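(* Let $n\ge 1$, $N:=2^n$, and consider the $n$-qubit bilinear control system $\Sigma_a$ $$\dot\rho(t) = -\big(i\hat H_{u}(t) + \Gamma_{\gamma(t)}\big)\rho(t),\qquad \rho(0)=\rho_0\in\mathfrak{P}_1,$$ where $H_u(t)=H_0+\sum_{j=1}^m u_j(t)H_j$, with the amplitude-damping Lindblad generator on the $n$-th qubit $V_a:=\mathbb{1}_2^{\otimes(n-1)}\otimes|0\rangle\langle 1|$. Assume: (i) $\langle iH_0, iH_1,\dots,iH_m\rangle_{\mathrm{Lie}}=\mathfrak{su}(N)$; (ii) $H_0$ is diagonal in the computational basis; (iii) the noise amplitude is a piecewise constant control $\gamma(t)\in\{0,\gamma_*\}$ for a fixed $\gamma_*>0$, and there are no other sources of decoherence. Then for every $\rho_0\in\mathfrak{P}_1$ the closure of the reachable set of $\Sigma_a$ is the set of all density operators: $$\overline{\mathfrak{Reach}_{\Sigma_a}(\rho_0)}=\mathfrak{P}_1,$$ i.e. for every $\rho_{\mathrm{target}}\in\mathfrak{P}_1$ and every $\varepsilon>0$ there are a time $T\ge 0$ and admissible controls such that $\|\rho(T)-\rho_{\mathrm{target}}\|<\varepsilon$ (in general the target is only reached in the limit $\gamma_*T\to\infty$).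
   Context: $\mathfrak{P}_1$ denotes the set of all density operators (positive semidefinite, trace one) on $(\mathbb{C}^2)^{\otimes n}$. For a Hermitian $H$, $\hat H$ is the commutator superoperator $\hat H\rho=[H,\rho]$. For a Lindblad generator $V$ and noise amplitude $\gamma\ge 0$, $\Gamma_\gamma(\rho):=-\gamma\big(V\rho V^\dagger-\tfrac12(V^\dagger V\rho+\rho V^\dagger V)\big)$. The Hamiltonians $H_0$ (drift) and $H_j$ (controls) are Hermitian $N\times N$ matrices; the control amplitudes $u_j(t)\in\mathbb{R}$ are piecewise constant and unbounded. The reachable set $\mathfrak{Reach}_{\Sigma}(\rho_0)$ is the set of all states $\rho(T)$, $T\ge 0$, obtainable as solutions of the system from $\rho_0$ under admissible controls; the bar denotes closure. *)

theory Defs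
  imports "HOL-Analysis.Analysis" "Jordan_Normal_Form.Schur_Decomposition"
begin

type_synonym cmat = "complex mat"

definition mtrace :: "cmat \<Rightarrow> complex" where
  "mtrace A = (\<Sum>i<dim_row A. A $$ (i,i))"

definition hermitian_mat :: "nat \<Rightarrow> cmat \<Rightarrow> bool" where
  "hermitian_mat N A \<longleftrightarrow> A \<in> carrier_mat N N \<and> mat_adjoint A = A"

definition commut :: "cmat \<Rightarrow> cmat \<Rightarrow> cmat" where
  "commut A B = A * B - B * A"

definition density_ops :: "nat \<Rightarrow> cmat set" where
  "density_ops N = {A. hermitian_mat N A \<and>
      (\<forall>v \<in> carrier_vec N. 0 \<le> (A *\<^sub>v v) \<bullet>c v) \<and> mtrace A = 1}"

definition su_alg :: "nat \<Rightarrow> cmat set" where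
  "su_alg N = {A. A \<in> carrier_mat N N \<and> mat_adjoint A = - A \<and> mtrace A = 0}"

inductive_set lie_gen :: "nat \<Rightarrow> cmat set \<Rightarrow> cmat set" for N S where
  gen: "A \<in> S \<Longrightarrow> A \<in> lie_gen N S"
| zero: "0\<^sub>m N N \<in> lie_gen N S"
| add: "A \<in> lie_gen N S \<Longrightarrow> B \<in> lie_gen N S \<Longrightarrow> A + B \<in> lie_gen N S"
| smult: "A \<in> lie_gen N S \<Longrightarrow> complex_of_real r \<cdot>\<^sub>m A \<in> lie_gen N S"
| bracket: "A \<in> lie_gen N S \<Longrightarrow> B \<in> lie_gen N S \<Longrightarrow> commut A B \<in> lie_gen N S"

text \<open>Amplitude-damping Lindblad operator on the n-th (last) qubit,
  V = 1^{(n-1)} \<otimes> |0><1|.  Computational basis index k <-> bit string with the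
  n-th qubit as least significant bit; entry (i,j) is 1 iff j = i + 1 and i is even.\<close>
definition V_ad :: "nat \<Rightarrow> cmat" where
  "V_ad n = mat (2^n) (2^n) (\<lambda>(i,j). if even i \<and> j = i + 1 then 1 else 0)"

definition ham :: "nat \<Rightarrow> (nat \<Rightarrow> cmat) \<Rightarrow> (nat \<Rightarrow> real) \<Rightarrow> cmat" where
  "ham m H u = foldr (\<lambda>j A. A + complex_of_real (u j) \<cdot>\<^sub>m H j) [1..<Suc m] (H 0)"

definition Gamma_op :: "cmat \<Rightarrow> real \<Rightarrow> cmat \<Rightarrow> cmat" where
  "Gamma_op V \<gamma> \<rho> = - (complex_of_real \<gamma> \<cdot>\<^sub>m
     (V * \<rho> * mat_adjoint V
       - (1/2 :: complex) \<cdot>\<^sub>m (mat_adjoint V * V * \<rho> + \<rho> * (mat_adjoint V * V))))"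

definition gen_rhs :: "nat \<Rightarrow> (nat \<Rightarrow> cmat) \<Rightarrow> cmat \<Rightarrow> (nat \<Rightarrow> real) \<Rightarrow> real \<Rightarrow> cmat \<Rightarrow> cmat" where
  "gen_rhs m H V u \<gamma> \<rho> = - (\<i> \<cdot>\<^sub>m commut (ham m H u) \<rho> + Gamma_op V \<gamma> \<rho>)"

definition piece_step :: "nat \<Rightarrow> nat \<Rightarrow> (nat \<Rightarrow> cmat) \<Rightarrow> cmat \<Rightarrow> (nat \<Rightarrow> real) \<Rightarrow> real
    \<Rightarrow> real \<Rightarrow> cmat \<Rightarrow> cmat \<Rightarrow> bool" where
  "piece_step N m H V u \<gamma> \<tau> \<rho>0 \<rho>1 \<longleftrightarrow> 0 \<le> \<tau> \<and>
     (\<exists>\<rho> :: real \<Rightarrow> cmat. \<rho> 0 = \<rho>0 \<and> \<rho> \<tau> = \<rho>1 \<and>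
        (\<forall>t\<in>{0..\<tau>}. \<rho> t \<in> carrier_mat N N \<and>
           (\<forall>i<N. \<forall>j<N. ((\<lambda>s. \<rho> s $$ (i,j)) has_vector_derivative
                 (gen_rhs m H V u \<gamma> (\<rho> t)) $$ (i,j)) (at t within {0..\<tau>}))))"

inductive_set reach :: "nat \<Rightarrow> nat \<Rightarrow> (nat \<Rightarrow> cmat) \<Rightarrow> cmat \<Rightarrow> real \<Rightarrow> cmat \<Rightarrow> cmat set"
  for N m H V \<gamma>s \<rho>0 where
  init: "\<rho>0 \<in> reach N m H V \<gamma>s \<rho>0"
| step: "\<rho> \<in> reach N m H V \<gamma>s \<rho>0 \<Longrightarrow> \<gamma> \<in> {0, \<gamma>s} \<Longrightarrow>
         piece_step N m H V u \<gamma> \<tau> \<rho> \<rho>' \<Longrightarrow> \<rho>' \<in> reach N m H V \<gamma>s \<rho>0"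

definition frob_norm :: "cmat \<Rightarrow> real" where
  "frob_norm A = sqrt (\<Sum>i<dim_row A. \<Sum>j<dim_col A. (cmod (A $$ (i,j)))\<^sup>2)"

end

theory Submission
  imports Defs "HOL-Combinatorics.Permutations"
begin

text \<open>The drift can be neither switched off nor reversed, so the controls generate only a
  forward semigroup, and exact reachability is lost in limits. Hence the argument works with
  closures from the start: linear flows depend continuously on the initial state, which makes
  approximate reachability transitive (\<open>closure_reachable_trans\<close>), and compactness then
  supplies inverses by recurrence. It is never shown that \<open>G\<close> contains all of SU(N).
  Only two consequences of su(N) being tangent to \<open>G\<close> are used: a maximiser over
  \<open>G\<close> is critical in every su(N) direction, and the plane rotations, as one-parameter
  groups with generator in su(N), lie in \<open>G\<close>. Both come from limits of difference
  quotients. Damping alone would empty an excited level only in infinite time. Here the pure state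
  appears as a maximiser over a compact set, so every damping step has finite duration. In the
  backward argument the support is first permuted to an initial segment; this guarantees a pair with
  both entries occupied and rules out an occupied odd entry above an empty even one, which could not
  arise from damping at all.\<close>

text \<open>
  Matrices of all sizes live in one normed algebra of finitely supported matrices, so that limits
  and derivatives can be taken without fixing the dimension \<open>N\<close> as a type.

  The unitaries \<open>U\<close> with \<open>U\<rho>U\<^sup>\<dagger>\<close> in the closed reachable set of every \<open>\<rho>\<close> form a compact
  semigroup, hence a compact group \<open>G\<close>. Its tangent vectors form a closed real Lie algebra containing
  all \<open>iH\<^sub>j\<close>, hence \<open>su(N)\<close>. Maximising \<open>tr(C U\<rho>U\<^sup>\<dagger>)\<close> over \<open>G\<close> diagonalises any Hermitian \<open>\<rho>\<close>
  within \<open>G\<close>, and rotations in coordinate planes give all permutations of the diagonal.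

  On diagonal states the noise, with the diagonal drift switched on, moves a fraction \<open>1 - \<lambda>\<close> of every
  odd entry to its even neighbour, for any \<open>\<lambda> \<in> (0,1]\<close>. A diagonal state in the closed reachable set
  with maximal first entry must therefore be pure. Conversely, after a permutation one can run
  the damping backwards from any diagonal target until an even entry vanishes, so induction on the
  size of the support shows that every diagonal state is reached from the pure one.

  Density operators are preserved because the flow is a limit of compositions of the positive maps
  \<open>\<rho> \<mapsto> (1 + sK)\<rho>(1 + sK)\<^sup>\<dagger> + s\<gamma>V\<rho>V\<^sup>\<dagger>\<close>.
\<close>


section \<open>Finitely supported complex matrices as a normed algebra\<close>

typedef fmat = "{f :: nat \<Rightarrow> nat \<Rightarrow> complex. \<exists>n. \<forall>i j. n \<le> i \<or> n \<le> j \<longrightarrow> f i j = 0}"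
  morphisms ent Abs_fmat
  by (rule exI[of _ "\<lambda>i j. 0"]) auto

setup_lifting type_definition_fmat

definition supp_on :: "nat \<Rightarrow> fmat set" where
  "supp_on n = {A. \<forall>i j. n \<le> i \<or> n \<le> j \<longrightarrow> ent A i j = 0}"

lemma supp_onD: "A \<in> supp_on n \<Longrightarrow> n \<le> i \<or> n \<le> j \<Longrightarrow> ent A i j = 0"
  by (auto simp: supp_on_def)

lemma fmat_eqI: "(\<And>i j. ent A i j = ent B i j) \<Longrightarrow> A = B"
  by (metis ent_inject ext)

lemma supp_eqI:
  assumes "A \<in> supp_on n" "B \<in> supp_on n" "\<And>i j. i < n \<Longrightarrow> j < n \<Longrightarrow> ent A i j = ent B i j"
  shows "A = B"
proof (rule fmat_eqI)
  fix i j
  show "ent A i j = ent B i j"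
    using assms supp_onD[of A n i j] supp_onD[of B n i j] by (cases "i < n \<and> j < n") auto
qed

lemma supp_on_mono: "A \<in> supp_on n \<Longrightarrow> n \<le> m \<Longrightarrow> A \<in> supp_on m"
  unfolding supp_on_def by (auto intro: order_trans)

lemma ex_supp_on: "\<exists>n. A \<in> supp_on n"
  using ent[of A] by (auto simp: supp_on_def)

lemma ex_supp_on2: "\<exists>n. A \<in> supp_on n \<and> B \<in> supp_on n"
proof -
  obtain k m where "A \<in> supp_on k" "B \<in> supp_on m" using ex_supp_on by blast
  thus ?thesis by (intro exI[of _ "max k m"]) (auto intro: supp_on_mono)
qed

lemma ex_supp_on3: "\<exists>n. A \<in> supp_on n \<and> B \<in> supp_on n \<and> C \<in> supp_on n"
proof -
  obtain k m where "A \<in> supp_on k" "B \<in> supp_on k" "C \<in> supp_on m"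
    using ex_supp_on ex_supp_on2 by blast
  thus ?thesis by (intro exI[of _ "max k m"]) (auto intro: supp_on_mono)
qed

lift_definition cutoff :: "nat \<Rightarrow> (nat \<Rightarrow> nat \<Rightarrow> complex) \<Rightarrow> fmat"
  is "\<lambda>n f i j. if i < n \<and> j < n then f i j else 0"
  by (rename_tac n f, rule_tac x=n in exI) auto

lemma ent_cutoff [simp]: "ent (cutoff n f) i j = (if i < n \<and> j < n then f i j else 0)"
  by transfer simp

lemma cutoff_supp [simp]: "cutoff n f \<in> supp_on n"
  by (auto simp: supp_on_def)

instantiation fmat :: ab_group_add
begin
lift_definition zero_fmat :: fmat is "\<lambda>i j. 0" by auto
lift_definition plus_fmat :: "fmat \<Rightarrow> fmat \<Rightarrow> fmat" is "\<lambda>f g i j. f i j + g i j"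
  by (auto, rename_tac n m, rule_tac x="max n m" in exI) auto
lift_definition minus_fmat :: "fmat \<Rightarrow> fmat \<Rightarrow> fmat" is "\<lambda>f g i j. f i j - g i j"
  by (auto, rename_tac n m, rule_tac x="max n m" in exI) auto
lift_definition uminus_fmat :: "fmat \<Rightarrow> fmat" is "\<lambda>f i j. - f i j"
  by auto
instance by standard (transfer; auto simp: fun_eq_iff)+
end

lemma ent_simps [simp]:
  "ent 0 i j = 0" "ent (A + B) i j = ent A i j + ent B i j"
  "ent (A - B) i j = ent A i j - ent B i j" "ent (- A) i j = - ent A i j"
  by (transfer; simp)+

lemma ent_sum [simp]: "ent (\<Sum>x\<in>S. F x) i j = (\<Sum>x\<in>S. ent (F x) i j)"
  by (induction S rule: infinite_finite_induct) auto

lift_definition csc :: "complex \<Rightarrow> fmat \<Rightarrow> fmat" is "\<lambda>z f i j. z * f i j"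
  by auto

lemma ent_csc [simp]: "ent (csc z A) i j = z * ent A i j"
  by transfer simp

lift_definition adj :: "fmat \<Rightarrow> fmat" is "\<lambda>f i j. cnj (f j i)"
  by auto

lemma ent_adj [simp]: "ent (adj A) i j = cnj (ent A j i)"
  by transfer simp

instantiation fmat :: real_normed_algebra
begin

text \<open>Summing over the finitely many nonzero entries of a row of the left factor makes the
  product independent of a dimension. \<open>ent_mult\<close> and \<open>ent_mult'\<close> return
  the usual sum below any bound on the support of one factor.\<close>

lift_definition times_fmat :: "fmat \<Rightarrow> fmat \<Rightarrow> fmat"
  is "\<lambda>f g i j. \<Sum>k | f i k \<noteq> 0. f i k * g k j"
  by (auto, rename_tac n m, rule_tac x="max n m" in exI) (auto intro!: sum.neutral)

definition scaleR_fmat :: "real \<Rightarrow> fmat \<Rightarrow> fmat" where "scaleR_fmat r A = csc (of_real r) A"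

text \<open>The entrywise l1 norm: submultiplicative, and unaffected by enlarging the block in which
  a matrix is viewed.\<close>

definition norm_fmat :: "fmat \<Rightarrow> real" where
  "norm_fmat A = (\<Sum>(i,j) | ent A i j \<noteq> 0. cmod (ent A i j))"

definition dist_fmat :: "fmat \<Rightarrow> fmat \<Rightarrow> real" where "dist_fmat A B = norm (A - B)"

definition sgn_fmat :: "fmat \<Rightarrow> fmat" where "sgn_fmat A = inverse (norm A) *\<^sub>R A"

definition uniformity_fmat :: "(fmat \<times> fmat) filter" where
  "uniformity_fmat = (INF e\<in>{0 <..}. principal {(x, y). dist x y < e})"

definition open_fmat :: "fmat set \<Rightarrow> bool" where
  "open_fmat S \<longleftrightarrow> (\<forall>x\<in>S. \<forall>\<^sub>F (x', y) in uniformity. x' = x \<longrightarrow> y \<in> S)"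

lemma norm_supp: "A \<in> supp_on n \<Longrightarrow> norm A = (\<Sum>i<n. \<Sum>j<n. cmod (ent A i j))"
  unfolding norm_fmat_def sum.cartesian_product
  by (rule sum.mono_neutral_left) (auto simp: supp_on_def intro: leI)

lemma ent_mult: "A \<in> supp_on n \<Longrightarrow> ent (A * B) i j = (\<Sum>k<n. ent A i k * ent B k j)"
  unfolding supp_on_def
  apply (transfer fixing: n i j)
  by (rule sum.mono_neutral_left) (auto intro: leI)

lemma ent_mult': "B \<in> supp_on n \<Longrightarrow> ent (A * B) i j = (\<Sum>k<n. ent A i k * ent B k j)"
proof -
  assume B: "B \<in> supp_on n"
  obtain m where m: "A \<in> supp_on m" "B \<in> supp_on m" using ex_supp_on2 by blast
  let ?f = "\<lambda>k. ent A i k * ent B k j"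
  have "(\<Sum>k<m. ?f k) = sum ?f {..<max m n}"
    by (rule sum.mono_neutral_left) (use m in \<open>auto simp: supp_onD\<close>)
  also have "\<dots> = (\<Sum>k<n. ?f k)"
    by (rule sum.mono_neutral_right) (use B in \<open>auto simp: supp_onD\<close>)
  finally show ?thesis using ent_mult[OF m(1)] by simp
qed

lemma supp_simps [simp, intro]:
  "0 \<in> supp_on n" "A \<in> supp_on n \<Longrightarrow> B \<in> supp_on n \<Longrightarrow> A + B \<in> supp_on n"
  "A \<in> supp_on n \<Longrightarrow> B \<in> supp_on n \<Longrightarrow> A - B \<in> supp_on n"
  "A \<in> supp_on n \<Longrightarrow> - A \<in> supp_on n" "A \<in> supp_on n \<Longrightarrow> csc z A \<in> supp_on n"
  "A \<in> supp_on n \<Longrightarrow> adj A \<in> supp_on n" "A \<in> supp_on n \<Longrightarrow> r *\<^sub>R A \<in> supp_on n"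
  by (auto simp: supp_on_def scaleR_fmat_def)

lemma supp_mult [simp, intro]: "A \<in> supp_on n \<Longrightarrow> B \<in> supp_on n \<Longrightarrow> A * B \<in> supp_on n"
  by (subst supp_on_def) (auto simp: ent_mult supp_onD intro!: sum.neutral)

instance
proof
  fix A B C :: fmat and r s :: real
  obtain n where n: "A \<in> supp_on n" "B \<in> supp_on n" "C \<in> supp_on n" using ex_supp_on3 by blast
  show "A * B * C = A * (B * C)"
  proof (rule fmat_eqI)
    fix i j
    have "ent (A * B * C) i j = (\<Sum>k<n. \<Sum>l<n. ent A i l * ent B l k * ent C k j)"
      using n by (simp add: ent_mult[of _ n] sum_distrib_right)
    also have "\<dots> = (\<Sum>l<n. \<Sum>k<n. ent A i l * ent B l k * ent C k j)" by (rule sum.swap)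
    also have "\<dots> = ent (A * (B * C)) i j"
      using n by (simp add: ent_mult[of _ n] sum_distrib_left mult.assoc)
    finally show "ent (A * B * C) i j = ent (A * (B * C)) i j" .
  qed
  show "(A + B) * C = A * C + B * C" "A * (B + C) = A * B + A * C"
    using n by (auto intro!: fmat_eqI simp: ent_mult[of _ n] distrib_left distrib_right sum.distrib)
  show "r *\<^sub>R (A + B) = r *\<^sub>R A + r *\<^sub>R B" "(r + s) *\<^sub>R A = r *\<^sub>R A + s *\<^sub>R A"
    "r *\<^sub>R s *\<^sub>R A = (r * s) *\<^sub>R A" "1 *\<^sub>R A = A"
    by (auto intro!: fmat_eqI simp: scaleR_fmat_def distrib_left distrib_right)
  show "(r *\<^sub>R A) * B = r *\<^sub>R (A * B)" "A * r *\<^sub>R B = r *\<^sub>R (A * B)"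
    using n by (auto intro!: fmat_eqI simp: ent_mult[of _ n] scaleR_fmat_def sum_distrib_left mult.assoc mult.left_commute)
  show "(norm A = 0) = (A = 0)"
  proof
    assume "norm A = 0"
    hence "\<forall>i<n. \<forall>j<n. ent A i j = 0"
      using norm_supp[OF n(1)] by (simp add: sum_nonneg_eq_0_iff sum_nonneg)
    thus "A = 0" using n(1) by (intro supp_eqI[of A n]) auto
  qed (simp add: norm_fmat_def)
  show "norm (A + B) \<le> norm A + norm B"
  proof -
    have "norm (A + B) = (\<Sum>i<n. \<Sum>j<n. cmod (ent A i j + ent B i j))"
      using n by (simp add: norm_supp[of _ n])
    also have "\<dots> \<le> (\<Sum>i<n. \<Sum>j<n. cmod (ent A i j) + cmod (ent B i j))"
      by (intro sum_mono norm_triangle_ineq)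
    also have "\<dots> = norm A + norm B"
      using n by (simp add: norm_supp[of _ n] sum.distrib)
    finally show ?thesis .
  qed
  show "norm (r *\<^sub>R A) = \<bar>r\<bar> * norm A"
  proof -
    have "norm (r *\<^sub>R A) = (\<Sum>i<n. \<Sum>j<n. cmod (of_real r * ent A i j))"
      using n by (simp only: norm_supp[of _ n] supp_simps scaleR_fmat_def ent_csc)
    thus ?thesis using n by (simp add: norm_supp[of _ n] norm_mult sum_distrib_left)
  qed
  show "norm (A * B) \<le> norm A * norm B"
  proof -
    have "norm (A * B) = (\<Sum>i<n. \<Sum>j<n. cmod (\<Sum>k<n. ent A i k * ent B k j))"
      using n by (simp add: norm_supp[of _ n] ent_mult[of _ n])
    also have "\<dots> \<le> (\<Sum>i<n. \<Sum>j<n. \<Sum>k<n. cmod (ent A i k) * cmod (ent B k j))"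
      by (intro sum_mono, rule order_trans[OF norm_sum]) (simp add: norm_mult)
    also have "\<dots> = (\<Sum>i<n. \<Sum>k<n. cmod (ent A i k) * (\<Sum>j<n. cmod (ent B k j)))"
      by (rule sum.cong[OF refl], subst sum.swap) (simp add: sum_distrib_left)
    also have "\<dots> \<le> (\<Sum>i<n. \<Sum>k<n. cmod (ent A i k) * norm B)"
    proof (intro sum_mono mult_left_mono)
      fix k assume "k \<in> {..<n}"
      thus "(\<Sum>j<n. cmod (ent B k j)) \<le> norm B"
        unfolding norm_supp[OF n(2)]
        by (intro member_le_sum[of k _ "\<lambda>k. \<Sum>j<n. cmod (ent B k j)"]) (auto intro: sum_nonneg)
    qed simp
    also have "\<dots> = norm A * norm B" using n by (simp add: norm_supp[of _ n] sum_distrib_right)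
    finally show ?thesis .
  qed
qed (simp_all add: dist_fmat_def sgn_fmat_def uniformity_fmat_def open_fmat_def)

end

lemma ent_scaleR [simp]: "ent (r *\<^sub>R A) i j = of_real r * ent A i j"
  by (simp add: scaleR_fmat_def)

lemma norm_csc [simp]: "norm (csc z A) = cmod z * norm A"
proof -
  obtain n where "A \<in> supp_on n" using ex_supp_on by blast
  thus ?thesis by (simp add: norm_supp[of _ n] sum_distrib_left norm_mult)
qed

lemma cmod_ent_le_norm: "cmod (ent A i j) \<le> norm A"
proof -
  obtain n where n: "A \<in> supp_on n" using ex_supp_on by blast
  show ?thesis
  proof (cases "i < n \<and> j < n")
    case True
    have "cmod (ent A i j) \<le> (\<Sum>j<n. cmod (ent A i j))"
      using True by (intro member_le_sum[of j _ "\<lambda>j. cmod (ent A i j)"]) auto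
    also have "\<dots> \<le> norm A" using True unfolding norm_supp[OF n]
      by (intro member_le_sum[of i _ "\<lambda>i. \<Sum>j<n. cmod (ent A i j)"]) (auto intro: sum_nonneg)
    finally show ?thesis .
  qed (use supp_onD[OF n, of i j] in \<open>auto simp: not_less\<close>)
qed

lemma norm_adj [simp]: "norm (adj A) = norm A"
proof -
  obtain n where "A \<in> supp_on n" using ex_supp_on by blast
  thus ?thesis by (simp add: norm_supp[of _ n]) (rule sum.swap)
qed

lemma bounded_linear_ent: "bounded_linear (\<lambda>A. ent A i j)"
  by (rule bounded_linear_intro[where K=1]) (auto simp: scaleR_conv_of_real cmod_ent_le_norm)

lemma adj_simps [simp]:
  "adj (A + B) = adj A + adj B" "adj (A - B) = adj A - adj B" "adj (- A) = - adj A"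
  "adj 0 = 0" "adj (csc z A) = csc (cnj z) (adj A)" "adj (r *\<^sub>R A) = r *\<^sub>R adj A"
  "adj (adj A) = A"
  by (auto intro: fmat_eqI)

lemma adj_mult [simp]: "adj (A * B) = adj B * adj A"
proof -
  obtain n where n: "A \<in> supp_on n" "B \<in> supp_on n" using ex_supp_on2 by blast
  thus ?thesis by (intro fmat_eqI) (simp add: ent_mult[of _ n] mult.commute)
qed

lemma bounded_linear_adj: "bounded_linear adj"
  by (rule bounded_linear_intro[where K=1]) auto

lemma csc_simps [simp]:
  "csc z A * B = csc z (A * B)" "A * csc z B = csc z (A * B)"
  "csc z (csc w A) = csc (z * w) A" "csc 1 A = A" "csc 0 A = 0" "csc z 0 = 0"
  "csc z (- A) = - csc z A" "csc (- z) A = - csc z A" "csc z (r *\<^sub>R A) = r *\<^sub>R csc z A"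
proof -
  obtain n where n: "A \<in> supp_on n" "B \<in> supp_on n" using ex_supp_on2 by blast
  thus "csc z A * B = csc z (A * B)" "A * csc z B = csc z (A * B)"
    by (auto intro!: fmat_eqI simp: ent_mult[of _ n] sum_distrib_left mult_ac)
qed (auto intro!: fmat_eqI)

lemma csc_add: "csc z (A + B) = csc z A + csc z B"
  by (auto intro!: fmat_eqI simp: algebra_simps)

lemma csc_diff: "csc z (A - B) = csc z A - csc z B"
  by (auto intro!: fmat_eqI simp: algebra_simps)

lemma csc_add_left: "csc (z + w) A = csc z A + csc w A"
  by (auto intro!: fmat_eqI simp: algebra_simps)

lemma csc_of_real [simp]: "csc (of_real r) A = r *\<^sub>R A"
  by (simp add: scaleR_fmat_def)

lemma bounded_linear_csc: "bounded_linear (csc z)"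
  by (rule bounded_linear_intro[where K="cmod z"]) (auto simp: csc_add mult.commute)

lemma bounded_linear_csc_left: "bounded_linear (\<lambda>z. csc z A)"
  by (rule bounded_linear_intro[where K="norm A"]) (auto simp: csc_add_left intro!: fmat_eqI simp: scaleR_conv_of_real)

lemmas fmat_tendsto [tendsto_intros] =
  bounded_linear.tendsto[OF bounded_linear_ent] bounded_linear.tendsto[OF bounded_linear_adj]
  bounded_linear.tendsto[OF bounded_linear_csc]

lemmas fmat_continuous_on [continuous_intros] =
  bounded_linear.continuous_on[OF bounded_linear_ent] bounded_linear.continuous_on[OF bounded_linear_adj]
  bounded_linear.continuous_on[OF bounded_linear_csc]

lemma closed_supp_on: "closed (supp_on n)"
proof -
  have "supp_on n = (\<Inter>i. \<Inter>j. if n \<le> i \<or> n \<le> j then {A. ent A i j = 0} else UNIV)"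
    by (auto simp: supp_on_def split: if_splits)
  moreover have "closed {A. ent A i j = 0}" for i j
    by (intro closed_Collect_eq continuous_intros)
  ultimately show ?thesis by (auto intro!: closed_INT)
qed

text \<open>The algebra itself has no unit; \<open>idm n\<close> below is the unit of the \<open>n\<close>-by-\<open>n\<close> block.\<close>

definition munit :: "nat \<Rightarrow> nat \<Rightarrow> fmat" where
  "munit p q = cutoff (Suc (max p q)) (\<lambda>i j. if i = p \<and> j = q then 1 else 0)"

lemma ent_munit [simp]: "ent (munit p q) i j = (if i = p \<and> j = q then 1 else 0)"
  by (auto simp: munit_def)

lemma munit_supp [simp, intro]: "p < n \<Longrightarrow> q < n \<Longrightarrow> munit p q \<in> supp_on n"
  by (auto simp: supp_on_def)

definition idm :: "nat \<Rightarrow> fmat" where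
  "idm n = cutoff n (\<lambda>i j. if i = j then 1 else 0)"

lemma ent_idm [simp]: "ent (idm n) i j = (if i = j \<and> i < n then 1 else 0)"
  by (auto simp: idm_def)

lemma idm_supp [simp, intro]: "idm n \<in> supp_on n"
  by (simp add: idm_def)

lemma adj_idm [simp]: "adj (idm n) = idm n"
  by (auto intro: fmat_eqI)

lemma idm_mult [simp]: "A \<in> supp_on n \<Longrightarrow> idm n * A = A" "A \<in> supp_on n \<Longrightarrow> A * idm n = A"
proof -
  assume A: "A \<in> supp_on n"
  have "(\<Sum>k<n. (if i = k \<and> i < n then 1 else 0) * ent A k j) = ent A i j" for i j
    using supp_onD[OF A, of i j] by (cases "i < n") (auto simp: if_distrib[of "\<lambda>x. x * _"] sum.delta cong: if_cong)
  thus "idm n * A = A" by (intro fmat_eqI) (simp add: ent_mult[OF idm_supp])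
  have "(\<Sum>k<n. ent A i k * (if k = j \<and> k < n then 1 else 0)) = ent A i j" for i j
    using supp_onD[OF A, of i j] by (cases "j < n") (auto simp: if_distrib[of "\<lambda>x. _ * x"] sum.delta cong: if_cong)
  thus "A * idm n = A" by (intro fmat_eqI) (simp add: ent_mult[OF A])
qed

lemma sum_delta_pair:
  fixes n :: nat
  shows "p < n \<Longrightarrow> q < n \<Longrightarrow> (\<Sum>i<n. \<Sum>j<n. if p = i \<and> q = j then f i j else 0) = (f p q :: 'a :: comm_monoid_add)"
proof -
  assume "p < n" "q < n"
  have "(\<Sum>i<n. \<Sum>j<n. if p = i \<and> q = j then f i j else 0) = (\<Sum>i<n. if p = i then f i q else 0)"
    using \<open>q < n\<close> by (intro sum.cong) (auto simp: sum.delta)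
  thus ?thesis using \<open>p < n\<close> by simp
qed

lemma munit_expand:
  assumes "A \<in> supp_on n"
  shows "A = (\<Sum>i<n. \<Sum>j<n. csc (ent A i j) (munit i j))"
proof (rule fmat_eqI)
  fix p q
  have "(\<Sum>i<n. \<Sum>j<n. ent A i j * (if p = i \<and> q = j then 1 else 0)) = ent A p q"
  proof (cases "p < n \<and> q < n")
    case True
    thus ?thesis using sum_delta_pair[of p n q "ent A"]
      by (simp add: if_distrib[of "\<lambda>x. _ * x"] cong: if_cong)
  next
    case False
    hence "ent A p q = 0" using supp_onD[OF assms] by (auto simp: not_less)
    thus ?thesis using False by (auto intro!: sum.neutral)
  qed
  thus "ent A p q = ent (\<Sum>i<n. \<Sum>j<n. csc (ent A i j) (munit i j)) p q" by simp
qed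

section \<open>Trace and the Frobenius form\<close>

definition tr :: "fmat \<Rightarrow> complex" where "tr A = (\<Sum>i | ent A i i \<noteq> 0. ent A i i)"

lemma tr_supp: "A \<in> supp_on n \<Longrightarrow> tr A = (\<Sum>i<n. ent A i i)"
  unfolding tr_def by (rule sum.mono_neutral_left) (auto simp: supp_on_def intro: leI)

lemma tr_simps [simp]:
  "tr (A + B) = tr A + tr B" "tr (A - B) = tr A - tr B" "tr (- A) = - tr A" "tr 0 = 0"
  "tr (csc z A) = z * tr A" "tr (r *\<^sub>R A) = of_real r * tr A"
proof -
  obtain n where n: "A \<in> supp_on n" "B \<in> supp_on n" using ex_supp_on2 by blast
  thus "tr (A + B) = tr A + tr B" "tr (A - B) = tr A - tr B" "tr (- A) = - tr A" "tr 0 = 0"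
    "tr (csc z A) = z * tr A" "tr (r *\<^sub>R A) = of_real r * tr A"
    by (auto simp: tr_supp[of _ n] sum.distrib sum_subtractf sum_negf sum_distrib_left)
qed

lemma tr_commute: "tr (A * B) = tr (B * A)"
proof -
  obtain n where n: "A \<in> supp_on n" "B \<in> supp_on n" using ex_supp_on2 by blast
  hence "tr (A * B) = (\<Sum>i<n. \<Sum>k<n. ent A i k * ent B k i)"
    by (simp add: tr_supp[of _ n] ent_mult[of _ n])
  also have "\<dots> = (\<Sum>k<n. \<Sum>i<n. ent A i k * ent B k i)" by (rule sum.swap)
  also have "\<dots> = tr (B * A)" using n by (simp add: tr_supp[of _ n] ent_mult[of _ n] mult.commute)
  finally show ?thesis .
qed

lemma norm_tr_le: "cmod (tr A) \<le> norm A"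
proof -
  obtain n where n: "A \<in> supp_on n" using ex_supp_on by blast
  have "cmod (tr A) \<le> (\<Sum>i<n. cmod (ent A i i))" by (simp add: tr_supp[OF n] norm_sum)
  also have "\<dots> \<le> norm A" unfolding norm_supp[OF n]
  proof (rule sum_mono)
    fix i assume "i \<in> {..<n}"
    thus "cmod (ent A i i) \<le> (\<Sum>j<n. cmod (ent A i j))"
      by (intro member_le_sum[of i _ "\<lambda>j. cmod (ent A i j)"]) auto
  qed
  finally show ?thesis .
qed

lemma bounded_linear_tr: "bounded_linear tr"
  by (rule bounded_linear_intro[where K=1]) (auto simp: scaleR_conv_of_real norm_tr_le)

lemmas [tendsto_intros] = bounded_linear.tendsto[OF bounded_linear_tr]
lemmas [continuous_intros] = bounded_linear.continuous_on[OF bounded_linear_tr]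

lemma tr_adj_mult_self: "A \<in> supp_on n \<Longrightarrow> tr (A * adj A) = of_real (\<Sum>i<n. \<Sum>j<n. (cmod (ent A i j))\<^sup>2)"
  by (simp add: tr_supp[of _ n] ent_mult[of _ n] complex_norm_square del: of_real_power)

text \<open>The trace is the sum of the squared moduli of all entries. An upper bound by zero is the
  form in which a first-variation inequality delivers the vanishing of a commutator.\<close>

lemma tr_adj_mult_self_le_0:
  assumes "Re (tr (A * adj A)) \<le> 0" shows "A = 0"
proof -
  obtain n where n: "A \<in> supp_on n" using ex_supp_on by blast
  have "(\<Sum>i<n. \<Sum>j<n. (cmod (ent A i j))\<^sup>2) = 0"
    using assms unfolding tr_adj_mult_self[OF n] Re_complex_of_real
    by (rule antisym) (intro sum_nonneg zero_le_power2)
  hence "\<forall>i<n. \<forall>j<n. ent A i j = 0" by (simp add: sum_nonneg_eq_0_iff sum_nonneg)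
  thus ?thesis using n by (intro supp_eqI[of A n]) auto
qed

text \<open>Heine--Borel, adding one matrix entry at a time.\<close>

lemma compact_bounded_entries:
  assumes "finite S"
  shows "compact {A. (\<forall>i j. (i,j) \<notin> S \<longrightarrow> ent A i j = 0) \<and> (\<forall>i j. cmod (ent A i j) \<le> b)}"
    (is "compact (?K S)")
proof (cases "b < 0")
  case True
  have "?K S = {}"
  proof (rule equals0I)
    fix A assume "A \<in> ?K S"
    hence "cmod (ent A 0 0) \<le> b" by simp
    thus False using True norm_ge_zero[of "ent A 0 0"] by linarith
  qed
  thus ?thesis by (simp only: compact_empty)
next
  case False
  show ?thesis using assms
  proof (induction S)
    case empty
    have "?K {} \<subseteq> {0}"
    proof
      fix A assume "A \<in> ?K {}"
      hence "A = 0" by (intro fmat_eqI) simp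
      thus "A \<in> {0}" by simp
    qed
    thus ?case by (rule finite_imp_compact[OF finite_subset]) simp
  next
    case (insert p S)
    obtain a c where p: "p = (a,c)" by force
    let ?g = "\<lambda>zA. csc (fst zA) (munit a c) + snd zA"
    have sub: "A \<in> ?g ` (cball 0 b \<times> ?K S)" if A: "A \<in> ?K (insert p S)" for A
    proof (rule image_eqI)
      let ?B = "A - csc (ent A a c) (munit a c)"
      show "A = ?g (ent A a c, ?B)" by simp
      have "(i,j) \<notin> insert p S \<Longrightarrow> ent A i j = 0" "cmod (ent A i j) \<le> b" for i j
        using A by simp_all
      moreover have "ent ?B i j = (if (i,j) = p then 0 else ent A i j)" for i j
        by (simp add: p)
      ultimately show "(ent A a c, ?B) \<in> cball 0 b \<times> ?K S"
        using False by (simp add: mem_Times_iff)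
    qed
    have sup: "A \<in> ?K (insert p S)" if A: "A \<in> ?g ` (cball 0 b \<times> ?K S)" for A
    proof -
      obtain x where x: "A = ?g x" "x \<in> cball 0 b \<times> ?K S" using A by (rule imageE)
      define z B where "z = fst x" and "B = snd x"
      have zB: "A = csc z (munit a c) + B" "cmod z \<le> b" "B \<in> ?K S"
        using x by (simp_all only: z_def B_def mem_Times_iff mem_cball_0 fst_conv snd_conv)
      have B: "(i,j) \<notin> S \<Longrightarrow> ent B i j = 0" "cmod (ent B i j) \<le> b" for i j
        using zB(3) by simp_all
      have "ent A i j = (if (i,j) = p then z else ent B i j)" for i j
        using B(1)[of i j] insert.hyps by (auto simp: zB(1) p)
      thus ?thesis using B zB(2) by simp
    qed
    from sub sup have "?K (insert p S) = ?g ` (cball 0 b \<times> ?K S)" by (intro equalityI subsetI)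
    moreover have "compact (?g ` (cball 0 b \<times> ?K S))"
      by (intro compact_continuous_image compact_Times insert.IH compact_cball continuous_intros
          bounded_linear.continuous_on[OF bounded_linear_csc_left])
    ultimately show ?case by simp
  qed
qed

lemma compact_supp_bounded:
  assumes "closed S" "S \<subseteq> supp_on n" "\<And>A i j. A \<in> S \<Longrightarrow> cmod (ent A i j) \<le> b"
  shows "compact S"
proof -
  let ?K = "{A. (\<forall>i j. (i,j) \<notin> {..<n} \<times> {..<n} \<longrightarrow> ent A i j = 0) \<and> (\<forall>i j. cmod (ent A i j) \<le> b)}"
  have "compact ?K" by (rule compact_bounded_entries) simp
  hence "compact (?K \<inter> S)" using assms(1) by (rule compact_Int_closed)
  moreover have "S \<subseteq> ?K"
  proof
    fix A assume A: "A \<in> S"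
    have "(i,j) \<notin> {..<n} \<times> {..<n} \<Longrightarrow> ent A i j = 0" for i j
      using A assms(2) supp_onD[of A n i j] by (auto simp: not_less)
    thus "A \<in> ?K" using assms(3)[OF A] by simp
  qed
  ultimately show ?thesis by (simp only: Int_absorb1)
qed



section \<open>Linear differential equations for matrices\<close>

text \<open>With the support confined to a fixed block, the curve is a finite combination of matrix
  units, so entrywise derivatives assemble into a derivative in norm. The system to be studied
  states its equation entrywise.\<close>

lemma has_vector_derivative_fmat:
  assumes x: "\<And>s. s \<in> S \<Longrightarrow> x s \<in> supp_on n" and D: "D \<in> supp_on n" and t: "t \<in> S"
    and der: "\<And>i j. i < n \<Longrightarrow> j < n \<Longrightarrow>
      ((\<lambda>s. ent (x s) i j) has_vector_derivative ent D i j) (at t within S)"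
  shows "(x has_vector_derivative D) (at t within S)"
proof -
  have "((\<lambda>s. \<Sum>i<n. \<Sum>j<n. csc (ent (x s) i j) (munit i j)) has_vector_derivative
      (\<Sum>i<n. \<Sum>j<n. csc (ent D i j) (munit i j))) (at t within S)"
    by (intro has_vector_derivative_sum bounded_linear.has_vector_derivative[OF bounded_linear_csc_left] der)
      simp_all
  hence "((\<lambda>s. \<Sum>i<n. \<Sum>j<n. csc (ent (x s) i j) (munit i j)) has_vector_derivative D) (at t within S)"
    by (simp only: munit_expand[OF D, symmetric])
  thus ?thesis by (rule has_vector_derivative_transform[OF t, rotated]) (rule munit_expand[OF x])
qed

section \<open>Existence of solutions by the exponential series\<close>

primrec coeff_pow :: "'i set \<Rightarrow> ('i \<Rightarrow> 'i \<Rightarrow> complex) \<Rightarrow> nat \<Rightarrow> 'i \<Rightarrow> 'i \<Rightarrow> complex" where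
  "coeff_pow I L 0 = (\<lambda>i j. if i = j then 1 else 0)"
| "coeff_pow I L (Suc k) = (\<lambda>i j. \<Sum>l\<in>I. L i l * coeff_pow I L k l j)"

lemma coeff_pow_bound:
  assumes "finite I" "i \<in> I"
  shows "cmod (coeff_pow I L k i j) \<le> (\<Sum>i\<in>I. \<Sum>l\<in>I. cmod (L i l)) ^ k" (is "_ \<le> ?c ^ k")
  using assms(2)
proof (induction k arbitrary: i)
  case 0
  thus ?case by simp
next
  case (Suc k)
  have c0: "0 \<le> ?c" by (intro sum_nonneg norm_ge_zero)
  have "cmod (coeff_pow I L (Suc k) i j) \<le> (\<Sum>l\<in>I. cmod (L i l) * cmod (coeff_pow I L k l j))"
    by (simp add: norm_mult sum_norm_le)
  also have "\<dots> \<le> (\<Sum>l\<in>I. cmod (L i l) * ?c ^ k)"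
    by (intro sum_mono mult_left_mono Suc.IH) simp_all
  also have "\<dots> = (\<Sum>l\<in>I. cmod (L i l)) * ?c ^ k" by (simp add: sum_distrib_right)
  also have "\<dots> \<le> ?c * ?c ^ k"
    using Suc.prems assms(1) c0
    by (intro mult_right_mono member_le_sum[of i I "\<lambda>i. \<Sum>l\<in>I. cmod (L i l)"])
      (simp_all add: sum_nonneg)
  finally show ?case by simp
qed

text \<open>The series of \<open>t^k L^k / k!\<close> is summed entry by entry in the complex
  numbers, because the space of all finitely supported matrices is not complete. Termwise
  differentiation gives the equation.\<close>

lemma linear_ode_fundamental_solution:
  fixes L :: "'i \<Rightarrow> 'i \<Rightarrow> complex"
  assumes I: "finite I"
  shows "\<exists>E. \<forall>i\<in>I. \<forall>j\<in>I. E 0 i j = (if i = j then 1 else 0) \<and>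
    (\<forall>t. ((\<lambda>s. E s i j) has_vector_derivative (\<Sum>l\<in>I. L i l * E t l j)) (at t))"
proof -
  define c where "c i j k = coeff_pow I L k i j / of_nat (fact k)" for i j k
  define E where "E t i j = (\<Sum>k. c i j k * complex_of_real t ^ k)" for t i j
  let ?c = "\<Sum>i\<in>I. \<Sum>l\<in>I. cmod (L i l)"
  have c0: "0 \<le> ?c" by (intro sum_nonneg norm_ge_zero)
  have summ: "summable (\<lambda>k. c i j k * y ^ k)" if i: "i \<in> I" for i j y
  proof (rule summable_comparison_test')
    show "summable (\<lambda>k. (?c * cmod y) ^ k / fact k)"
      using summable_exp[of "?c * cmod y"] by (simp add: field_simps)
    fix k
    have "cmod (c i j k * y ^ k) = cmod (coeff_pow I L k i j) * (cmod y ^ k / fact k)"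
      by (simp add: c_def norm_mult norm_divide norm_power)
    also have "\<dots> \<le> ?c ^ k * (cmod y ^ k / fact k)"
      by (intro mult_right_mono coeff_pow_bound I i) simp
    finally show "norm (c i j k * y ^ k) \<le> (?c * cmod y) ^ k / fact k"
      by (simp add: power_mult_distrib)
  qed
  have der: "((\<lambda>s. E s i j) has_vector_derivative (\<Sum>l\<in>I. L i l * E t l j)) (at t)"
    if i: "i \<in> I" for i j t
  proof -
    have "((\<lambda>x. \<Sum>k. c i j k * x ^ k) has_field_derivative
        (\<Sum>k. diffs (c i j) k * of_real t ^ k)) (at (of_real t))"
      by (rule termdiffs_strong_converges_everywhere) (rule summ[OF i])
    hence "((\<lambda>s. E s i j) has_vector_derivative (\<Sum>k. diffs (c i j) k * of_real t ^ k)) (at t)"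
      unfolding E_def by (rule has_vector_derivative_real_field)
    also have "(\<lambda>k. diffs (c i j) k * of_real t ^ k) = (\<lambda>k. \<Sum>l\<in>I. L i l * (c l j k * of_real t ^ k))"
    proof
      fix k
      have "diffs (c i j) k = coeff_pow I L (Suc k) i j / of_nat (fact k)"
        unfolding diffs_def c_def fact_Suc of_nat_mult by (simp del: of_nat_Suc)
      also have "\<dots> = (\<Sum>l\<in>I. L i l * c l j k)" by (simp add: c_def sum_divide_distrib)
      finally show "diffs (c i j) k * of_real t ^ k = (\<Sum>l\<in>I. L i l * (c l j k * of_real t ^ k))"
        by (simp add: sum_distrib_right mult.assoc)
    qed
    also have "(\<Sum>k. \<Sum>l\<in>I. L i l * (c l j k * of_real t ^ k)) =
        (\<Sum>l\<in>I. \<Sum>k. L i l * (c l j k * of_real t ^ k))"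
      by (rule suminf_sum) (intro summable_mult summ)
    also have "\<dots> = (\<Sum>l\<in>I. L i l * E t l j)"
      unfolding E_def by (intro sum.cong refl suminf_mult summ)
    finally show ?thesis .
  qed
  have "E 0 i j = (if i = j then 1 else 0)" for i j
  proof -
    have "E 0 i j = c i j 0" unfolding E_def using powser_zero[of "c i j"] by simp
    thus ?thesis by (simp add: c_def)
  qed
  with der show ?thesis by (intro exI[of _ E]) blast
qed

text \<open>One constant \<open>C\<close> serves all initial values at the fixed time; this is the
  continuous dependence behind \<open>flow_perturb\<close>.\<close>

lemma linear_ode_exists:
  fixes F :: "fmat \<Rightarrow> fmat" and \<tau> :: real
  assumes add: "\<And>A B. F (A + B) = F A + F B" and scale: "\<And>z A. F (csc z A) = csc z (F A)"
    and supp: "\<And>A. A \<in> supp_on n \<Longrightarrow> F A \<in> supp_on n"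
  shows "\<exists>C. \<forall>A\<in>supp_on n. \<exists>x. x 0 = A \<and> norm (x \<tau>) \<le> C * norm A \<and>
    (\<forall>t. x t \<in> supp_on n \<and> (x has_vector_derivative F (x t)) (at t))"
proof -
  \<comment> \<open>A superoperator on \<open>n\<close>-by-\<open>n\<close> matrices becomes an
    ordinary coefficient matrix indexed by pairs, with the matrix units as basis.\<close>
  define I where "I = {..<n} \<times> {..<n}"
  have I: "finite I" by (simp add: I_def)
  define e where "e q = munit (fst q) (snd q)" for q :: "nat \<times> nat"
  define L where "L p q = ent (F (e q)) (fst p) (snd p)" for p q
  obtain E where E0: "\<And>p q. p \<in> I \<Longrightarrow> q \<in> I \<Longrightarrow> E 0 p q = (if p = q then 1 else 0)"
    and E': "\<And>p q t. p \<in> I \<Longrightarrow> q \<in> I \<Longrightarrow>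
      ((\<lambda>s. E s p q) has_vector_derivative (\<Sum>l\<in>I. L p l * E t l q)) (at t)"
    using linear_ode_fundamental_solution[OF I, of L] by metis
  have F0: "F 0 = 0" using scale[of 0 0] by simp
  have Fsum: "F (\<Sum>q\<in>J. f q) = (\<Sum>q\<in>J. F (f q))" for J :: "(nat \<times> nat) set" and f
    by (induction J rule: infinite_finite_induct) (simp_all add: F0 add)
  have expand: "A = (\<Sum>q\<in>I. csc (ent A (fst q) (snd q)) (e q))" if "A \<in> supp_on n" for A
    using munit_expand[OF that] by (simp add: I_def e_def sum.cartesian_product case_prod_unfold)
  have Fent: "ent (F A) i j = (\<Sum>l\<in>I. L (i,j) l * ent A (fst l) (snd l))" if "A \<in> supp_on n" for A i j
    by (subst expand[OF that]) (simp add: Fsum scale L_def mult.commute)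
  show ?thesis
  proof (intro exI[of _ "\<Sum>p\<in>I. \<Sum>q\<in>I. cmod (E \<tau> p q)"] ballI)
    fix A assume A: "A \<in> supp_on n"
    define a where "a q = ent A (fst q) (snd q)" for q
    define x where "x t = cutoff n (\<lambda>i j. \<Sum>q\<in>I. E t (i,j) q * a q)" for t
    have x_supp: "x t \<in> supp_on n" for t by (simp add: x_def)
    have x_ent: "ent (x t) i j = (\<Sum>q\<in>I. E t (i,j) q * a q)" if "i < n" "j < n" for t i j
      using that by (simp add: x_def)
    have "x 0 = A"
    proof (rule supp_eqI[OF x_supp A])
      fix i j assume ij: "i < n" "j < n"
      have "ent (x 0) i j = (\<Sum>q\<in>I. if (i,j) = q then a q else 0)"
        unfolding x_ent[OF ij] using ij by (intro sum.cong refl) (simp add: E0 I_def)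
      also have "\<dots> = ent A i j" using ij I by (simp add: I_def a_def)
      finally show "ent (x 0) i j = ent A i j" .
    qed
    moreover have "(x has_vector_derivative F (x t)) (at t)" for t
    proof (rule has_vector_derivative_fmat[OF x_supp supp[OF x_supp] UNIV_I])
      fix i j assume ij: "i < n" "j < n"
      hence ijI: "(i,j) \<in> I" by (simp add: I_def)
      have "((\<lambda>s. \<Sum>q\<in>I. E s (i,j) q * a q) has_vector_derivative
          (\<Sum>q\<in>I. (\<Sum>l\<in>I. L (i,j) l * E t l q) * a q)) (at t)"
        by (intro has_vector_derivative_sum has_vector_derivative_mult_left E' ijI)
      also have "(\<Sum>q\<in>I. (\<Sum>l\<in>I. L (i,j) l * E t l q) * a q) =
          (\<Sum>l\<in>I. \<Sum>q\<in>I. L (i,j) l * E t l q * a q)"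
        unfolding sum_distrib_right by (rule sum.swap)
      also have "\<dots> = (\<Sum>l\<in>I. L (i,j) l * ent (x t) (fst l) (snd l))"
        by (intro sum.cong refl) (auto simp: I_def x_ent sum_distrib_left mult.assoc)
      also have "\<dots> = ent (F (x t)) i j" by (simp add: Fent[OF x_supp])
      finally show "((\<lambda>s. ent (x s) i j) has_vector_derivative ent (F (x t)) i j) (at t)"
        by (simp add: x_ent[OF ij])
    qed
    moreover have "norm (x \<tau>) \<le> (\<Sum>p\<in>I. \<Sum>q\<in>I. cmod (E \<tau> p q)) * norm A"
    proof -
      have "norm (x \<tau>) = (\<Sum>p\<in>I. cmod (\<Sum>q\<in>I. E \<tau> p q * a q))"
        unfolding norm_supp[OF x_supp] I_def sum.cartesian_product
        by (intro sum.cong refl) (auto simp: x_ent I_def)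
      also have "\<dots> \<le> (\<Sum>p\<in>I. \<Sum>q\<in>I. cmod (E \<tau> p q) * norm A)"
      proof (intro sum_mono sum_norm_le)
        fix p q
        show "cmod (E \<tau> p q * a q) \<le> cmod (E \<tau> p q) * norm A"
          by (simp add: norm_mult a_def mult_left_mono cmod_ent_le_norm)
      qed
      finally show ?thesis by (simp add: sum_distrib_right)
    qed
    ultimately show "\<exists>x. x 0 = A \<and> norm (x \<tau>) \<le> (\<Sum>p\<in>I. \<Sum>q\<in>I. cmod (E \<tau> p q)) * norm A \<and>
        (\<forall>t. x t \<in> supp_on n \<and> (x has_vector_derivative F (x t)) (at t))"
      using x_supp by (intro exI[of _ x]) simp
  qed
qed

text \<open>Convergence of a one-step method: consistency of order \<open>h^2\<close> and stability
  force the iterates of \<open>\<Phi> h\<close> to converge to the solution, and the iterates stay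
  in \<open>P\<close>. This proves invariance when the exact flow is inaccessible but a suitable
  discretisation visibly preserves the set.\<close>

lemma invariance_by_discretization:
  fixes x :: "real \<Rightarrow> 'a :: real_normed_vector" and F :: "'a \<Rightarrow> 'a" and \<Phi> :: "real \<Rightarrow> 'a \<Rightarrow> 'a"
  assumes \<tau>: "0 < \<tau>" and F: "bounded_linear F"
    and x': "\<And>t. t \<in> {0..\<tau>} \<Longrightarrow> (x has_vector_derivative F (x t)) (at t within {0..\<tau>})"
    and P: "closed P" "x 0 \<in> P"
    and stable: "\<And>h A B. 0 \<le> h \<Longrightarrow> h \<le> \<tau> \<Longrightarrow> norm (\<Phi> h A - \<Phi> h B) \<le> (1 + M * h) * norm (A - B)"
    and consistent: "\<And>h A. norm (\<Phi> h A - (A + h *\<^sub>R F A)) \<le> h\<^sup>2 * K * norm A"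
    and inv: "\<And>h A. 0 \<le> h \<Longrightarrow> A \<in> P \<Longrightarrow> \<Phi> h A \<in> P"
    and M: "0 \<le> M" and K: "0 \<le> K"
  shows "x \<tau> \<in> P"
proof -
  obtain M0 where M0: "\<And>A. norm (F A) \<le> norm A * M0" "0 < M0"
    using bounded_linear.pos_bounded[OF F] by metis
  have "continuous_on {0..\<tau>} x"
    unfolding continuous_on_eq_continuous_within using has_vector_derivative_continuous[OF x'] by blast
  hence "bounded (x ` {0..\<tau>})" by (intro compact_imp_bounded compact_continuous_image compact_Icc)
  then obtain B where B0: "\<forall>y\<in>x ` {0..\<tau>}. norm y \<le> B" "0 < B"
    unfolding bounded_pos by blast
  hence B: "\<And>t. t \<in> {0..\<tau>} \<Longrightarrow> norm (x t) \<le> B" "0 < B" by simp_all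
  \<comment> \<open>The first summand bounds exact solution against Euler step, the second Euler
    step against \<open>\<Phi>\<close>.\<close>
  define C where "C = M0 * (3 * M0 * B) + K * B"
  have C0: "0 \<le> C" using M0(2) B(2) K by (simp add: C_def)
  have local: "norm (x (s + h) - \<Phi> h (x s)) \<le> C * h\<^sup>2" if s: "0 \<le> s" "0 \<le> h" "s + h \<le> \<tau>" for s h
  proof -
    have x's: "(x has_vector_derivative F (x t)) (at t within {s..s+h})" if "t \<in> {s..s+h}" for t
      by (rule has_vector_derivative_within_subset[OF x']) (use that s in auto)
    have F_bd: "norm (F (x t)) \<le> M0 * B" if "t \<in> {s..s+h}" for t
    proof -
      have "norm (x t) * M0 \<le> B * M0" using B(1)[of t] M0(2) that s by (intro mult_right_mono) auto
      thus ?thesis using M0(1)[of "x t"] by (simp add: mult.commute)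
    qed
    \<comment> \<open>The variation of \<open>F\<close> along the curve contributes
      \<open>2 * M0 * B\<close>, the linear term another \<open>M0 * B\<close>.\<close>
    have near: "norm (x t - x s) \<le> 3 * M0 * B * h" if t: "t \<in> {s..s+h}" for t
    proof -
      have "norm (x t - x s - (t - s) *\<^sub>R F (x s)) \<le> norm (t - s) * (2 * (M0 * B))"
      proof (rule vector_differentiable_bound_linearization[where S="{s..s+h}" and f'="\<lambda>t. F (x t)"])
        fix r assume "r \<in> {s..s+h}"
        thus "norm (F (x r) - F (x s)) \<le> 2 * (M0 * B)"
          using F_bd[of r] F_bd[of s] norm_triangle_ineq4[of "F (x r)" "F (x s)"] s by auto
      qed (use x's t s in \<open>auto simp: closed_segment_eq_real_ivl\<close>)
      moreover have "norm ((t - s) *\<^sub>R F (x s)) \<le> norm (t - s) * (M0 * B)"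
        using F_bd[of s] s by (simp add: mult_left_mono)
      ultimately have "norm (x t - x s) \<le> norm (t - s) * (3 * M0 * B)"
        using norm_triangle_sub[of "x t - x s" "(t - s) *\<^sub>R F (x s)"] by (simp add: algebra_simps)
      also have "\<dots> \<le> h * (3 * M0 * B)"
        using t M0(2) B(2) by (intro mult_right_mono) auto
      finally show ?thesis by (simp add: mult_ac)
    qed
    have "norm (x (s + h) - x s - (s + h - s) *\<^sub>R F (x s)) \<le> norm (s + h - s) * (M0 * (3 * M0 * B * h))"
    proof (rule vector_differentiable_bound_linearization[where S="{s..s+h}" and f'="\<lambda>t. F (x t)"])
      fix r assume r: "r \<in> {s..s+h}"
      have "norm (F (x r) - F (x s)) \<le> norm (x r - x s) * M0"
        using M0(1)[of "x r - x s"] by (simp add: linear_diff[OF bounded_linear.linear[OF F]])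
      also have "\<dots> \<le> 3 * M0 * B * h * M0" using near[OF r] M0(2) by (intro mult_right_mono) auto
      finally show "norm (F (x r) - F (x s)) \<le> M0 * (3 * M0 * B * h)" by (simp add: mult.commute)
    qed (use x's s in \<open>auto simp: closed_segment_eq_real_ivl\<close>)
    hence 1: "norm (x (s + h) - (x s + h *\<^sub>R F (x s))) \<le> M0 * (3 * M0 * B) * h\<^sup>2"
      using s by (simp add: diff_diff_eq power2_eq_square mult_ac)
    have "h\<^sup>2 * K * norm (x s) \<le> h\<^sup>2 * K * B" using B(1)[of s] K s by (intro mult_left_mono) auto
    with consistent[of h "x s"] have 2: "norm (\<Phi> h (x s) - (x s + h *\<^sub>R F (x s))) \<le> K * B * h\<^sup>2"
      by (simp add: mult_ac)
    have "norm (x (s + h) - \<Phi> h (x s)) \<le>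
        norm (x (s + h) - (x s + h *\<^sub>R F (x s))) + norm (\<Phi> h (x s) - (x s + h *\<^sub>R F (x s)))"
      using norm_triangle_ineq4[of "x (s + h) - (x s + h *\<^sub>R F (x s))" "\<Phi> h (x s) - (x s + h *\<^sub>R F (x s))"]
      by simp
    with 1 2 show ?thesis by (simp add: C_def algebra_simps)
  qed
  \<comment> \<open>The error obeys
    \<open>e (k+1) \<le> C * h^2 + (1 + M * h) * e k\<close>.\<close>
  have global: "norm (x (real k * h) - (\<Phi> h ^^ k) (x 0)) \<le> real k * C * h\<^sup>2 * (1 + M * h) ^ k"
    if "0 \<le> h" "real k * h \<le> \<tau>" "h \<le> \<tau>" for k h
    using that(2)
  proof (induction k)
    case (Suc k)
    have kh: "real k * h \<le> \<tau>" "real k * h + h \<le> \<tau>" using Suc.prems that(1) by (auto simp: algebra_simps)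
    have ge1: "1 \<le> (1 + M * h) ^ Suc k" using M that(1) by (intro one_le_power) simp
    let ?S = "(\<Phi> h ^^ k) (x 0)"
    have "norm (x (real (Suc k) * h) - \<Phi> h ?S) \<le>
        norm (x (real k * h + h) - \<Phi> h (x (real k * h))) + norm (\<Phi> h (x (real k * h)) - \<Phi> h ?S)"
      using norm_triangle_ineq[of "x (real k * h + h) - \<Phi> h (x (real k * h))" "\<Phi> h (x (real k * h)) - \<Phi> h ?S"]
      by (simp add: algebra_simps)
    also have "\<dots> \<le> C * h\<^sup>2 + (1 + M * h) * norm (x (real k * h) - ?S)"
      using that kh by (intro add_mono local stable) auto
    also have "\<dots> \<le> C * h\<^sup>2 * (1 + M * h) ^ Suc k + (1 + M * h) * (real k * C * h\<^sup>2 * (1 + M * h) ^ k)"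
    proof (rule add_mono)
      show "C * h\<^sup>2 \<le> C * h\<^sup>2 * (1 + M * h) ^ Suc k"
        using mult_left_mono[OF ge1, of "C * h\<^sup>2"] C0 by simp
      show "(1 + M * h) * norm (x (real k * h) - ?S) \<le> (1 + M * h) * (real k * C * h\<^sup>2 * (1 + M * h) ^ k)"
        using Suc.IH[OF kh(1)] M that(1) by (intro mult_left_mono) auto
    qed
    also have "\<dots> = real (Suc k) * C * h\<^sup>2 * (1 + M * h) ^ Suc k" by (simp add: algebra_simps)
    finally show ?case by simp
  qed simp
  have invk: "(\<Phi> h ^^ k) (x 0) \<in> P" if "0 \<le> h" for h k
    by (induction k) (use P inv that in auto)
  have "\<exists>y\<in>P. dist y (x \<tau>) < \<epsilon>" if \<epsilon>: "0 < \<epsilon>" for \<epsilon>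
  proof -
    \<comment> \<open>With \<open>h = \<tau> / k\<close> the global error is at most
      \<open>C * \<tau>^2 * exp (M * \<tau>) / k\<close>.\<close>
    obtain k :: nat where k: "C * \<tau>\<^sup>2 * exp (M * \<tau>) / \<epsilon> < real k" "1 \<le> k"
      using reals_Archimedean2[of "max 1 (C * \<tau>\<^sup>2 * exp (M * \<tau>) / \<epsilon>)"] by auto
    define h where "h = \<tau> / real k"
    have h: "0 \<le> h" "real k * h = \<tau>" "h \<le> \<tau>"
      using \<tau> k(2) by (auto simp: h_def field_simps)
    have "(1 + M * h) ^ k \<le> exp (M * h) ^ k"
      using M h(1) by (intro power_mono exp_ge_add_one_self) auto
    also have "\<dots> = exp (M * \<tau>)" using h(2) by (simp add: exp_of_nat_mult[symmetric] mult_ac)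
    finally have pw: "(1 + M * h) ^ k \<le> exp (M * \<tau>)" .
    have "norm (x \<tau> - (\<Phi> h ^^ k) (x 0)) \<le> real k * C * h\<^sup>2 * (1 + M * h) ^ k"
      using global[of h k] h by simp
    also have "\<dots> \<le> real k * C * h\<^sup>2 * exp (M * \<tau>)" using pw C0 by (intro mult_left_mono) auto
    also have "\<dots> = C * \<tau>\<^sup>2 * exp (M * \<tau>) / real k"
      using k(2) by (simp add: h_def power2_eq_square)
    also have "\<dots> < \<epsilon>" using k \<epsilon> by (simp add: field_simps)
    finally have "dist ((\<Phi> h ^^ k) (x 0)) (x \<tau>) < \<epsilon>" by (simp add: dist_norm norm_minus_commute)
    thus ?thesis using invk[OF h(1)] by blast
  qed
  hence "x \<tau> \<in> closure P" by (simp add: closure_approachable)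
  thus ?thesis using P(1) by simp
qed



section \<open>Lindblad control systems\<close>

definition to_mat :: "nat \<Rightarrow> fmat \<Rightarrow> complex mat" where
  "to_mat n A = Matrix.mat n n (\<lambda>(i,j). ent A i j)"

lemma to_mat_carrier [simp]: "to_mat n A \<in> carrier_mat n n"
  by (simp add: to_mat_def)

lemma to_mat_mult: "A \<in> supp_on n \<Longrightarrow> to_mat n (A * B) = to_mat n A * to_mat n B"
  by (rule eq_matI) (simp_all add: to_mat_def ent_mult[of _ n] scalar_prod_def atLeast0LessThan)

lemma to_mat_inject:
  assumes "to_mat n A = to_mat n B" "A \<in> supp_on n" "B \<in> supp_on n"
  shows "A = B"
proof (rule supp_eqI[OF assms(2,3)])
  fix i j assume ij: "i < n" "j < n"
  have "to_mat n A $$ (i,j) = to_mat n B $$ (i,j)" by (simp only: assms(1))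
  thus "ent A i j = ent B i j" using ij by (simp add: to_mat_def)
qed

lemma to_mat_idm: "to_mat n (idm n) = 1\<^sub>m n"
  by (rule eq_matI) (simp_all add: to_mat_def)

text \<open>A finite-dimensional fact, borrowed from ordinary matrices through
  \<open>to_mat\<close>; it reduces later unitarity proofs to one identity.\<close>

lemma left_inverse_imp_right_inverse:
  assumes "A \<in> supp_on n" "B \<in> supp_on n" "A * B = idm n"
  shows "B * A = idm n"
proof -
  have "to_mat n A * to_mat n B = 1\<^sub>m n"
    using to_mat_mult[OF assms(1), of B] assms(3) by (simp add: to_mat_idm)
  hence "to_mat n B * to_mat n A = 1\<^sub>m n"
    by (rule mat_mult_left_right_inverse[OF to_mat_carrier to_mat_carrier])
  hence "to_mat n (B * A) = to_mat n (idm n)" using to_mat_mult[OF assms(2)] by (simp add: to_mat_idm)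
  thus ?thesis by (rule to_mat_inject) (simp_all add: assms)
qed

section \<open>Unitary matrices in a block\<close>

definition unitary_on :: "nat \<Rightarrow> fmat \<Rightarrow> bool" where
  "unitary_on n U \<longleftrightarrow> U \<in> supp_on n \<and> adj U * U = idm n \<and> U * adj U = idm n"

lemma unitary_on_supp: "unitary_on n U \<Longrightarrow> U \<in> supp_on n"
  by (simp add: unitary_on_def)

lemma unitary_onI: "U \<in> supp_on n \<Longrightarrow> adj U * U = idm n \<Longrightarrow> unitary_on n U"
  using left_inverse_imp_right_inverse[of "adj U" n U] by (simp add: unitary_on_def)

lemma unitary_on_idm: "unitary_on n (idm n)"
  by (simp add: unitary_on_def)

lemma unitary_on_cancel:
  assumes "unitary_on n U" "A \<in> supp_on n"
  shows "adj U * (U * A) = A" "U * (adj U * A) = A" "A * U * adj U = A" "A * adj U * U = A"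
  using assms by (simp_all add: unitary_on_def mult.assoc[symmetric]) (simp_all add: mult.assoc)

lemma unitary_on_mult:
  assumes U: "unitary_on n U" and W: "unitary_on n W"
  shows "unitary_on n (U * W)"
proof (rule unitary_onI)
  show "U * W \<in> supp_on n" using U W by (simp add: unitary_on_def)
  show "adj (U * W) * (U * W) = idm n"
    using unitary_on_cancel(1)[OF U unitary_on_supp[OF W]] W by (simp add: mult.assoc unitary_on_def)
qed

lemma unitary_on_cmod_ent_le:
  assumes "unitary_on n U"
  shows "cmod (ent U i j) \<le> 1"
proof (cases "i < n \<and> j < n")
  case True
  have U: "U \<in> supp_on n" using assms by (rule unitary_on_supp)
  have "complex_of_real (\<Sum>k<n. (cmod (ent U k j))\<^sup>2) = ent (adj U * U) j j"
    using U by (simp add: ent_mult[of _ n] complex_norm_square mult.commute del: of_real_power)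
  also have "\<dots> = 1" using assms True by (simp add: unitary_on_def)
  finally have "(\<Sum>k<n. (cmod (ent U k j))\<^sup>2) = 1" using of_real_eq_1_iff by blast
  moreover have "(cmod (ent U i j))\<^sup>2 \<le> (\<Sum>k<n. (cmod (ent U k j))\<^sup>2)"
    using True by (intro member_le_sum[of i _ "\<lambda>k. (cmod (ent U k j))\<^sup>2"]) simp_all
  ultimately show ?thesis using power2_le_imp_le[of "cmod (ent U i j)" 1] by simp
next
  case False
  thus ?thesis using supp_onD[OF unitary_on_supp[OF assms], of i j] by auto
qed

lemma unitary_on_norm_le:
  assumes "unitary_on n U"
  shows "norm U \<le> real n * real n"
proof -
  have "norm U \<le> (\<Sum>i<n. \<Sum>j<n. 1)"
    unfolding norm_supp[OF unitary_on_supp[OF assms]]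
    by (intro sum_mono unitary_on_cmod_ent_le[OF assms])
  thus ?thesis by simp
qed

lemma unitary_on_limit:
  assumes "\<And>k. unitary_on n (X k)" "X \<longlonglongrightarrow> U"
  shows "unitary_on n U"
proof (rule unitary_onI)
  show "U \<in> supp_on n"
    using closed_sequentially[OF closed_supp_on unitary_on_supp[OF assms(1)] assms(2)] .
  have "(\<lambda>k. adj (X k) * X k) \<longlonglongrightarrow> adj U * U" by (intro tendsto_intros assms(2))
  moreover have "adj (X k) * X k = idm n" for k using assms(1)[of k] by (simp add: unitary_on_def)
  ultimately show "adj U * U = idm n" using LIMSEQ_unique[OF _ tendsto_const] by simp
qed

text \<open>Column vectors are encoded as the zeroth column of a matrix.\<close>

definition psd_on :: "nat \<Rightarrow> fmat \<Rightarrow> bool" where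
  "psd_on n A \<longleftrightarrow> (\<forall>X\<in>supp_on n. 0 \<le> Re (ent (adj X * A * X) 0 0))"

definition densities :: "nat \<Rightarrow> fmat set" where
  "densities n = {A \<in> supp_on n. adj A = A \<and> psd_on n A \<and> tr A = 1}"

lemma psd_on_conj: "psd_on n A \<Longrightarrow> W \<in> supp_on n \<Longrightarrow> psd_on n (W * A * adj W)"
  unfolding psd_on_def
proof
  fix X assume "\<forall>X\<in>supp_on n. 0 \<le> Re (ent (adj X * A * X) 0 0)" "W \<in> supp_on n" "X \<in> supp_on n"
  hence "0 \<le> Re (ent (adj (adj W * X) * A * (adj W * X)) 0 0)" by (meson supp_simps supp_mult)
  thus "0 \<le> Re (ent (adj X * (W * A * adj W) * X) 0 0)" by (simp add: mult.assoc)
qed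

lemma psd_on_add: "psd_on n A \<Longrightarrow> psd_on n B \<Longrightarrow> psd_on n (A + B)"
  by (simp add: psd_on_def distrib_left distrib_right)

lemma psd_on_scaleR: "psd_on n A \<Longrightarrow> 0 \<le> r \<Longrightarrow> psd_on n (r *\<^sub>R A)"
  by (simp add: psd_on_def)

lemma psd_on_diag: "psd_on n A \<Longrightarrow> A \<in> supp_on n \<Longrightarrow> i < n \<Longrightarrow> 0 \<le> Re (ent A i i)"
proof -
  assume A: "psd_on n A" "A \<in> supp_on n" "i < n"
  have X: "munit i 0 \<in> supp_on n" using A(3) by simp
  have 1: "ent (adj (munit i 0) * A) 0 k = ent A i k" for k
    using A(3) by (subst ent_mult'[OF A(2)])
      (simp add: if_distrib[of "\<lambda>x. x * _"] if_distrib[of cnj] cong: if_cong)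
  have "ent (adj (munit i 0) * A * munit i 0) 0 0 = ent A i i"
    using A(3) by (subst ent_mult'[OF X]) (simp add: 1 if_distrib[of "\<lambda>x. _ * x"] cong: if_cong)
  thus ?thesis using A(1) X unfolding psd_on_def by metis
qed

lemma closed_psd_on: "closed {A. psd_on n A}"
proof -
  have "{A. psd_on n A} = (\<Inter>X\<in>supp_on n. {A. 0 \<le> Re (ent (adj X * A * X) 0 0)})"
    by (simp add: psd_on_def set_eq_iff)
  moreover have "closed {A. 0 \<le> Re (ent (adj X * A * X) 0 0)}" for X
    by (intro closed_Collect_le continuous_intros)
  ultimately show ?thesis by (auto intro: closed_INT)
qed

text \<open>The type of control values is left abstract: only the Hamiltonian attached to a value
  enters. The concrete system later takes vectors of amplitudes.\<close>

locale lindblad =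
  fixes N :: nat and h :: "'u \<Rightarrow> fmat" and V :: fmat and \<gamma>s :: real
  assumes h_supp [simp, intro]: "h u \<in> supp_on N"
    and h_adj [simp]: "adj (h u) = h u"
    and V_supp [simp, intro]: "V \<in> supp_on N"
    and \<gamma>s_pos: "0 < \<gamma>s"
begin

text \<open>The generator in the form \<open>K\<rho> + \<rho>K\<^sup>\<dagger> + \<gamma>V\<rho>V\<^sup>\<dagger>\<close> with the non-Hermitian
  effective Hamiltonian \<open>iK\<close>.\<close>

definition K :: "'u \<Rightarrow> real \<Rightarrow> fmat" where
  "K u \<gamma> = csc (- \<i>) (h u) - (\<gamma> / 2) *\<^sub>R (adj V * V)"

definition L :: "'u \<Rightarrow> real \<Rightarrow> fmat \<Rightarrow> fmat" where
  "L u \<gamma> A = K u \<gamma> * A + A * adj (K u \<gamma>) + \<gamma> *\<^sub>R (V * A * adj V)"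

lemma K_supp [simp, intro]: "K u \<gamma> \<in> supp_on N"
  by (simp add: K_def)

lemma L_supp [simp, intro]: "A \<in> supp_on N \<Longrightarrow> L u \<gamma> A \<in> supp_on N"
  by (simp add: L_def)

lemma L_add: "L u \<gamma> (A + B) = L u \<gamma> A + L u \<gamma> B"
  by (simp add: L_def algebra_simps)

lemma L_csc: "L u \<gamma> (csc z A) = csc z (L u \<gamma> A)"
  by (simp add: L_def csc_add)

lemma bounded_linear_L: "bounded_linear (L u \<gamma>)"
proof (rule bounded_linear_intro)
  let ?C = "2 * norm (K u \<gamma>) + \<bar>\<gamma>\<bar> * (norm V * norm V)"
  show "L u \<gamma> (r *\<^sub>R A) = r *\<^sub>R L u \<gamma> A" for r A
    using L_csc[of u \<gamma> "of_real r" A] by simp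
  fix A
  have "norm (V * A * adj V) \<le> norm V * norm A * norm V"
    by (rule order_trans[OF norm_mult_ineq]) (simp add: mult_right_mono norm_mult_ineq)
  hence "norm (\<gamma> *\<^sub>R (V * A * adj V)) \<le> \<bar>\<gamma>\<bar> * (norm V * norm A * norm V)"
    by (simp add: mult_left_mono)
  moreover have "norm (K u \<gamma> * A) \<le> norm (K u \<gamma>) * norm A" by (rule norm_mult_ineq)
  moreover have "norm (A * adj (K u \<gamma>)) \<le> norm A * norm (K u \<gamma>)"
    using norm_mult_ineq[of A "adj (K u \<gamma>)"] by simp
  ultimately have "norm (L u \<gamma> A) \<le> norm (K u \<gamma>) * norm A + norm A * norm (K u \<gamma>) + \<bar>\<gamma>\<bar> * (norm V * norm A * norm V)"
    unfolding L_def by (intro norm_triangle_le add_mono)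
  thus "norm (L u \<gamma> A) \<le> norm A * ?C" by (simp add: algebra_simps)
qed (rule L_add)

text \<open>By cyclicity the jump term contributes \<open>\<gamma>\<close> times the trace of
  \<open>adj V * V * A\<close>, and \<open>K\<close> plus its adjoint contributes exactly the
  negative.\<close>

lemma tr_L: "tr (L u \<gamma> A) = 0"
proof -
  have "tr (L u \<gamma> A) = tr ((K u \<gamma> + adj (K u \<gamma>)) * A) + of_real \<gamma> * tr (adj V * V * A)"
    using tr_commute[of A "adj (K u \<gamma>)"] tr_commute[of "V * A" "adj V"]
    by (simp add: L_def distrib_right mult.assoc)
  also have "K u \<gamma> + adj (K u \<gamma>) = - (\<gamma> *\<^sub>R (adj V * V))"
    by (rule fmat_eqI) (simp add: K_def algebra_simps)
  finally show ?thesis by simp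
qed

section \<open>Reachability and its behaviour under limits\<close>

definition flow :: "'u \<Rightarrow> real \<Rightarrow> real \<Rightarrow> fmat \<Rightarrow> fmat \<Rightarrow> bool" where
  "flow u \<gamma> \<tau> A B \<longleftrightarrow> 0 \<le> \<tau> \<and> (\<exists>x. x 0 = A \<and> x \<tau> = B \<and> (\<forall>t\<in>{0..\<tau>}. x t \<in> supp_on N \<and>
    (x has_vector_derivative L u \<gamma> (x t)) (at t within {0..\<tau>})))"

inductive_set reachable :: "fmat \<Rightarrow> fmat set" for A where
  init: "A \<in> reachable A"
| step: "B \<in> reachable A \<Longrightarrow> \<gamma> \<in> {0, \<gamma>s} \<Longrightarrow> flow u \<gamma> \<tau> B C \<Longrightarrow> C \<in> reachable A"

lemma reachable_trans: "C \<in> reachable B \<Longrightarrow> B \<in> reachable A \<Longrightarrow> C \<in> reachable A"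
  by (induction rule: reachable.induct) (auto intro: reachable.step)

lemma flow_supp: "flow u \<gamma> \<tau> A B \<Longrightarrow> A \<in> supp_on N \<and> B \<in> supp_on N"
  unfolding flow_def by fastforce

lemma reachable_supp: "B \<in> reachable A \<Longrightarrow> A \<in> supp_on N \<Longrightarrow> B \<in> supp_on N"
  by (induction rule: reachable.induct) (auto dest: flow_supp)

text \<open>By linearity the solution started at \<open>A'\<close> is the given one plus the
  solution started at \<open>A' - A\<close>.\<close>

lemma flow_perturb:
  assumes "flow u \<gamma> \<tau> A B"
  shows "\<exists>C>0. \<forall>A'\<in>supp_on N. \<exists>B'. flow u \<gamma> \<tau> A' B' \<and> norm (B' - B) \<le> C * norm (A' - A)"
proof -
  obtain x where \<tau>: "0 \<le> \<tau>" and x: "x 0 = A" "x \<tau> = B" and x': "\<forall>t\<in>{0..\<tau>}. x t \<in> supp_on N \<and>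
    (x has_vector_derivative L u \<gamma> (x t)) (at t within {0..\<tau>})"
    using assms unfolding flow_def by auto
  obtain C where C: "\<forall>D\<in>supp_on N. \<exists>y. y 0 = D \<and> norm (y \<tau>) \<le> C * norm D \<and>
    (\<forall>t. y t \<in> supp_on N \<and> (y has_vector_derivative L u \<gamma> (y t)) (at t))"
    using linear_ode_exists[where F="L u \<gamma>" and n=N and \<tau>=\<tau>, OF L_add L_csc L_supp] by blast
  have A: "A \<in> supp_on N" using flow_supp[OF assms] by simp
  have "\<exists>B'. flow u \<gamma> \<tau> A' B' \<and> norm (B' - B) \<le> (\<bar>C\<bar> + 1) * norm (A' - A)" if A': "A' \<in> supp_on N" for A'
  proof -
    obtain y where y: "y 0 = A' - A" "norm (y \<tau>) \<le> C * norm (A' - A)"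
      and y': "\<And>t. y t \<in> supp_on N" "\<And>t. (y has_vector_derivative L u \<gamma> (y t)) (at t)"
      using C A A' by (meson supp_simps(3))
    have "flow u \<gamma> \<tau> A' (x \<tau> + y \<tau>)"
      unfolding flow_def
    proof (intro conjI \<tau> exI[of _ "\<lambda>t. x t + y t"] ballI)
      show "x 0 + y 0 = A'" by (simp add: x y)
      fix t assume t: "t \<in> {0..\<tau>}"
      thus "x t + y t \<in> supp_on N" using x' y' by simp
      show "((\<lambda>t. x t + y t) has_vector_derivative L u \<gamma> (x t + y t)) (at t within {0..\<tau>})"
        unfolding L_add using x' t has_vector_derivative_at_within[OF y'(2)]
        by (intro has_vector_derivative_add) blast+
    qed simp
    moreover have "norm (x \<tau> + y \<tau> - B) \<le> (\<bar>C\<bar> + 1) * norm (A' - A)"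
    proof -
      have "norm (x \<tau> + y \<tau> - B) \<le> C * norm (A' - A)" using y(2) by (simp add: x)
      also have "\<dots> \<le> (\<bar>C\<bar> + 1) * norm (A' - A)" by (intro mult_right_mono) auto
      finally show ?thesis .
    qed
    ultimately show ?thesis by blast
  qed
  thus ?thesis by (intro exI[of _ "\<bar>C\<bar> + 1"]) simp
qed

text \<open>The same finite sequence of controls is applied to the perturbed initial matrix, and the
  Lipschitz constants of its pieces compose.\<close>

lemma reachable_perturb:
  assumes "B \<in> reachable A" "0 < \<epsilon>"
  shows "\<exists>\<delta>>0. \<forall>A'\<in>supp_on N. norm (A' - A) < \<delta> \<longrightarrow> (\<exists>B'\<in>reachable A'. norm (B' - B) < \<epsilon>)"
  using assms
proof (induction arbitrary: \<epsilon> rule: reachable.induct)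
  case init
  thus ?case using reachable.init by blast
next
  case (step B \<gamma> u \<tau> C)
  obtain c where c: "0 < c" "\<And>B'. B' \<in> supp_on N \<Longrightarrow> \<exists>C'. flow u \<gamma> \<tau> B' C' \<and> norm (C' - C) \<le> c * norm (B' - B)"
    using flow_perturb[OF step.hyps(3)] by blast
  obtain \<delta> where \<delta>: "0 < \<delta>" "\<And>A'. A' \<in> supp_on N \<Longrightarrow> norm (A' - A) < \<delta> \<Longrightarrow> \<exists>B'\<in>reachable A'. norm (B' - B) < \<epsilon> / c"
    using step.IH[of "\<epsilon> / c"] c(1) step.prems by (meson divide_pos_pos)
  have "\<exists>C'\<in>reachable A'. norm (C' - C) < \<epsilon>" if A': "A' \<in> supp_on N" "norm (A' - A) < \<delta>" for A'
  proof -
    obtain B' where B': "B' \<in> reachable A'" "norm (B' - B) < \<epsilon> / c" using \<delta>(2)[OF A'] by blast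
    obtain C' where C': "flow u \<gamma> \<tau> B' C'" "norm (C' - C) \<le> c * norm (B' - B)"
      using c(2) reachable_supp[OF B'(1) A'(1)] by blast
    have "c * norm (B' - B) < \<epsilon>" using B'(2) c(1) by (simp add: field_simps)
    thus ?thesis using C' reachable.step[OF B'(1) step.hyps(2) C'(1)] by (intro bexI[of _ C']) simp_all
  qed
  thus ?case using \<delta>(1) by blast
qed

lemma closure_reachable_supp: "B \<in> closure (reachable A) \<Longrightarrow> A \<in> supp_on N \<Longrightarrow> B \<in> supp_on N"
  using closure_minimal[OF _ closed_supp_on, of "reachable A" N] reachable_supp by blast

text \<open>An intermediate limit point need not itself be reachable; the continuation is run from a
  nearby reachable matrix instead, and \<open>reachable_perturb\<close> controls the error.\<close>

lemma closure_reachable_trans: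
  assumes B: "B \<in> closure (reachable A)" and C: "C \<in> closure (reachable B)" and A: "A \<in> supp_on N"
  shows "C \<in> closure (reachable A)"
  unfolding closure_approachable
proof (intro allI impI)
  fix \<epsilon> :: real assume \<epsilon>: "0 < \<epsilon>"
  obtain C' where C': "C' \<in> reachable B" "dist C' C < \<epsilon> / 2"
    using C \<epsilon> unfolding closure_approachable by (meson half_gt_zero)
  obtain \<delta> where \<delta>: "0 < \<delta>" "\<And>B'. B' \<in> supp_on N \<Longrightarrow> norm (B' - B) < \<delta> \<Longrightarrow> \<exists>C''\<in>reachable B'. norm (C'' - C') < \<epsilon> / 2"
    using reachable_perturb[OF C'(1), of "\<epsilon> / 2"] \<epsilon> by auto
  obtain B' where B': "B' \<in> reachable A" "dist B' B < \<delta>"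
    using B \<delta>(1) unfolding closure_approachable by blast
  obtain C'' where C'': "C'' \<in> reachable B'" "norm (C'' - C') < \<epsilon> / 2"
    using \<delta>(2)[OF reachable_supp[OF B'(1) A]] B'(2) by (auto simp: dist_norm)
  have "dist C'' C < \<epsilon>" using C'(2) C''(2) by (metis dist_norm dist_triangle_half_r dist_commute)
  thus "\<exists>y\<in>reachable A. dist y C < \<epsilon>" using reachable_trans[OF C''(1) B'(1)] by blast
qed

subsection \<open>Invariance of the set of density operators\<close>

lemma flow_preserves_psd:
  assumes fl: "flow u \<gamma> \<tau> A B" and \<gamma>: "0 \<le> \<gamma>" and A: "adj A = A" "psd_on N A"
  shows "adj B = B \<and> psd_on N B"
proof (cases "\<tau> = 0")
  case True
  thus ?thesis using assms by (auto simp: flow_def)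
next
  case False
  obtain x where \<tau>: "0 \<le> \<tau>" and x: "x 0 = A" "x \<tau> = B" and x': "\<forall>t\<in>{0..\<tau>}. x t \<in> supp_on N \<and>
    (x has_vector_derivative L u \<gamma> (x t)) (at t within {0..\<tau>})"
    using fl unfolding flow_def by auto
  let ?K = "K u \<gamma>"
  define P where "P = {A. A \<in> supp_on N \<and> adj A = A \<and> psd_on N A}"
  \<comment> \<open>The added \<open>h^2\<close> term completes the Euler step to a manifestly
    positive map, see \<open>eq\<close> below, without spoiling first-order consistency.\<close>
  define \<Phi> where "\<Phi> h A = A + h *\<^sub>R L u \<gamma> A + h\<^sup>2 *\<^sub>R (?K * A * adj ?K)" for h A
  obtain M0 where M0: "\<And>A. norm (L u \<gamma> A) \<le> norm A * M0" "0 < M0"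
    using bounded_linear.pos_bounded[OF bounded_linear_L] by metis
  have kk: "norm (?K * A * adj ?K) \<le> (norm ?K)\<^sup>2 * norm A" for A
  proof -
    have "norm (?K * A * adj ?K) \<le> norm (?K * A) * norm ?K" using norm_mult_ineq[of "?K * A" "adj ?K"] by simp
    also have "\<dots> \<le> norm ?K * norm A * norm ?K" by (intro mult_right_mono norm_mult_ineq norm_ge_zero)
    finally show ?thesis by (simp add: power2_eq_square mult_ac)
  qed
  have "x \<tau> \<in> P"
  proof (rule invariance_by_discretization[where F="L u \<gamma>" and \<Phi>=\<Phi> and M="M0 + \<tau> * (norm ?K)\<^sup>2" and K="(norm ?K)\<^sup>2"])
    show "0 < \<tau>" using \<tau> False by simp
    show "bounded_linear (L u \<gamma>)" by (rule bounded_linear_L)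
    show "closed P"
    proof -
      have "P = supp_on N \<inter> {A. adj A = A} \<inter> {A. psd_on N A}" unfolding P_def by blast
      moreover have "closed {A. adj A = A}" by (intro closed_Collect_eq continuous_intros)
      ultimately show ?thesis using closed_supp_on closed_psd_on by auto
    qed
    show "x 0 \<in> P" using x(1) A flow_supp[OF fl] by (simp add: P_def)
    show "(x has_vector_derivative L u \<gamma> (x t)) (at t within {0..\<tau>})" if "t \<in> {0..\<tau>}" for t
      using x' that by blast
    show "norm (\<Phi> h A - (A + h *\<^sub>R L u \<gamma> A)) \<le> h\<^sup>2 * (norm ?K)\<^sup>2 * norm A" for h A
      using kk[of A] by (simp add: \<Phi>_def mult.assoc mult_left_mono)
    show "norm (\<Phi> h A - \<Phi> h B) \<le> (1 + (M0 + \<tau> * (norm ?K)\<^sup>2) * h) * norm (A - B)" if h: "0 \<le> h" "h \<le> \<tau>" for h A B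
    proof -
      have "\<Phi> h A - \<Phi> h B = (A - B) + h *\<^sub>R L u \<gamma> (A - B) + h\<^sup>2 *\<^sub>R (?K * (A - B) * adj ?K)"
        by (simp add: \<Phi>_def linear_diff[OF bounded_linear.linear[OF bounded_linear_L]] algebra_simps)
      also have "norm \<dots> \<le> norm (A - B) + h * (norm (A - B) * M0) + h\<^sup>2 * ((norm ?K)\<^sup>2 * norm (A - B))"
        using h M0(1)[of "A - B"] kk[of "A - B"]
        by (intro norm_triangle_le add_mono) (simp_all add: mult_left_mono)
      \<comment> \<open>Since \<open>h \<le> \<tau>\<close>, the quadratic term is absorbed into one
        linear in \<open>h\<close>; hence the summand \<open>\<tau> * (norm ?K)^2\<close> in the
        stability constant.\<close>
      also have "h\<^sup>2 * ((norm ?K)\<^sup>2 * norm (A - B)) \<le> (h * \<tau>) * ((norm ?K)\<^sup>2 * norm (A - B))"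
        using h by (intro mult_right_mono) (simp_all add: power2_eq_square mult_left_mono)
      finally show ?thesis by (simp add: algebra_simps)
    qed
    show "0 \<le> M0 + \<tau> * (norm ?K)\<^sup>2" using M0(2) \<tau> by simp
    show "\<Phi> h A \<in> P" if h: "0 \<le> h" and A: "A \<in> P" for h A
    proof -
      have As: "A \<in> supp_on N" "adj A = A" "psd_on N A" using A by (simp_all add: P_def)
      have eq: "\<Phi> h A = (idm N + h *\<^sub>R ?K) * A * adj (idm N + h *\<^sub>R ?K) + (h * \<gamma>) *\<^sub>R (V * A * adj V)"
        using As(1) by (simp add: \<Phi>_def L_def algebra_simps power2_eq_square)
      have "psd_on N (\<Phi> h A)"
        unfolding eq using h \<gamma> As by (intro psd_on_add psd_on_scaleR psd_on_conj) simp_all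
      moreover have "adj (\<Phi> h A) = \<Phi> h A" unfolding eq by (simp add: As(2) mult.assoc)
      moreover have "\<Phi> h A \<in> supp_on N" unfolding \<Phi>_def using As(1) by simp
      ultimately show ?thesis by (simp add: P_def)
    qed
  qed simp
  thus ?thesis by (simp add: P_def x)
qed

lemma flow_preserves_tr:
  assumes "flow u \<gamma> \<tau> A B"
  shows "tr B = tr A"
proof -
  obtain x where \<tau>: "0 \<le> \<tau>" and x: "x 0 = A" "x \<tau> = B" and x': "\<forall>t\<in>{0..\<tau>}. x t \<in> supp_on N \<and>
    (x has_vector_derivative L u \<gamma> (x t)) (at t within {0..\<tau>})"
    using assms unfolding flow_def by auto
  have "((\<lambda>t. tr (x t)) has_vector_derivative 0) (at t within {0..\<tau>})" if "t \<in> {0..\<tau>}" for t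
    using bounded_linear.has_vector_derivative[OF bounded_linear_tr, of x "L u \<gamma> (x t)"] x' that
    by (simp add: tr_L)
  then obtain c where "\<And>t. t \<in> {0..\<tau>} \<Longrightarrow> tr (x t) = c"
    using has_vector_derivative_zero_constant[of "{0..\<tau>}" "\<lambda>t. tr (x t)"] by auto
  thus ?thesis using x \<tau> by (metis atLeastAtMost_iff order_refl)
qed

lemma reachable_densities: "B \<in> reachable A \<Longrightarrow> A \<in> densities N \<Longrightarrow> B \<in> densities N"
proof (induction rule: reachable.induct)
  case (step B \<gamma> u \<tau> C)
  have "0 \<le> \<gamma>" using step.hyps(2) \<gamma>s_pos by auto
  thus ?case using step flow_preserves_psd[OF step.hyps(3)] flow_preserves_tr[OF step.hyps(3)] flow_supp[OF step.hyps(3)]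
    by (simp add: densities_def)
qed

end



context lindblad
begin

section \<open>Approximately implementable unitaries\<close>

definition G :: "fmat set" where
  "G = {U. unitary_on N U \<and> (\<forall>A\<in>supp_on N. U * A * adj U \<in> closure (reachable A))}"

text \<open>One-sided tangent vectors of \<open>G\<close> at the identity. No regularity of the
  curve is asked for beyond its difference quotient, so its points may be chosen separately for each
  \<open>s\<close>.\<close>

definition T :: "fmat set" where
  "T = {A. \<exists>U. (\<forall>s>0. U s \<in> G) \<and> ((\<lambda>s. (1 / s) *\<^sub>R (U s - idm N)) \<longlongrightarrow> A) (at_right 0)}"

lemma T_memI:
  assumes "\<And>s. 0 < s \<Longrightarrow> U s \<in> G" "((\<lambda>s. (1 / s) *\<^sub>R (U s - idm N)) \<longlongrightarrow> A) (at_right 0)"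
  shows "A \<in> T"
  unfolding T_def using assms by (intro CollectI exI[of _ U] conjI allI impI)

lemma T_memD:
  "A \<in> T \<Longrightarrow> \<exists>U. (\<forall>s>0. U s \<in> G) \<and> ((\<lambda>s. (1 / s) *\<^sub>R (U s - idm N)) \<longlongrightarrow> A) (at_right 0)"
  by (simp add: T_def)

lemma G_unitary: "U \<in> G \<Longrightarrow> unitary_on N U"
  by (simp add: G_def)

lemma G_supp: "U \<in> G \<Longrightarrow> U \<in> supp_on N"
  by (simp add: G_unitary unitary_on_supp)

lemma G_reach: "U \<in> G \<Longrightarrow> A \<in> supp_on N \<Longrightarrow> U * A * adj U \<in> closure (reachable A)"
  by (simp add: G_def)

lemma idm_G: "idm N \<in> G"
  unfolding G_def
proof (intro CollectI conjI unitary_on_idm ballI)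
  fix A assume "A \<in> supp_on N"
  moreover have "A \<in> closure (reachable A)" using closure_subset reachable.init by (rule subsetD)
  ultimately show "idm N * A * adj (idm N) \<in> closure (reachable A)" by simp
qed

lemma G_mult:
  assumes U: "U \<in> G" and W: "W \<in> G"
  shows "U * W \<in> G"
  unfolding G_def
proof (intro CollectI conjI ballI)
  show "unitary_on N (U * W)" using U W by (simp add: G_unitary unitary_on_mult)
  fix A assume A: "A \<in> supp_on N"
  have 1: "W * A * adj W \<in> closure (reachable A)" using W A by (rule G_reach)
  have "U * (W * A * adj W) * adj U \<in> closure (reachable (W * A * adj W))"
    using U closure_reachable_supp[OF 1 A] by (rule G_reach)
  from closure_reachable_trans[OF 1 this A]
  show "U * W * A * adj (U * W) \<in> closure (reachable A)" by (simp add: mult.assoc)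
qed

lemma closed_G: "closed G"
  unfolding closed_sequential_limits
proof (intro allI impI, elim conjE)
  fix X U assume X: "\<forall>k. X k \<in> G" and lim: "X \<longlonglongrightarrow> U"
  have "unitary_on N U" using unitary_on_limit[OF _ lim] X G_unitary by blast
  moreover have "U * A * adj U \<in> closure (reachable A)" if A: "A \<in> supp_on N" for A
  proof (rule closed_sequentially[OF closed_closure])
    show "X k * A * adj (X k) \<in> closure (reachable A)" for k using X A G_reach by blast
    show "(\<lambda>k. X k * A * adj (X k)) \<longlonglongrightarrow> U * A * adj U" by (intro tendsto_intros lim)
  qed
  ultimately show "U \<in> G" by (simp add: G_def)
qed

lemma compact_G: "compact G"
  by (rule compact_supp_bounded[OF closed_G, of N 1])
    (auto intro: G_supp unitary_on_cmod_ent_le G_unitary)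

definition pow :: "fmat \<Rightarrow> nat \<Rightarrow> fmat" where
  "pow U k = ((*) U ^^ k) (idm N)"

lemma pow_simps [simp]: "pow U 0 = idm N" "pow U (Suc k) = U * pow U k"
  by (simp_all add: pow_def)

lemma pow_supp [simp]: "U \<in> supp_on N \<Longrightarrow> pow U k \<in> supp_on N"
  by (induction k) simp_all

lemma pow_add: "U \<in> supp_on N \<Longrightarrow> pow U (k + l) = pow U k * pow U l"
  by (induction k) (simp_all add: mult.assoc)

lemma pow_G: "U \<in> G \<Longrightarrow> pow U k \<in> G"
  by (induction k) (simp_all add: idm_G G_mult)

lemma pow_unitary: "unitary_on N U \<Longrightarrow> unitary_on N (pow U k)"
  by (induction k) (simp_all add: unitary_on_idm unitary_on_mult)

text \<open>A compact semigroup of unitaries is a group: by recurrence, suitable powers of \<open>U\<close>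
  approximate \<open>U\<^sup>-\<^sup>1\<close>.\<close>

lemma G_adj:
  assumes U: "U \<in> G"
  shows "adj U \<in> G"
proof -
  have Us: "U \<in> supp_on N" using U by (rule G_supp)
  have "\<exists>W\<in>G. \<exists>r. strict_mono r \<and> (pow U \<circ> r) \<longlonglongrightarrow> W"
    using compact_imp_seq_compact[OF compact_G, unfolded seq_compact_def] pow_G[OF U] by simp
  then obtain W r where r: "strict_mono (r :: nat \<Rightarrow> nat)" "(pow U \<circ> r) \<longlonglongrightarrow> W"
    by (elim bexE exE conjE) (rule that)
  have "\<exists>Y\<in>G. dist Y (adj U) < \<epsilon>" if \<epsilon>: "0 < \<epsilon>" for \<epsilon>
  proof -
    \<comment> \<open>Bounds the norm of every unitary in the block; the added one keeps it
      positive.\<close>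
    define b where "b = real N * real N + 1"
    have b: "0 < b" by (simp add: b_def add_nonneg_pos)
    have "0 < \<epsilon> / (b * b)" using b \<epsilon> by simp
    from metric_CauchyD[OF LIMSEQ_imp_Cauchy[OF r(2)] this]
    obtain k where k: "\<forall>m\<ge>k. \<forall>n\<ge>k. dist ((pow U \<circ> r) m) ((pow U \<circ> r) n) < \<epsilon> / (b * b)" ..
    \<comment> \<open>If two powers of \<open>U\<close> nearly agree, their quotient, the power
      \<open>Suc m\<close>, is near the identity, so the power \<open>m\<close> is near the adjoint.
      Writing the gap as \<open>Suc m\<close> leaves a nonnegative exponent.\<close>
    have "r k < r (Suc k)" using r(1) by (simp add: strict_mono_def)
    then obtain m where m: "r (Suc k) = r k + Suc m" using less_imp_Suc_add by auto
    let ?P = "pow U (r k)"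
    have P: "unitary_on N ?P" using U by (simp add: G_unitary pow_unitary)
    have "pow U (r (Suc k)) - ?P = ?P * (U * pow U m - idm N)"
      using Us by (simp add: m pow_add right_diff_distrib del: add_Suc_right)
    hence "adj U * (adj ?P * (pow U (r (Suc k)) - ?P)) = adj U * (U * pow U m - idm N)"
      using unitary_on_cancel(1)[OF P, of "U * pow U m - idm N"] Us by simp
    also have "\<dots> = pow U m - adj U"
      using unitary_on_cancel(1)[OF G_unitary[OF U], of "pow U m"] Us by (simp add: right_diff_distrib)
    finally have "norm (pow U m - adj U) \<le> norm (adj U) * norm (adj ?P * (pow U (r (Suc k)) - ?P))"
      using norm_mult_ineq[of "adj U" "adj ?P * (pow U (r (Suc k)) - ?P)"] by simp
    also have "\<dots> \<le> norm U * (norm ?P * norm (pow U (r (Suc k)) - ?P))"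
      using norm_mult_ineq[of "adj ?P" "pow U (r (Suc k)) - ?P"] by (simp add: mult_left_mono)
    also have "\<dots> \<le> b * (b * norm (pow U (r (Suc k)) - ?P))"
      using unitary_on_norm_le[OF P] unitary_on_norm_le[OF G_unitary[OF U]]
      by (intro mult_mono) (auto simp: b_def)
    also have "\<dots> < \<epsilon>"
      using k[rule_format, of "Suc k" k] b by (simp add: dist_norm field_simps)
    finally show ?thesis using pow_G[OF U, of m] by (intro bexI[of _ "pow U m"]) (simp_all add: dist_norm)
  qed
  hence "adj U \<in> closure G" by (simp add: closure_approachable)
  thus ?thesis using closed_G by simp
qed

subsection \<open>The tangent Lie algebra\<close>

lemma at_right_le: "at_right (0::real) \<noteq> bot"
  by (rule trivial_limit_at_right_real)

lemma eventually_at_right_pos: "\<forall>\<^sub>F s in at_right (0::real). 0 < s"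
  by (simp add: eventually_at_right_less)

lemma derivative_imp_tangent:
  assumes "(E has_vector_derivative D) (at 0)" "E 0 = idm N"
  shows "((\<lambda>s. (1 / s) *\<^sub>R (E s - idm N)) \<longlongrightarrow> D) (at_right 0)"
proof -
  have "(E has_vector_derivative D) (at_right 0)"
    using assms(1) by (rule has_vector_derivative_at_within)
  hence "((\<lambda>s. (E s - E 0 - (s - 0) *\<^sub>R D) /\<^sub>R norm (s - 0)) \<longlongrightarrow> 0) (at_right 0)"
    unfolding has_vector_derivative_def has_derivative_at_within by (rule conjunct2)
  moreover have "\<forall>\<^sub>F s in at_right 0.
      (E s - E 0 - (s - 0) *\<^sub>R D) /\<^sub>R norm (s - 0) = (1 / s) *\<^sub>R (E s - idm N) - D"
    by (rule eventually_mono[OF eventually_at_right_pos])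
      (simp add: assms(2) scaleR_diff_right inverse_eq_divide)
  ultimately have "((\<lambda>s. (1 / s) *\<^sub>R (E s - idm N) - D) \<longlongrightarrow> 0) (at_right 0)"
    by (rule Lim_transform_eventually)
  thus ?thesis by (rule LIM_zero_cancel)
qed

lemma T_supp:
  assumes "A \<in> T"
  shows "A \<in> supp_on N"
proof -
  obtain U where U: "\<forall>s>0. U s \<in> G" and lim: "((\<lambda>s. (1 / s) *\<^sub>R (U s - idm N)) \<longlongrightarrow> A) (at_right 0)"
    using T_memD[OF assms] by (elim exE conjE) (rule that)
  have "\<forall>\<^sub>F s in at_right 0. (1 / s) *\<^sub>R (U s - idm N) \<in> supp_on N"
    by (rule eventually_mono[OF eventually_at_right_pos]) (simp add: U G_supp)
  thus ?thesis by (rule Lim_in_closed_set[OF closed_supp_on _ at_right_le lim])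
qed

lemma tangent_curve_limit:
  assumes "((\<lambda>s. (1 / s) *\<^sub>R (U s - idm N)) \<longlongrightarrow> A) (at_right 0)"
  shows "(U \<longlongrightarrow> idm N) (at_right 0)"
proof -
  have "((\<lambda>s. s *\<^sub>R ((1 / s) *\<^sub>R (U s - idm N)) + idm N) \<longlongrightarrow> 0 *\<^sub>R A + idm N) (at_right 0)"
    by (intro tendsto_intros assms)
  moreover have "\<forall>\<^sub>F s in at_right 0. s *\<^sub>R ((1 / s) *\<^sub>R (U s - idm N)) + idm N = U s"
    by (rule eventually_mono[OF eventually_at_right_pos]) simp
  ultimately have "(U \<longlongrightarrow> 0 *\<^sub>R A + idm N) (at_right 0)" by (rule Lim_transform_eventually)
  thus ?thesis by simp
qed

text \<open>The product curve works, because
  \<open>U * W - 1 = (U - 1) * W + (W - 1)\<close>.\<close>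

lemma T_add:
  assumes "A \<in> T" "B \<in> T"
  shows "A + B \<in> T"
proof -
  obtain U where U0: "\<forall>s>0. U s \<in> G" and U1: "((\<lambda>s. (1 / s) *\<^sub>R (U s - idm N)) \<longlongrightarrow> A) (at_right 0)"
    using T_memD[OF assms(1)] by (elim exE conjE) (rule that)
  note U = U0[rule_format] U1
  obtain W where W0: "\<forall>s>0. W s \<in> G" and W1: "((\<lambda>s. (1 / s) *\<^sub>R (W s - idm N)) \<longlongrightarrow> B) (at_right 0)"
    using T_memD[OF assms(2)] by (elim exE conjE) (rule that)
  note W = W0[rule_format] W1
  have "((\<lambda>s. (1 / s) *\<^sub>R (U s - idm N) * W s + (1 / s) *\<^sub>R (W s - idm N)) \<longlongrightarrow> A * idm N + B) (at_right 0)"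
    by (intro tendsto_intros U W tangent_curve_limit[OF W(2)])
  moreover have "\<forall>\<^sub>F s in at_right 0. (1 / s) *\<^sub>R (U s - idm N) * W s + (1 / s) *\<^sub>R (W s - idm N) =
      (1 / s) *\<^sub>R (U s * W s - idm N)"
    by (rule eventually_mono[OF eventually_at_right_pos])
      (use W(1) G_supp in \<open>simp add: left_diff_distrib scaleR_diff_right\<close>)
  ultimately have "((\<lambda>s. (1 / s) *\<^sub>R (U s * W s - idm N)) \<longlongrightarrow> A * idm N + B) (at_right 0)"
    by (rule Lim_transform_eventually)
  hence "((\<lambda>s. (1 / s) *\<^sub>R (U s * W s - idm N)) \<longlongrightarrow> A + B) (at_right 0)"
    by (simp only: idm_mult T_supp[OF assms(1)])
  moreover have "U s * W s \<in> G" if "0 < s" for s using U(1)[OF that] W(1)[OF that] by (rule G_mult)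
  ultimately show ?thesis by (rule T_memI[rotated])
qed

lemma T_zero: "0 \<in> T"
  by (rule T_memI[of "\<lambda>s. idm N"]) (simp_all add: idm_G)

text \<open>Unitarity gives \<open>adj (U - 1) * U + (U - 1) = adj U * U - 1 = 0\<close> along the
  curve; divide by \<open>s\<close> and pass to the limit.\<close>

lemma T_antiherm:
  assumes "A \<in> T"
  shows "adj A = - A"
proof -
  obtain U where U0: "\<forall>s>0. U s \<in> G" and U1: "((\<lambda>s. (1 / s) *\<^sub>R (U s - idm N)) \<longlongrightarrow> A) (at_right 0)"
    using T_memD[OF assms(1)] by (elim exE conjE) (rule that)
  note U = U0[rule_format] U1
  have "((\<lambda>s. adj ((1 / s) *\<^sub>R (U s - idm N)) * U s + (1 / s) *\<^sub>R (U s - idm N)) \<longlongrightarrow> adj A * idm N + A) (at_right 0)"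
    by (intro tendsto_intros U tangent_curve_limit[OF U(2)])
  moreover have "\<forall>\<^sub>F s in at_right 0. adj ((1 / s) *\<^sub>R (U s - idm N)) * U s + (1 / s) *\<^sub>R (U s - idm N) = 0"
  proof (rule eventually_mono[OF eventually_at_right_pos])
    fix s :: real assume "0 < s"
    hence "unitary_on N (U s)" using U(1) G_unitary by blast
    thus "adj ((1 / s) *\<^sub>R (U s - idm N)) * U s + (1 / s) *\<^sub>R (U s - idm N) = 0"
      by (simp add: unitary_on_def left_diff_distrib scaleR_diff_right)
  qed
  ultimately have "((\<lambda>s. 0) \<longlongrightarrow> adj A * idm N + A) (at_right (0::real))"
    by (rule Lim_transform_eventually)
  hence "adj A * idm N + A = 0" by (rule tendsto_unique[OF at_right_le _ tendsto_const])
  hence "adj A + A = 0" using T_supp[OF assms] by simp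
  thus ?thesis by (simp add: eq_neg_iff_add_eq_0)
qed

text \<open>The adjoint curve has tangent \<open>adj A = - A\<close>. This is where closure of
  \<open>G\<close> under adjoints turns a cone of directions into a real vector space.\<close>

lemma T_uminus:
  assumes "A \<in> T"
  shows "- A \<in> T"
proof -
  obtain U where U0: "\<forall>s>0. U s \<in> G" and U1: "((\<lambda>s. (1 / s) *\<^sub>R (U s - idm N)) \<longlongrightarrow> A) (at_right 0)"
    using T_memD[OF assms(1)] by (elim exE conjE) (rule that)
  note U = U0[rule_format] U1
  have "((\<lambda>s. adj ((1 / s) *\<^sub>R (U s - idm N))) \<longlongrightarrow> adj A) (at_right 0)" by (intro tendsto_intros U)
  hence "((\<lambda>s. (1 / s) *\<^sub>R (adj (U s) - idm N)) \<longlongrightarrow> - A) (at_right 0)" by (simp add: T_antiherm[OF assms])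
  thus ?thesis by (rule T_memI[rotated]) (intro G_adj U(1))
qed

lemma T_scaleR_pos:
  assumes "A \<in> T" "0 < r"
  shows "r *\<^sub>R A \<in> T"
proof -
  obtain U where U0: "\<forall>s>0. U s \<in> G" and U1: "((\<lambda>s. (1 / s) *\<^sub>R (U s - idm N)) \<longlongrightarrow> A) (at_right 0)"
    using T_memD[OF assms(1)] by (elim exE conjE) (rule that)
  note U = U0[rule_format] U1
  have "filterlim (\<lambda>s. r * s) (at_right 0) (at_right (0::real))"
    unfolding filterlim_at using assms(2)
    by (auto intro!: tendsto_eq_intros eventually_mono[OF eventually_at_right_pos])
  from filterlim_compose[OF U(2) this]
  have "((\<lambda>s. r *\<^sub>R ((1 / (r * s)) *\<^sub>R (U (r * s) - idm N))) \<longlongrightarrow> r *\<^sub>R A) (at_right 0)"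
    by (intro tendsto_intros)
  hence "((\<lambda>s. (1 / s) *\<^sub>R (U (r * s) - idm N)) \<longlongrightarrow> r *\<^sub>R A) (at_right 0)" using assms(2) by simp
  thus ?thesis by (rule T_memI[rotated]) (use U(1) assms(2) in simp)
qed

lemma T_scaleR:
  assumes "A \<in> T"
  shows "r *\<^sub>R A \<in> T"
proof -
  consider "r = 0" | "0 < r" | "0 < - r" by linarith
  thus ?thesis
  proof cases
    case 3
    thus ?thesis using T_scaleR_pos[OF T_uminus[OF assms], of "- r"] by simp
  qed (simp_all add: T_zero T_scaleR_pos assms)
qed

lemma T_diff: "A \<in> T \<Longrightarrow> B \<in> T \<Longrightarrow> A - B \<in> T"
  using T_add[of A "- B"] T_uminus[of B] by simp

lemma T_conj:
  assumes "A \<in> T" and W: "W \<in> G"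
  shows "W * A * adj W \<in> T"
proof -
  obtain U where U0: "\<forall>s>0. U s \<in> G" and U1: "((\<lambda>s. (1 / s) *\<^sub>R (U s - idm N)) \<longlongrightarrow> A) (at_right 0)"
    using T_memD[OF assms(1)] by (elim exE conjE) (rule that)
  note U = U0[rule_format] U1
  have "((\<lambda>s. W * ((1 / s) *\<^sub>R (U s - idm N)) * adj W) \<longlongrightarrow> W * A * adj W) (at_right 0)"
    by (intro tendsto_intros U)
  hence "((\<lambda>s. (1 / s) *\<^sub>R (W * U s * adj W - idm N)) \<longlongrightarrow> W * A * adj W) (at_right 0)"
    using G_unitary[OF W] by (simp add: left_diff_distrib right_diff_distrib unitary_on_def)
  thus ?thesis by (rule T_memI[rotated]) (intro G_mult G_adj W U(1))
qed

text \<open>Taking for each \<open>s\<close> the point of \<open>G\<close> closest to \<open>1 + sA\<close> gives a curve tangent to \<open>A\<close>.\<close>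

lemma T_closed:
  assumes "\<And>\<epsilon>. 0 < \<epsilon> \<Longrightarrow> \<exists>B\<in>T. norm (B - A) < \<epsilon>"
  shows "A \<in> T"
proof -
  have "\<exists>U\<in>G. \<forall>W\<in>G. norm (U - idm N - s *\<^sub>R A) \<le> norm (W - idm N - s *\<^sub>R A)" for s
    using idm_G by (intro continuous_attains_inf[OF compact_G] continuous_intros) blast
  then obtain U where U: "\<And>s. U s \<in> G" "\<And>s W. W \<in> G \<Longrightarrow> norm (U s - idm N - s *\<^sub>R A) \<le> norm (W - idm N - s *\<^sub>R A)"
    by metis
  have "((\<lambda>s. (1 / s) *\<^sub>R (U s - idm N)) \<longlongrightarrow> A) (at_right 0)"
  proof (rule tendstoI)
    fix \<epsilon> :: real assume \<epsilon>: "0 < \<epsilon>"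
    then obtain B where B: "B \<in> T" "norm (B - A) < \<epsilon> / 2" using assms[of "\<epsilon> / 2"] by auto
    obtain W where W0: "\<forall>s>0. W s \<in> G" and W1: "((\<lambda>s. (1 / s) *\<^sub>R (W s - idm N)) \<longlongrightarrow> B) (at_right 0)"
      using T_memD[OF B(1)] by (elim exE conjE) (rule that)
    note W = W0[rule_format] W1
    have "\<forall>\<^sub>F s in at_right 0. dist ((1 / s) *\<^sub>R (W s - idm N)) B < \<epsilon> / 2"
      using tendstoD[OF W(2), of "\<epsilon> / 2"] \<epsilon> by simp
    thus "\<forall>\<^sub>F s in at_right 0. dist ((1 / s) *\<^sub>R (U s - idm N)) A < \<epsilon>"
      using eventually_at_right_pos
    proof eventually_elim
      case (elim s)
      have eq: "norm ((1 / s) *\<^sub>R (Y - idm N) - A) = (1 / s) * norm (Y - idm N - s *\<^sub>R A)" for Y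
      proof -
        have "(1 / s) *\<^sub>R (Y - idm N) - A = (1 / s) *\<^sub>R (Y - idm N - s *\<^sub>R A)"
          using elim(2) by (simp add: scaleR_diff_right)
        thus ?thesis using elim(2) by simp
      qed
      have "norm ((1 / s) *\<^sub>R (U s - idm N) - A) \<le> norm ((1 / s) *\<^sub>R (W s - idm N) - A)"
        unfolding eq using U(2)[of "W s" s] W(1) elim(2) by (simp add: divide_right_mono)
      also have "\<dots> \<le> norm ((1 / s) *\<^sub>R (W s - idm N) - B) + norm (B - A)"
        using norm_triangle_ineq[of "(1 / s) *\<^sub>R (W s - idm N) - B" "B - A"] by simp
      also have "\<dots> < \<epsilon>" using elim(1) B(2) by (simp add: dist_norm)
      finally show ?case by (simp add: dist_norm)
    qed
  qed
  thus ?thesis by (rule T_memI[OF U(1)])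
qed

text \<open>The derivative of conjugation at the identity, from
  \<open>U B U' - B = (U - 1) B U' + B (U - 1)'\<close> with a prime for the adjoint, and
  anti-Hermiticity of \<open>A\<close>.\<close>

lemma tangent_conj_limit:
  assumes U: "\<And>s. 0 < s \<Longrightarrow> U s \<in> G" "((\<lambda>s. (1 / s) *\<^sub>R (U s - idm N)) \<longlongrightarrow> A) (at_right 0)"
    and B: "B \<in> supp_on N"
  shows "((\<lambda>s. (1 / s) *\<^sub>R (U s * B * adj (U s) - B)) \<longlongrightarrow> A * B - B * A) (at_right 0)"
proof -
  have A: "A \<in> T" using U by (rule T_memI)
  have "((\<lambda>s. (1 / s) *\<^sub>R (U s - idm N) * B * adj (U s) + B * adj ((1 / s) *\<^sub>R (U s - idm N)))
      \<longlongrightarrow> A * B * adj (idm N) + B * adj A) (at_right 0)"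
    by (intro tendsto_intros U tangent_curve_limit[OF U(2)])
  moreover have "\<forall>\<^sub>F s in at_right 0. (1 / s) *\<^sub>R (U s - idm N) * B * adj (U s) +
      B * adj ((1 / s) *\<^sub>R (U s - idm N)) = (1 / s) *\<^sub>R (U s * B * adj (U s) - B)"
  proof (rule eventually_mono[OF eventually_at_right_pos])
    fix s :: real assume "0 < s"
    hence "U s \<in> supp_on N" by (intro G_supp U(1))
    thus "(1 / s) *\<^sub>R (U s - idm N) * B * adj (U s) +
        B * adj ((1 / s) *\<^sub>R (U s - idm N)) = (1 / s) *\<^sub>R (U s * B * adj (U s) - B)"
      using B by (simp add: left_diff_distrib right_diff_distrib scaleR_diff_right)
  qed
  ultimately have "((\<lambda>s. (1 / s) *\<^sub>R (U s * B * adj (U s) - B)) \<longlongrightarrow>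
      A * B * adj (idm N) + B * adj A) (at_right 0)"
    by (rule Lim_transform_eventually)
  moreover have "A * B * adj (idm N) + B * adj A = A * B - B * A"
    using T_supp[OF A] B by (simp add: T_antiherm[OF A])
  ultimately show ?thesis by (simp only:)
qed

text \<open>For each \<open>s\<close> the quotient of \<open>U B U' - B\<close> by \<open>s\<close>
  already lies in \<open>T\<close>, a conjugation-invariant vector space; the bracket is the limit,
  and \<open>T\<close> is closed.\<close>

lemma T_bracket:
  assumes A: "A \<in> T" and B: "B \<in> T"
  shows "A * B - B * A \<in> T"
proof (rule T_closed)
  fix \<epsilon> :: real assume \<epsilon>: "0 < \<epsilon>"
  obtain U where U0: "\<forall>s>0. U s \<in> G" and U1: "((\<lambda>s. (1 / s) *\<^sub>R (U s - idm N)) \<longlongrightarrow> A) (at_right 0)"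
    using T_memD[OF A] by (elim exE conjE) (rule that)
  note U = U0[rule_format] U1
  let ?C = "\<lambda>s. (1 / s) *\<^sub>R (U s * B * adj (U s) - B)"
  have "(?C \<longlongrightarrow> A * B - B * A) (at_right 0)" by (rule tangent_conj_limit[OF U T_supp[OF B]])
  hence "\<forall>\<^sub>F s in at_right 0. dist (?C s) (A * B - B * A) < \<epsilon> \<and> 0 < s"
    by (intro eventually_conj tendstoD[OF _ \<epsilon>] eventually_at_right_pos)
  then obtain s where s: "dist (?C s) (A * B - B * A) < \<epsilon>" "0 < s"
    using eventually_happens'[OF at_right_le] by blast
  have "?C s \<in> T" using U(1) s(2) B by (intro T_scaleR T_diff T_conj)
  thus "\<exists>C\<in>T. norm (C - (A * B - B * A)) < \<epsilon>" using s(1) unfolding dist_norm by (intro bexI)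
qed

lemma K_zero: "K u 0 = csc (- \<i>) (h u)" "adj (K u 0) = - K u 0"
  by (auto simp: K_def intro!: fmat_eqI)

lemma flowI:
  assumes "0 \<le> \<tau>" "x 0 = A" "x \<tau> = B" "\<And>t. t \<in> {0..\<tau>} \<Longrightarrow> x t \<in> supp_on N"
    "\<And>t. t \<in> {0..\<tau>} \<Longrightarrow> (x has_vector_derivative L u \<gamma> (x t)) (at t within {0..\<tau>})"
  shows "flow u \<gamma> \<tau> A B"
  unfolding flow_def using assms by (intro conjI exI[of _ x] ballI)

text \<open>The propagator \<open>E\<close> of the noiseless equation is unitary because
  \<open>adj E * E\<close> has zero derivative, and conjugation by it solves the flow, so it stays
  in \<open>G\<close> for all positive times.\<close>

lemma hamiltonian_T: "csc (- \<i>) (h u) \<in> T"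
proof -
  have "\<exists>C. \<forall>A\<in>supp_on N. \<exists>x. x 0 = A \<and> norm (x (0::real)) \<le> C * norm A \<and>
    (\<forall>t. x t \<in> supp_on N \<and> (x has_vector_derivative K u 0 * x t) (at t))"
    by (rule linear_ode_exists) (simp_all add: distrib_left)
  then obtain C where C: "\<forall>A\<in>supp_on N. \<exists>x. x 0 = A \<and> norm (x (0::real)) \<le> C * norm A \<and>
    (\<forall>t. x t \<in> supp_on N \<and> (x has_vector_derivative K u 0 * x t) (at t))" ..
  obtain E where E0: "E 0 = idm N"
    and E: "\<forall>t. E t \<in> supp_on N \<and> (E has_vector_derivative K u 0 * E t) (at t)"
    using bspec[OF C idm_supp] by (elim exE conjE) (rule that)
  have Es: "\<And>t. E t \<in> supp_on N" and E': "\<And>t. (E has_vector_derivative K u 0 * E t) (at t)"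
    using E by simp_all
  have aE': "((\<lambda>s. adj (E s)) has_vector_derivative - (adj (E t) * K u 0)) (at t)" for t
    using bounded_linear.has_vector_derivative[OF bounded_linear_adj E'[of t]] by (simp add: K_zero(2))
  have "((\<lambda>s. adj (E s) * E s) has_vector_derivative 0) (at t within UNIV)" for t
    using has_vector_derivative_mult[OF aE' E', of t] by (simp add: mult.assoc)
  then obtain c where c: "\<And>t. adj (E t) * E t = c"
    using has_vector_derivative_zero_constant[of UNIV "\<lambda>s. adj (E s) * E s"] by auto
  have "adj (E t) * E t = idm N" for t using c[of 0] c[of t] E0 by simp
  hence Eu: "unitary_on N (E t)" for t by (intro unitary_onI Es)
  have "E t \<in> G" if t: "0 < t" for t
    unfolding G_def
  proof (intro CollectI conjI Eu ballI)
    fix A assume A: "A \<in> supp_on N"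
    have "flow u 0 t A (E t * A * adj (E t))"
    proof (rule flowI[of t "\<lambda>s. E s * A * adj (E s)"])
      show "0 \<le> t" using t by simp
      show "E 0 * A * adj (E 0) = A" using A by (simp add: E0)
      fix s
      show "E s * A * adj (E s) \<in> supp_on N" using A Es by simp
      have "((\<lambda>s. E s * A * adj (E s)) has_vector_derivative
          E s * A * (- (adj (E s) * K u 0)) + K u 0 * E s * A * adj (E s)) (at s)"
        by (rule has_vector_derivative_mult[OF has_vector_derivative_mult_left[OF E'] aE'])
      moreover have "E s * A * (- (adj (E s) * K u 0)) + K u 0 * E s * A * adj (E s) =
          L u 0 (E s * A * adj (E s))"
        by (simp add: L_def K_zero(2) mult.assoc)
      ultimately have "((\<lambda>s. E s * A * adj (E s)) has_vector_derivative L u 0 (E s * A * adj (E s))) (at s)"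
        by (simp only:)
      thus "((\<lambda>s. E s * A * adj (E s)) has_vector_derivative L u 0 (E s * A * adj (E s))) (at s within {0..t})"
        by (rule has_vector_derivative_at_within)
    qed simp
    hence "E t * A * adj (E t) \<in> reachable A" by (rule reachable.step[OF reachable.init insertI1])
    thus "E t * A * adj (E t) \<in> closure (reachable A)" by (rule subsetD[OF closure_subset])
  qed
  moreover have "(E has_vector_derivative K u 0) (at 0)" using E'[of 0] by (simp add: E0)
  hence "((\<lambda>s. (1 / s) *\<^sub>R (E s - idm N)) \<longlongrightarrow> csc (- \<i>) (h u)) (at_right 0)"
    unfolding K_zero(1) by (rule derivative_imp_tangent) (rule E0)
  ultimately show ?thesis by (rule T_memI)
qed

end



section \<open>Steering diagonal states\<close>

context lindblad
begin

text \<open>Telescoping. In this norm a unitary may have norm above one, so bounding factor by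
  factor would grow exponentially in \<open>k\<close>. The prefix \<open>Z\<close> collects the
  unitaries already split off, so each step costs the same bounded factor.\<close>

lemma norm_pow_diff_le:
  assumes "unitary_on N U" "unitary_on N W" "unitary_on N Z"
  shows "norm (Z * (pow U k - pow W k)) \<le> real k * ((real N * real N) * norm (U - W) * (real N * real N))"
  using assms(3)
proof (induction k arbitrary: Z)
  case (Suc k)
  let ?b = "real N * real N"
  have "Z * (pow U (Suc k) - pow W (Suc k)) = (Z * U) * (pow U k - pow W k) + Z * (U - W) * pow W k"
    by (simp add: algebra_simps)
  hence "norm (Z * (pow U (Suc k) - pow W (Suc k))) \<le>
      norm ((Z * U) * (pow U k - pow W k)) + norm (Z * (U - W) * pow W k)"
    by (simp only: norm_triangle_ineq)
  moreover have "norm ((Z * U) * (pow U k - pow W k)) \<le> real k * (?b * norm (U - W) * ?b)"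
    using Suc.prems assms(1) by (intro Suc.IH unitary_on_mult)
  moreover have "norm (Z * (U - W) * pow W k) \<le> ?b * norm (U - W) * ?b"
  proof -
    have "norm (Z * (U - W) * pow W k) \<le> norm (Z * (U - W)) * norm (pow W k)" by (rule norm_mult_ineq)
    also have "\<dots> \<le> (norm Z * norm (U - W)) * norm (pow W k)"
      by (intro mult_right_mono norm_mult_ineq norm_ge_zero)
    also have "\<dots> \<le> ?b * norm (U - W) * ?b"
      using unitary_on_norm_le[OF Suc.prems] unitary_on_norm_le[OF pow_unitary[OF assms(2)], of k]
      by (intro mult_mono) simp_all
    finally show ?thesis .
  qed
  ultimately show ?case by (simp add: algebra_simps)
qed simp

text \<open>A one-parameter group of unitaries whose generator lies in \<open>T\<close> is contained in \<open>G\<close>: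
  compare \<open>R t = (R (t/k))\<^sup>k\<close> with \<open>(U (t/k))\<^sup>k\<close> for a curve \<open>U\<close> in \<open>G\<close> with the same tangent.\<close>

lemma one_parameter_group_G:
  assumes A: "A \<in> T" and R: "\<And>t. unitary_on N (R t)" "\<And>s t. R (s + t) = R s * R t" "R 0 = idm N"
    and R': "(R has_vector_derivative A) (at 0)" and t: "0 < t"
  shows "R t \<in> G"
proof -
  obtain U where U0: "\<forall>s>0. U s \<in> G" and U1: "((\<lambda>s. (1 / s) *\<^sub>R (U s - idm N)) \<longlongrightarrow> A) (at_right 0)"
    using T_memD[OF A] by (elim exE conjE) (rule that)
  \<comment> \<open>\<open>Suc k\<close> avoids division by zero; \<open>Suc k\<close> steps of this
    length make up \<open>t\<close> exactly.\<close>
  define s where "s k = t / real (Suc k)" for k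
  have s_pos: "0 < s k" for k using t by (simp add: s_def)
  have s_lim: "filterlim s (at_right 0) sequentially"
    unfolding filterlim_at
  proof
    show "\<forall>\<^sub>F k in sequentially. s k \<in> {0<..} \<and> s k \<noteq> 0" using s_pos less_imp_neq by (auto simp: less_le)
    show "s \<longlonglongrightarrow> 0"
      unfolding s_def using lim_const_over_n[of t] by (rule LIMSEQ_Suc)
  qed
  have Rpow: "pow (R r) k = R (real k * r)" for r k
    by (induction k) (simp_all add: R(2)[symmetric] R(3) distrib_right)
  have eq: "real (Suc k) * s k = t" for k by (simp add: s_def)
  \<comment> \<open>Both difference quotients tend to \<open>A\<close>. The \<open>Suc k\<close>
    steps each err by \<open>s k * norm (?D k)\<close>, so the total error is of order
    \<open>t * norm (?D k)\<close>.\<close>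
  let ?D = "\<lambda>k. (1 / s k) *\<^sub>R (U (s k) - idm N) - (1 / s k) *\<^sub>R (R (s k) - idm N)"
  let ?c = "real N * real N * t * (real N * real N)"
  have "?D \<longlonglongrightarrow> A - A"
    by (intro tendsto_diff filterlim_compose[OF U1 s_lim]
        filterlim_compose[OF derivative_imp_tangent[OF R' R(3)] s_lim])
  hence "?D \<longlonglongrightarrow> 0" by (simp only: diff_self)
  hence Dlim: "(\<lambda>k. ?c * norm (?D k)) \<longlonglongrightarrow> 0"
    by (intro tendsto_mult_right_zero tendsto_norm_zero)
  have bound: "norm (pow (U (s k)) (Suc k) - R t) \<le> ?c * norm (?D k)" for k
  proof -
    have Uk: "unitary_on N (U (s k))" using U0 s_pos G_unitary by simp
    have "norm (U (s k) - R (s k)) = s k * norm (?D k)"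
    proof -
      have "U (s k) - R (s k) = s k *\<^sub>R ?D k" using s_pos[of k] by (simp add: scaleR_diff_right)
      thus ?thesis using s_pos[of k] by simp
    qed
    moreover have "norm (idm N * (pow (U (s k)) (Suc k) - pow (R (s k)) (Suc k))) \<le>
        real (Suc k) * ((real N * real N) * norm (U (s k) - R (s k)) * (real N * real N))"
      by (rule norm_pow_diff_le[OF Uk R(1) unitary_on_idm])
    moreover have "idm N * (pow (U (s k)) (Suc k) - pow (R (s k)) (Suc k)) = pow (U (s k)) (Suc k) - R t"
      using Uk R(1)[of t] by (simp only: Rpow eq) (simp add: unitary_on_supp)
    ultimately have "norm (pow (U (s k)) (Suc k) - R t) \<le>
        real (Suc k) * ((real N * real N) * (s k * norm (?D k)) * (real N * real N))" by (simp only:)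
    also have "\<dots> = real N * real N * (real (Suc k) * s k) * (real N * real N) * norm (?D k)"
      by (simp only: mult_ac)
    finally show ?thesis by (simp only: eq)
  qed
  have "(\<lambda>k. pow (U (s k)) (Suc k) - R t) \<longlonglongrightarrow> 0"
    by (rule Lim_null_comparison[OF _ Dlim]) (intro always_eventually allI bound)
  hence lim: "(\<lambda>k. pow (U (s k)) (Suc k)) \<longlonglongrightarrow> R t" by (rule LIM_zero_cancel)
  have "pow (U (s k)) (Suc k) \<in> G" for k using U0 s_pos by (intro pow_G) simp
  thus ?thesis using lim by (rule closed_sequentially[OF closed_G])
qed

end

lemma adj_munit: "adj (munit p q) = munit q p"
  by (rule fmat_eqI) (simp add: conj_commute)

lemma munit_mult: "munit p q * munit r s = (if q = r then munit p s else 0)"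
proof (rule fmat_eqI)
  fix i j
  have "munit p q \<in> supp_on (Suc (max p q))" by (intro munit_supp) simp_all
  from ent_mult[OF this, of "munit r s" i j]
  have "ent (munit p q * munit r s) i j =
      (\<Sum>k<Suc (max p q). if k = q then (if i = p \<and> q = r \<and> j = s then 1 else 0) else 0)"
    by (simp only:) (intro sum.cong refl, auto)
  also have "\<dots> = (if i = p \<and> q = r \<and> j = s then 1 else 0)" by (subst sum.delta) auto
  finally show "ent (munit p q * munit r s) i j = ent (if q = r then munit p s else 0) i j" by simp
qed

lemma sum_pairs:
  fixes n :: nat
  shows "(\<Sum>i<2 * n. f i) = (\<Sum>k<n. f (2 * k) + f (2 * k + 1) :: 'a :: comm_monoid_add)"
  by (induction n) (simp_all add: add.assoc)

text \<open>\<open>u0\<close> stands for a control value with diagonal Hamiltonian, later all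
  amplitudes zero with only the drift left. The Lie algebra condition enters through
  \<open>su_T\<close> alone.\<close>

locale amplitude_damping = lindblad N h V \<gamma>s
  for N :: nat and h :: "'u \<Rightarrow> fmat" and V :: fmat and \<gamma>s :: real +
  fixes u0 :: 'u
  assumes N_even: "even N" and N_ge2: "2 \<le> N"
    and V_eq: "V = cutoff N (\<lambda>i j. if even i \<and> j = i + 1 then 1 else 0)"
    and h0_diag: "i \<noteq> j \<Longrightarrow> ent (h u0) i j = 0"
    and su_T: "X \<in> supp_on N \<Longrightarrow> adj X = - X \<Longrightarrow> tr X = 0 \<Longrightarrow> X \<in> T"
begin

text \<open>A maximiser of \<open>U \<mapsto> tr (C U A U\<^sup>\<dagger>)\<close> over \<open>G\<close> yields a critical point, where
  \<open>U A U\<^sup>\<dagger>\<close> commutes with \<open>C\<close>; since \<open>C\<close> has simple spectrum, \<open>U A U\<^sup>\<dagger>\<close> is diagonal.\<close>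

lemma diagonalize_in_G:
  assumes A: "A \<in> supp_on N" "adj A = A"
  shows "\<exists>U\<in>G. \<forall>i j. i \<noteq> j \<longrightarrow> ent (U * A * adj U) i j = 0"
proof -
  \<comment> \<open>The entries \<open>0, ..., N - 1\<close> are distinct, so only diagonal matrices
    in the block commute with \<open>C\<close>.\<close>
  define C where "C = cutoff N (\<lambda>i j. if i = j then of_nat i else 0)"
  have C: "C \<in> supp_on N" "adj C = C" by (auto simp: C_def intro!: fmat_eqI)
  have "\<exists>U\<in>G. \<forall>W\<in>G. Re (tr (C * (W * A * adj W))) \<le> Re (tr (C * (U * A * adj U)))"
    using idm_G by (intro continuous_attains_sup[OF compact_G] continuous_intros) blast
  then obtain U where U: "U \<in> G" and max: "\<forall>W\<in>G. Re (tr (C * (W * A * adj W))) \<le> Re (tr (C * (U * A * adj U)))" ..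
  define B where "B = U * A * adj U"
  have B: "B \<in> supp_on N" "adj B = B" using A G_supp[OF U] by (simp_all add: B_def mult.assoc)
  \<comment> \<open>A commutator of Hermitian matrices is anti-Hermitian and traceless, hence a
    tangent direction. Along \<open>- X\<close> the objective changes at the rate computed
    below.\<close>
  define X where "X = B * C - C * B"
  have X: "X \<in> supp_on N" "adj X = - X" using B C by (simp_all add: X_def)
  moreover have "tr X = 0" using tr_commute[of B C] by (simp add: X_def)
  ultimately have nX: "- X \<in> T" by (intro T_uminus su_T)
  obtain W where W0: "\<forall>s>0. W s \<in> G" and W1: "((\<lambda>s. (1 / s) *\<^sub>R (W s - idm N)) \<longlongrightarrow> - X) (at_right 0)"
    using T_memD[OF nX] by (elim exE conjE) (rule that)
  have "((\<lambda>s. Re (tr (C * ((1 / s) *\<^sub>R (W s * B * adj (W s) - B))))) \<longlongrightarrow>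
      Re (tr (C * (- X * B - B * (- X))))) (at_right 0)"
    by (intro tendsto_intros tangent_conj_limit[OF W0[rule_format] W1 B(1)])
  moreover have "\<forall>\<^sub>F s in at_right 0. Re (tr (C * ((1 / s) *\<^sub>R (W s * B * adj (W s) - B)))) \<le> 0"
  proof (rule eventually_mono[OF eventually_at_right_pos])
    fix s :: real assume s: "0 < s"
    hence "W s * U \<in> G" using W0 U by (intro G_mult) simp_all
    with max have "Re (tr (C * ((W s * U) * A * adj (W s * U)))) \<le> Re (tr (C * (U * A * adj U)))" ..
    hence "Re (tr (C * (W s * B * adj (W s)))) - Re (tr (C * B)) \<le> 0" by (simp add: B_def mult.assoc)
    hence "(1 / s) * (Re (tr (C * (W s * B * adj (W s)))) - Re (tr (C * B))) \<le> 0"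
      using s by (intro mult_nonneg_nonpos) simp_all
    thus "Re (tr (C * ((1 / s) *\<^sub>R (W s * B * adj (W s) - B)))) \<le> 0"
      by (simp add: right_diff_distrib del: of_real_divide)
  qed
  ultimately have "Re (tr (C * (- X * B - B * (- X)))) \<le> 0"
    by (rule tendsto_upperbound[OF _ _ at_right_le])
  \<comment> \<open>The first variation equals the squared Frobenius norm of \<open>X\<close>, while
    maximality makes it nonpositive.\<close>
  moreover have "tr (C * (- X * B - B * (- X))) = tr (X * adj X)"
  proof -
    have "tr (C * (- X * B - B * (- X))) = tr (C * B * X) - tr (C * X * B)"
      by (simp add: algebra_simps)
    also have "tr (C * X * B) = tr (X * (B * C))" using tr_commute[of C "X * B"] by (simp add: mult.assoc)
    also have "tr (C * B * X) = tr (X * (C * B))" by (rule tr_commute)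
    finally show ?thesis by (simp add: X(2)) (simp add: X_def algebra_simps)
  qed
  ultimately have "X = 0" by (intro tr_adj_mult_self_le_0) simp
  have "ent B i j = 0" if "i \<noteq> j" for i j
  proof (cases "i < N \<and> j < N")
    case True
    have "ent (B * C) i j = (\<Sum>k<N. if k = j then ent B i j * of_nat j else 0)"
      using True by (subst ent_mult[OF B(1)]) (intro sum.cong refl, auto simp: C_def)
    also have "\<dots> = ent B i j * of_nat j" using True by (subst sum.delta) auto
    finally have 1: "ent (B * C) i j = ent B i j * of_nat j" .
    have "ent (C * B) i j = (\<Sum>k<N. if k = i then of_nat i * ent B i j else 0)"
      using True by (subst ent_mult[OF C(1)]) (intro sum.cong refl, auto simp: C_def)
    also have "\<dots> = of_nat i * ent B i j" using True by (subst sum.delta) auto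
    finally have 2: "ent (C * B) i j = of_nat i * ent B i j" .
    \<comment> \<open>Commuting with \<open>C\<close> multiplies the entry by a difference of
      eigenvalues, nonzero off the diagonal.\<close>
    have "(of_nat j - of_nat i) * ent B i j = ent X i j"
      by (simp add: X_def 1 2 algebra_simps)
    also have "\<dots> = 0" by (simp add: \<open>X = 0\<close>)
    finally show ?thesis using that by simp
  next
    case False
    thus ?thesis using supp_onD[OF B(1), of i j] by auto
  qed
  thus ?thesis using U by (intro bexI[of _ U]) (simp_all add: B_def)
qed

section \<open>Diagonal matrices\<close>

definition dg :: "(nat \<Rightarrow> real) \<Rightarrow> fmat" where
  "dg x = cutoff N (\<lambda>i j. if i = j then of_real (x i) else 0)"

lemma ent_dg [simp]: "ent (dg x) i j = (if i = j \<and> i < N then of_real (x i) else 0)"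
  by (auto simp: dg_def)

lemma dg_supp [simp, intro]: "dg x \<in> supp_on N"
  by (simp add: dg_def)

lemma dg_cong: "(\<And>i. i < N \<Longrightarrow> x i = y i) \<Longrightarrow> dg x = dg y"
  by (intro fmat_eqI) simp

lemma ent_mult_dg: "j < N \<Longrightarrow> ent (A * dg x) i j = ent A i j * of_real (x j)"
proof -
  assume j: "j < N"
  have "ent (A * dg x) i j = (\<Sum>k<N. if k = j then ent A i j * of_real (x j) else 0)"
    using j by (subst ent_mult'[OF dg_supp]) (intro sum.cong refl, auto)
  thus ?thesis using j by (subst (asm) sum.delta) auto
qed

lemma ent_dg_mult: "i < N \<Longrightarrow> ent (dg x * A) i j = of_real (x i) * ent A i j"
proof -
  assume i: "i < N"
  have "ent (dg x * A) i j = (\<Sum>k<N. if k = i then of_real (x i) * ent A i j else 0)"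
    using i by (subst ent_mult[OF dg_supp]) (intro sum.cong refl, auto)
  thus ?thesis using i by (subst (asm) sum.delta) auto
qed

lemma ent_conj_dg:
  assumes "A \<in> supp_on N"
  shows "ent (A * dg x * adj A) i j = (\<Sum>k<N. ent A i k * of_real (x k) * cnj (ent A j k))"
  using assms by (subst ent_mult[of _ N]) (simp_all add: ent_mult_dg)

subsection \<open>Permutations\<close>

text \<open>A quarter turn in the plane of \<open>p\<close> and \<open>q\<close> is a transposition
  up to one sign; its traceless generator places it in \<open>G\<close>, and the sign disappears on
  conjugating a diagonal matrix.\<close>

lemma rotation_G:
  assumes pq: "p < N" "q < N" "p \<noteq> q"
  shows "idm N + munit p q - munit q p - munit p p - munit q q \<in> G"
proof -
  define X where "X = munit p q - munit q p"
  have Xs: "X \<in> supp_on N" using pq by (simp add: X_def)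
  have adjX: "adj X = - X" by (simp add: X_def adj_munit)
  have "ent X i i = 0" for i using pq(3) by (simp add: X_def)
  hence "tr X = 0" by (simp add: tr_supp[OF Xs])
  with Xs adjX have XT: "X \<in> T" by (rule su_T)
  have X2: "X * X = - munit p p - munit q q"
    using pq(3) by (simp add: X_def left_diff_distrib right_diff_distrib munit_mult)
  have X3: "X * (X * X) = - X"
    unfolding X2 using pq(3) by (simp add: X_def left_diff_distrib right_diff_distrib munit_mult)
  \<comment> \<open>The exponential of \<open>\<theta>\<close> times \<open>X\<close>, in closed
    form because the cube of \<open>X\<close> is \<open>- X\<close> (Rodrigues).\<close>
  define R where "R \<theta> = idm N + sin \<theta> *\<^sub>R X + (1 - cos \<theta>) *\<^sub>R (X * X)" for \<theta>
  have Rs: "R \<theta> \<in> supp_on N" for \<theta> using Xs by (simp add: R_def)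
  have R0: "R 0 = idm N" by (simp add: R_def)
  have Radd: "R (s + t) = R s * R t" for s t
  proof -
    define Y where "Y = X * X"
    have XY: "X * Y = - X" "Y * X = - X" "Y * Y = - Y"
      using X3 by (simp_all add: Y_def mult.assoc)
    let ?a = "sin s" and ?b = "1 - cos s" and ?c = "sin t" and ?d = "1 - cos t"
    let ?R = "idm N + ?a *\<^sub>R X + ?b *\<^sub>R Y"
    have "R s * R t = ?R * idm N + ?c *\<^sub>R (?R * X) + ?d *\<^sub>R (?R * Y)"
      by (simp only: R_def Y_def[symmetric] distrib_left mult_scaleR_right)
    moreover have "?R * idm N = ?R" using Xs by (simp add: Y_def)
    moreover have "?R * X = X - ?b *\<^sub>R X + ?a *\<^sub>R Y"
      using Xs by (simp add: distrib_right XY) (simp add: Y_def)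
    moreover have "?R * Y = Y - ?a *\<^sub>R X - ?b *\<^sub>R Y"
      using Xs by (simp add: distrib_right XY) (simp add: Y_def)
    ultimately have "R s * R t = ?R + ?c *\<^sub>R (X - ?b *\<^sub>R X + ?a *\<^sub>R Y) + ?d *\<^sub>R (Y - ?a *\<^sub>R X - ?b *\<^sub>R Y)"
      by (simp only:)
    also have "\<dots> = idm N + (?a + ?c - ?a * ?d - ?b * ?c) *\<^sub>R X + (?b + ?d + ?a * ?c - ?b * ?d) *\<^sub>R Y"
      by (rule fmat_eqI) (simp add: algebra_simps)
    also have "sin s + sin t - sin s * (1 - cos t) - (1 - cos s) * sin t = sin (s + t)"
      by (simp add: sin_add algebra_simps)
    also have "(1 - cos s) + (1 - cos t) + sin s * sin t - (1 - cos s) * (1 - cos t) = 1 - cos (s + t)"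
      by (simp add: cos_add algebra_simps)
    finally show ?thesis by (simp only: R_def Y_def)
  qed
  have Radj: "adj (R t) = R (- t)" for t by (simp add: R_def adjX)
  have Runit: "unitary_on N (R t)" for t
    using Radd[of "- t" t] by (intro unitary_onI Rs) (simp add: Radj R0)
  have "(R has_vector_derivative cos 0 *\<^sub>R X + sin 0 *\<^sub>R (X * X)) (at 0)"
    unfolding R_def by (auto intro!: derivative_eq_intros)
  hence "(R has_vector_derivative X) (at 0)" by simp
  \<comment> \<open>At a quarter turn sine and 1 minus cosine are both one, so \<open>R\<close> is
    \<open>1 + X + X * X\<close>.\<close>
  from one_parameter_group_G[OF XT Runit Radd R0 this, of "pi / 2"]
  have "R (pi / 2) \<in> G" by simp
  moreover have "R (pi / 2) = idm N + munit p q - munit q p - munit p p - munit q q"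
    unfolding R_def X2 by (simp add: X_def algebra_simps)
  ultimately show ?thesis by (simp only:)
qed

lemma reach_transpose:
  assumes pq: "p < N" "q < N"
  shows "dg (x \<circ> Transposition.transpose p q) \<in> closure (reachable (dg x))"
proof (cases "p = q")
  case True
  thus ?thesis using subsetD[OF closure_subset reachable.init] by simp
next
  case False
  let ?t = "Transposition.transpose p q"
  define P where "P = idm N + munit p q - munit q p - munit p p - munit q q"
  have P: "P \<in> G" unfolding P_def using pq False by (rule rotation_G)
  \<comment> \<open>Row \<open>q\<close> carries the sign of the rotation.\<close>
  define sg :: "nat \<Rightarrow> complex" where "sg i = (if i = q then -1 else 1)" for i
  have Pent: "ent P i k = (if k = ?t i then sg i else 0)" if "i < N" "k < N" for i k
    using that False by (auto simp: P_def sg_def Transposition.transpose_def)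
  have "P * dg x * adj P = dg (x \<circ> ?t)"
  proof (rule supp_eqI)
    show "P * dg x * adj P \<in> supp_on N" using G_supp[OF P] by simp
    fix i j assume ij: "i < N" "j < N"
    have ti: "?t i < N" using pq ij by (auto simp: Transposition.transpose_def)
    have "ent (P * dg x * adj P) i j =
        (\<Sum>k<N. if k = ?t i then (if ?t i = ?t j then sg i * of_real (x (?t i)) * cnj (sg j) else 0) else 0)"
      unfolding ent_conj_dg[OF G_supp[OF P]] using ij by (intro sum.cong refl) (simp add: Pent)
    also have "\<dots> = (if ?t i = ?t j then sg i * of_real (x (?t i)) * cnj (sg j) else 0)"
      using ti by (subst sum.delta) simp_all
    also have "\<dots> = (if i = j then of_real (x (?t i)) else 0)"
      by (simp add: inj_eq[OF inj_transpose] sg_def)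
    finally show "ent (P * dg x * adj P) i j = ent (dg (x \<circ> ?t)) i j" using ij by simp
  qed simp
  thus ?thesis using G_reach[OF P dg_supp, of x] by simp
qed

lemma reach_permute:
  assumes "\<pi> permutes {..<N}"
  shows "dg (x \<circ> \<pi>) \<in> closure (reachable (dg x))"
  using assms finite_lessThan[of N]
proof (induction arbitrary: x rule: permutes_induct)
  case id
  thus ?case using subsetD[OF closure_subset reachable.init] by simp
next
  case (swap a b p)
  have "dg (x \<circ> Transposition.transpose a b) \<in> closure (reachable (dg x))"
    using swap.hyps by (intro reach_transpose) simp_all
  from closure_reachable_trans[OF this swap.IH dg_supp]
  show ?case by (simp add: o_assoc)
qed

subsection \<open>Amplitude damping\<close>

text \<open>\<open>l\<close> is the surviving fraction of each excited population,
  \<open>exp (- (\<gamma>s * t))\<close> after time \<open>t\<close>. Odd indices have the damped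
  qubit in its excited state.\<close>

definition damp :: "real \<Rightarrow> (nat \<Rightarrow> real) \<Rightarrow> nat \<Rightarrow> real" where
  "damp l x i = (if even i then x i + (1 - l) * x (i + 1) else l * x i)"

lemma even_Suc_less: "even i \<Longrightarrow> i < N \<Longrightarrow> Suc i < N"
  using N_even by (metis Suc_lessI even_Suc)

lemma ent_V: "i < N \<Longrightarrow> ent V i j = (if even i \<and> j = i + 1 then 1 else 0)"
  using even_Suc_less[of i] by (auto simp: V_eq)

lemma ent_adjV_V:
  assumes "i < N" "j < N"
  shows "ent (adj V * V) i j = (if odd i \<and> i = j then 1 else 0)"
proof -
  have "ent (adj V * V) i j = (\<Sum>k<N. if k = i - 1 then (if odd i \<and> i = j then 1 else 0) else 0)"
    using assms by (subst ent_mult'[OF V_supp], intro sum.cong refl) (auto simp: ent_V elim!: oddE)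
  also have "\<dots> = (if odd i \<and> i = j then 1 else 0)" using assms by (subst sum.delta) auto
  finally show ?thesis .
qed

lemma ent_V_dg_adjV:
  assumes "i < N" "j < N"
  shows "ent (V * dg y * adj V) i j = (if even i \<and> i = j then of_real (y (i + 1)) else 0)"
proof -
  have "ent (V * dg y * adj V) i j =
      (\<Sum>k<N. if k = i + 1 then (if even i \<and> i = j then of_real (y (i + 1)) else 0) else 0)"
    using assms by (subst ent_conj_dg[OF V_supp], intro sum.cong refl) (auto simp: ent_V)
  also have "\<dots> = (if even i \<and> i = j then of_real (y (i + 1)) else 0)"
    using even_Suc_less[of i] assms by (subst sum.delta) auto
  finally show ?thesis .
qed

text \<open>The diagonal Hamiltonian commutes with the state; \<open>adj V * V\<close> projects onto
  the odd levels, and the jump term deposits their population one index lower.\<close>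

lemma L_dg: "L u0 \<gamma> (dg y) = dg (\<lambda>i. if even i then \<gamma> * y (i + 1) else - (\<gamma> * y i))"
proof (rule supp_eqI)
  fix i j assume ij: "i < N" "j < N"
  \<comment> \<open>Diagonal entries of the Hamiltonian are real, so their contributions to
    \<open>K\<close> and its adjoint cancel.\<close>
  have real: "cnj (ent (h u0) j i) = ent (h u0) i j"
    using ent_adj[of "h u0" i j] unfolding h_adj by (rule sym)
  have "ent (L u0 \<gamma> (dg y)) i j = ent (K u0 \<gamma>) i j * of_real (y j) + of_real (y i) * cnj (ent (K u0 \<gamma>) j i)
      + of_real \<gamma> * (if even i \<and> i = j then of_real (y (i + 1)) else 0)"
    unfolding L_def using ij by (simp add: ent_mult_dg ent_dg_mult ent_V_dg_adjV)
  also have "\<dots> = ent (dg (\<lambda>i. if even i then \<gamma> * y (i + 1) else - (\<gamma> * y i))) i j"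
    using ij h0_diag[of i j] h0_diag[of j i] real by (auto simp: K_def ent_adjV_V algebra_simps)
  finally show "ent (L u0 \<gamma> (dg y)) i j = ent (dg (\<lambda>i. if even i then \<gamma> * y (i + 1) else - (\<gamma> * y i))) i j" .
qed simp_all

lemma reach_damp:
  assumes l: "0 < l" "l \<le> 1"
  shows "dg (damp l x) \<in> closure (reachable (dg x))"
proof -
  \<comment> \<open>The waiting time after which the fraction \<open>l\<close> survives; it is
    finite because \<open>l\<close> is positive.\<close>
  define \<tau> where "\<tau> = - ln l / \<gamma>s"
  have exp\<tau>: "exp (- (\<gamma>s * \<tau>)) = l" using l \<gamma>s_pos by (simp add: \<tau>_def)
  have "flow u0 \<gamma>s \<tau> (dg x) (dg (damp l x))"
  proof (rule flowI[of \<tau> "\<lambda>t. dg (damp (exp (- (\<gamma>s * t))) x)"])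
    show "0 \<le> \<tau>" using l \<gamma>s_pos by (simp add: \<tau>_def divide_nonpos_pos)
    show "dg (damp (exp (- (\<gamma>s * 0))) x) = dg x" by (rule dg_cong) (simp add: damp_def)
    show "dg (damp (exp (- (\<gamma>s * \<tau>))) x) = dg (damp l x)" by (simp add: exp\<tau>)
    show "dg (damp (exp (- (\<gamma>s * t))) x) \<in> supp_on N" for t by simp
    fix t
    assume t: "t \<in> {0..\<tau>}"
    show "((\<lambda>t. dg (damp (exp (- (\<gamma>s * t))) x)) has_vector_derivative
        L u0 \<gamma>s (dg (damp (exp (- (\<gamma>s * t))) x))) (at t within {0..\<tau>})"
    proof (rule has_vector_derivative_fmat[OF dg_supp _ t])
      fix i j assume ij: "i < N" "j < N"
      have "((\<lambda>t. damp (exp (- (\<gamma>s * t))) x i) has_real_derivative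
          (if even i then \<gamma>s * damp (exp (- (\<gamma>s * t))) x (i + 1)
           else - (\<gamma>s * damp (exp (- (\<gamma>s * t))) x i))) (at t within {0..\<tau>})"
        unfolding damp_def by (cases "even i") (auto intro!: derivative_eq_intros)
      hence "((\<lambda>t. complex_of_real (damp (exp (- (\<gamma>s * t))) x i)) has_vector_derivative
          of_real (if even i then \<gamma>s * damp (exp (- (\<gamma>s * t))) x (i + 1)
           else - (\<gamma>s * damp (exp (- (\<gamma>s * t))) x i))) (at t within {0..\<tau>})"
        by (intro has_vector_derivative_of_real) (simp add: has_real_derivative_iff_has_vector_derivative)
      thus "((\<lambda>s. ent (dg (damp (exp (- (\<gamma>s * s))) x)) i j) has_vector_derivative
          ent (L u0 \<gamma>s (dg (damp (exp (- (\<gamma>s * t))) x))) i j) (at t within {0..\<tau>})"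
        unfolding L_dg ent_dg using ij by (cases "i = j") simp_all
    qed simp
  qed
  hence "dg (damp l x) \<in> reachable (dg x)" by (intro reachable.step[OF reachable.init, of \<gamma>s]) simp_all
  thus ?thesis by (rule subsetD[OF closure_subset])
qed

end



context amplitude_damping
begin

section \<open>Probability vectors and the two halves of the transfer\<close>

definition prob :: "(nat \<Rightarrow> real) \<Rightarrow> bool" where
  "prob x \<longleftrightarrow> (\<forall>i<N. 0 \<le> x i) \<and> (\<Sum>i<N. x i) = 1"

definition unit_dist :: "nat \<Rightarrow> real" where
  "unit_dist i = (if i = 0 then 1 else 0)"

lemma prob_le_1: "prob x \<Longrightarrow> i < N \<Longrightarrow> x i \<le> 1"
  unfolding prob_def using member_le_sum[of i "{..<N}" x] by simp

lemma prob_concentrated: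
  assumes "prob x" "p < N" "\<And>i. i < N \<Longrightarrow> i \<noteq> p \<Longrightarrow> x i = 0" "i < N"
  shows "x i = (if i = p then 1 else 0)"
proof -
  have "(\<Sum>i<N. x i) = (\<Sum>i<N. if i = p then x p else 0)" using assms(3) by (intro sum.cong refl) auto
  also have "\<dots> = x p" using assms(2) by (subst sum.delta) auto
  finally have "x p = 1" using assms(1) by (simp add: prob_def)
  thus ?thesis using assms(3,4) by simp
qed

lemma prob_permute:
  assumes "prob x" "\<pi> permutes {..<N}"
  shows "prob (x \<circ> \<pi>)"
proof -
  have "\<pi> i < N" if "i < N" for i using permutes_in_image[OF assms(2), of i] that by simp
  moreover have "(\<Sum>i<N. (x \<circ> \<pi>) i) = (\<Sum>i<N. x i)" using sum.permute[OF assms(2), of x] by simp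
  ultimately show ?thesis using assms(1) by (simp add: prob_def)
qed

lemma sum_N_pairs: "(\<Sum>i<N. f i) = (\<Sum>k<N div 2. f (2 * k) + f (2 * k + 1) :: real)"
  using sum_pairs[of f "N div 2"] N_even by simp

text \<open>Damping conserves the population of each even-odd pair, so the totals are compared
  pairwise.\<close>

lemma prob_damp:
  assumes "prob x" "0 \<le> l" "l \<le> 1"
  shows "prob (damp l x)"
proof -
  have "0 \<le> damp l x i" if i: "i < N" for i
    using assms i even_Suc_less[OF _ i] by (auto simp: damp_def prob_def)
  moreover have "(\<Sum>i<N. damp l x i) = (\<Sum>i<N. x i)"
    unfolding sum_N_pairs by (intro sum.cong refl) (simp add: damp_def algebra_simps)
  ultimately show ?thesis using assms(1) by (simp add: prob_def)
qed

text \<open>Phrased by equations and inequalities between continuous functions, rather than as the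
  image of probability vectors, so that closedness is immediate.\<close>

definition diag_states :: "fmat set" where
  "diag_states = {B. B \<in> supp_on N \<and> adj B = B \<and> (\<forall>i j. i \<noteq> j \<longrightarrow> ent B i j = 0) \<and>
     (\<forall>i. 0 \<le> Re (ent B i i)) \<and> tr B = 1}"

lemma diag_statesE:
  assumes "B \<in> diag_states"
  shows "\<exists>x. prob x \<and> B = dg x"
proof -
  have B: "B \<in> supp_on N" "adj B = B" "\<And>i j. i \<noteq> j \<Longrightarrow> ent B i j = 0" "\<And>i. 0 \<le> Re (ent B i i)" "tr B = 1"
    using assms by (simp_all add: diag_states_def)
  have real: "ent B i i = of_real (Re (ent B i i))" for i
  proof -
    have "cnj (ent B i i) = ent B i i" using ent_adj[of B i i] unfolding B(2) by (rule sym)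
    thus ?thesis by (simp add: complex_eq_iff)
  qed
  define x where "x i = Re (ent B i i)" for i
  have "of_real (\<Sum>i<N. x i) = tr B" unfolding tr_supp[OF B(1)] x_def of_real_sum by (simp only: real[symmetric])
  hence "(\<Sum>i<N. x i) = 1" unfolding B(5) of_real_eq_1_iff .
  hence "prob x" using B(4) by (simp add: prob_def x_def)
  moreover have "B = dg x"
  proof (rule supp_eqI[OF B(1) dg_supp])
    fix i j assume "i < N" "j < N"
    thus "ent B i j = ent (dg x) i j" using B(3)[of i j] real[of i] by (cases "i = j") (simp_all add: x_def)
  qed
  ultimately show ?thesis by blast
qed

lemma dg_diag_states: "prob x \<Longrightarrow> dg x \<in> diag_states"
proof -
  assume x: "prob x"
  have "adj (dg x) = dg x" by (rule fmat_eqI) simp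
  moreover have "tr (dg x) = 1"
    using x by (simp add: tr_supp[OF dg_supp] prob_def of_real_sum[symmetric] del: of_real_sum)
  ultimately show ?thesis using x by (simp add: diag_states_def prob_def)
qed

lemma closed_diag_states: "closed diag_states"
proof -
  have "closed {B. B \<in> supp_on N}" using closed_supp_on by simp
  moreover have "closed {B. i \<noteq> j \<longrightarrow> ent B i j = 0}" for i j
  proof (cases "i = j")
    case False
    have "closed {B. ent B i j = 0}" by (intro closed_Collect_eq continuous_intros)
    thus ?thesis using False by simp
  qed simp
  moreover have "closed {B. adj B = B}" by (intro closed_Collect_eq continuous_intros)
  moreover have "closed {B. 0 \<le> Re (ent B i i)}" for i
    by (intro closed_Collect_le continuous_intros)
  moreover have "closed {B. tr B = 1}" by (intro closed_Collect_eq continuous_intros)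
  ultimately show ?thesis
    unfolding diag_states_def by (intro closed_Collect_conj closed_Collect_all)
qed

lemma density_diagonalize:
  assumes A: "A \<in> densities N"
  shows "\<exists>U\<in>G. \<exists>x. prob x \<and> U * A * adj U = dg x"
proof -
  have As: "A \<in> supp_on N" "adj A = A" "psd_on N A" "tr A = 1" using A by (simp_all add: densities_def)
  obtain U where U: "U \<in> G" and diag: "\<forall>i j. i \<noteq> j \<longrightarrow> ent (U * A * adj U) i j = 0"
    using diagonalize_in_G[OF As(1,2)] ..
  let ?B = "U * A * adj U"
  have Us: "U \<in> supp_on N" using U by (rule G_supp)
  have Bs: "?B \<in> supp_on N" using Us As(1) by simp
  have "0 \<le> Re (ent ?B i i)" for i
  proof (cases "i < N")
    case True
    show ?thesis by (rule psd_on_diag[OF psd_on_conj[OF As(3) Us] Bs True])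
  next
    case False
    thus ?thesis using supp_onD[OF Bs, of i i] by simp
  qed
  moreover have "tr ?B = 1"
  proof -
    have "tr ?B = tr (adj U * (U * A))" by (rule tr_commute)
    thus ?thesis using unitary_on_cancel(1)[OF G_unitary[OF U] As(1)] As(4) by simp
  qed
  moreover have "adj ?B = ?B" by (simp add: As(2) mult.assoc)
  ultimately have "?B \<in> diag_states" using Bs diag by (simp add: diag_states_def)
  thus ?thesis using diag_statesE U by blast
qed

text \<open>Among the diagonal states in the closed reachable set, one with maximal ground state population
  must be pure: otherwise move some other population to the excited state paired with the ground
  state and damp a bit.\<close>

lemma reach_pure:
  assumes A: "A \<in> densities N"
  shows "dg unit_dist \<in> closure (reachable A)"
proof -
  have As: "A \<in> supp_on N" using A by (simp add: densities_def)
  define S where "S = closure (reachable A) \<inter> diag_states"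
  have "compact S"
  proof (rule compact_supp_bounded)
    show "closed S" unfolding S_def by (intro closed_Int closed_closure closed_diag_states)
    show "S \<subseteq> supp_on N" by (simp add: S_def diag_states_def subset_iff)
    fix B i j assume "B \<in> S"
    then obtain x where "prob x" "B = dg x" using diag_statesE by (auto simp: S_def)
    thus "cmod (ent B i j) \<le> 1"
      using prob_le_1[of x i] by (cases "i = j \<and> i < N") (auto simp: prob_def)
  qed
  moreover have "S \<noteq> {}"
  proof -
    obtain U x where "U \<in> G" "prob x" "U * A * adj U = dg x" using density_diagonalize[OF A] by blast
    hence "dg x \<in> S" using G_reach[OF _ As, of U] dg_diag_states[of x] by (simp add: S_def)
    thus ?thesis by blast
  qed
  ultimately have "\<exists>B\<in>S. \<forall>C\<in>S. Re (ent C 0 0) \<le> Re (ent B 0 0)"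
    by (intro continuous_attains_sup continuous_intros)
  then obtain B where B: "B \<in> S" and max: "\<forall>C\<in>S. Re (ent C 0 0) \<le> Re (ent B 0 0)" ..
  obtain x where x: "prob x" "B = dg x" using diag_statesE[of B] B by (auto simp: S_def)
  have N0: "0 < N" "1 < N" using N_ge2 by simp_all
  have "x j = 0" if j: "j < N" "j \<noteq> 0" for j
  proof (rule ccontr)
    assume "x j \<noteq> 0"
    hence xj: "0 < x j" using x(1) j(1) by (simp add: prob_def less_le)
    \<comment> \<open>The population \<open>x j\<close> goes to level 1, the partner of level 0;
      damping by one half then raises the ground population by \<open>x j / 2\<close>.\<close>
    define y where "y = x \<circ> Transposition.transpose 1 j"
    have y: "prob y" unfolding y_def using x(1) permutes_swap_id[of 1 "{..<N}" j] N0 j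
      by (intro prob_permute) simp_all
    have 1: "dg x \<in> closure (reachable A)" using B x(2) by (simp add: S_def)
    have 2: "dg y \<in> closure (reachable (dg x))" unfolding y_def using N0(2) j(1) by (rule reach_transpose)
    have 3: "dg (damp (1/2) y) \<in> closure (reachable (dg y))" by (intro reach_damp) simp_all
    have "dg (damp (1/2) y) \<in> closure (reachable A)"
      by (rule closure_reachable_trans[OF closure_reachable_trans[OF 1 2 As] 3 As])
    moreover have "dg (damp (1/2) y) \<in> diag_states" using y by (intro dg_diag_states prob_damp) simp_all
    ultimately have "dg (damp (1/2) y) \<in> S" by (simp add: S_def)
    with max have "Re (ent (dg (damp (1/2) y)) 0 0) \<le> Re (ent B 0 0)" ..
    moreover have "y 0 = x 0" "y 1 = x j"
      using j(2) by (simp_all add: y_def Transposition.transpose_def)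
    ultimately show False using xj N0 by (simp add: x(2) damp_def)
  qed
  hence "dg x = dg unit_dist"
    using prob_concentrated[OF x(1) N0(1)] by (intro dg_cong) (simp add: unit_dist_def)
  thus ?thesis using B x(2) by (simp add: S_def)
qed

text \<open>Moving a support to an initial segment ensures that in every pair the even position is
  occupied whenever the odd one is.\<close>

lemma permute_support:
  assumes "S \<subseteq> {..<N}"
  shows "\<exists>\<pi>. \<pi> permutes {..<N} \<and> (\<forall>i<N. \<pi> i \<in> S \<longleftrightarrow> i < card S)"
proof -
  have fin: "finite S" using assms finite_subset by blast
  have le: "card S \<le> N" using card_mono[OF finite_lessThan assms] by simp
  obtain f where f: "bij_betw f {..<card S} S"
    using ex_bij_betw_nat_finite[OF fin] by (auto simp: atLeast0LessThan)
  have "card {card S..<N} = card ({..<N} - S)"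
    using card_Diff_subset[OF fin assms] by simp
  then obtain g where g: "bij_betw g {card S..<N} ({..<N} - S)"
    using finite_same_card_bij[of "{card S..<N}" "{..<N} - S"] by auto
  define \<pi> where "\<pi> i = (if i < card S then f i else if i < N then g i else i)" for i
  have 1: "bij_betw \<pi> {..<card S} S" using f by (subst bij_betw_cong[of _ \<pi> f]) (simp_all add: \<pi>_def)
  have 2: "bij_betw \<pi> {card S..<N} ({..<N} - S)"
    using g by (subst bij_betw_cong[of _ \<pi> g]) (simp_all add: \<pi>_def)
  have "bij_betw \<pi> ({..<card S} \<union> {card S..<N}) (S \<union> ({..<N} - S))"
    using 1 2 by (rule bij_betw_combine) blast
  moreover have "{..<card S} \<union> {card S..<N} = {..<N}" using le by auto
  moreover have "S \<union> ({..<N} - S) = {..<N}" using assms by auto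
  ultimately have "bij_betw \<pi> {..<N} {..<N}" by simp
  hence "\<pi> permutes {..<N}" by (rule bij_imp_permutes) (use le in \<open>simp add: \<pi>_def\<close>)
  moreover have "\<pi> i \<in> S \<longleftrightarrow> i < card S" if i: "i < N" for i
  proof (cases "i < card S")
    case True
    thus ?thesis using bij_betwE[OF 1] by simp
  next
    case False
    thus ?thesis using bij_betwE[OF 2] i by simp
  qed
  ultimately show ?thesis by blast
qed

text \<open>Backwards in time, damping moves population from the even to the odd position of every pair.
  Running it until the first even position is empty reduces the support of the target.\<close>

lemma reach_from_pure:
  assumes "prob y"
  shows "dg y \<in> closure (reachable (dg unit_dist))"
  using assms
proof (induction "card {i. i < N \<and> 0 < y i}" arbitrary: y rule: less_induct)
  case less
  define S where "S = {i. i < N \<and> 0 < y i}"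
  have S: "S \<subseteq> {..<N}" "finite S" by (auto simp: S_def)
  have y0: "y i = 0" if "i < N" "i \<notin> S" for i
    using less.prems that by (auto simp: prob_def S_def)
  have "S \<noteq> {}"
  proof
    assume "S = {}"
    hence "(\<Sum>i<N. y i) = 0" using y0 by (intro sum.neutral) simp
    thus False using less.prems by (simp add: prob_def)
  qed
  hence "0 < card S" using S(2) by (simp add: card_gt_0_iff)
  show ?case
  proof (cases "card S = 1")
    case True
    then obtain p where p: "S = {p}" by (auto simp: card_1_singleton_iff)
    hence "p < N" using S by auto
    have "dg (unit_dist \<circ> Transposition.transpose 0 p) \<in> closure (reachable (dg unit_dist))"
      using \<open>p < N\<close> by (intro reach_transpose) simp_all
    moreover have "dg (unit_dist \<circ> Transposition.transpose 0 p) = dg y"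
    proof (rule dg_cong)
      fix i assume "i < N"
      hence "y i = (if i = p then 1 else 0)"
        using y0 p by (intro prob_concentrated[OF less.prems \<open>p < N\<close>]) simp_all
      thus "(unit_dist \<circ> Transposition.transpose 0 p) i = y i"
        by (auto simp: unit_dist_def Transposition.transpose_def)
    qed
    ultimately show ?thesis by simp
  next
    case False
    hence c2: "2 \<le> card S" using \<open>0 < card S\<close> by simp
    obtain \<pi> where \<pi>: "\<pi> permutes {..<N}" "\<And>i. i < N \<Longrightarrow> \<pi> i \<in> S \<longleftrightarrow> i < card S"
      using permute_support[OF S(1)] by blast
    \<comment> \<open>The support of \<open>z\<close> is an initial segment of length at least two,
      so both members of the first pair are occupied.\<close>
    define z where "z = y \<circ> \<pi>"
    have z: "prob z" unfolding z_def using less.prems \<pi>(1) by (rule prob_permute)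
    have z_ge: "0 \<le> z i" if "i < N" for i using z that by (simp add: prob_def)
    have \<pi>N: "\<pi> i < N" if "i < N" for i using permutes_in_image[OF \<pi>(1), of i] that by simp
    have z_pos: "0 < z i \<longleftrightarrow> i < card S" if "i < N" for i
      using \<pi>(2)[OF that] \<pi>N[OF that] by (simp add: z_def S_def)
    have supp_z: "{i. i < N \<and> 0 < z i} = {..<card S}"
      using z_pos card_mono[OF finite_lessThan S(1)] by auto
    define I where "I = {k. 2 * k + 1 < N \<and> 0 < z (2 * k + 1)}"
    have I_fin: "finite I" by (rule finite_subset[of _ "{..<N}"]) (auto simp: I_def)
    have I0: "0 \<in> I" using c2 N_ge2 z_pos[of 1] by (simp add: I_def)
    \<comment> \<open>The largest \<open>r\<close> for which every even entry of the vector
      \<open>x\<close> below stays nonnegative. At a pair \<open>m\<close> attaining the minimum the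
      even entry becomes exactly zero, which shrinks the support.\<close>
    define r where "r = Min ((\<lambda>k. z (2 * k) / z (2 * k + 1)) ` I)"
    have "r \<in> (\<lambda>k. z (2 * k) / z (2 * k + 1)) ` I"
      unfolding r_def using I_fin I0 by (intro Min_in) auto
    then obtain m where m: "m \<in> I" "r = z (2 * m) / z (2 * m + 1)" by blast
    have zm: "2 * m + 1 < N" "0 < z (2 * m + 1)" using m(1) by (simp_all add: I_def)
    have zm2: "0 < z (2 * m)" using z_pos[of "2 * m"] z_pos[of "2 * m + 1"] zm by simp
    have r: "0 < r" using zm zm2 m(2) by simp
    have r_le: "r * z (i + 1) \<le> z i" if i: "even i" "i < N" for i
    proof (cases "0 < z (i + 1)")
      case True
      have "i + 1 < N" using even_Suc_less[OF i] by simp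
      hence "i div 2 \<in> I" using i True by (simp add: I_def)
      hence "r \<le> z (2 * (i div 2)) / z (2 * (i div 2) + 1)"
        unfolding r_def using I_fin by (intro Min_le) auto
      thus ?thesis using i True by (simp add: field_simps)
    next
      case False
      hence "z (i + 1) = 0" using z_ge[of "i + 1"] even_Suc_less[OF i] by simp
      thus ?thesis using z_ge[OF i(2)] by simp
    qed
    \<comment> \<open>The preimage of \<open>z\<close> under damping with
      \<open>l = 1 / (1 + r)\<close>; pair sums are unchanged.\<close>
    define x where "x i = (if even i then z i - r * z (i + 1) else (1 + r) * z i)" for i
    have x: "prob x"
      unfolding prob_def
    proof
      show "\<forall>i<N. 0 \<le> x i" using r_le r z_ge by (simp add: x_def)
      have "(\<Sum>i<N. x i) = (\<Sum>i<N. z i)"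
        unfolding sum_N_pairs by (intro sum.cong refl) (simp add: x_def algebra_simps)
      thus "(\<Sum>i<N. x i) = 1" using z by (simp add: prob_def)
    qed
    have "{i. i < N \<and> 0 < x i} \<subset> {i. i < N \<and> 0 < z i}"
    proof
      show "{i. i < N \<and> 0 < x i} \<subseteq> {i. i < N \<and> 0 < z i}"
      proof
        fix i assume "i \<in> {i. i < N \<and> 0 < x i}"
        hence i: "i < N" "0 < x i" by simp_all
        have "0 < z i"
        proof (cases "even i")
          case True
          have "0 \<le> r * z (i + 1)" using r z_ge[of "i + 1"] even_Suc_less[OF True i(1)] by simp
          thus ?thesis using i(2) True by (simp add: x_def)
        next
          case False
          thus ?thesis using i r by (simp add: x_def zero_less_mult_iff)
        qed
        thus "i \<in> {i. i < N \<and> 0 < z i}" using i(1) by simp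
      qed
      have "x (2 * m) = 0" using m(2) zm by (simp add: x_def)
      hence "2 * m \<notin> {i. i < N \<and> 0 < x i}" by simp
      moreover have "2 * m \<in> {i. i < N \<and> 0 < z i}" using zm zm2 by simp
      ultimately show "{i. i < N \<and> 0 < x i} \<noteq> {i. i < N \<and> 0 < z i}" by blast
    qed
    hence "card {i. i < N \<and> 0 < x i} < card {i. i < N \<and> 0 < z i}" by (intro psubset_card_mono) simp_all
    hence "card {i. i < N \<and> 0 < x i} < card {i. i < N \<and> 0 < y i}" by (simp add: supp_z S_def)
    hence xr: "dg x \<in> closure (reachable (dg unit_dist))" using x by (rule less.hyps)
    have "dg (damp (1 / (1 + r)) x) = dg z"
    proof (rule dg_cong)
      fix i
      have "(1 - 1 / (1 + r)) * ((1 + r) * z (i + 1)) = r * z (i + 1)" using r by (simp add: field_simps)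
      thus "damp (1 / (1 + r)) x i = z i" using r by (simp add: damp_def x_def)
    qed
    moreover have "dg (damp (1 / (1 + r)) x) \<in> closure (reachable (dg x))"
      using r by (intro reach_damp) simp_all
    ultimately have "dg z \<in> closure (reachable (dg x))" by (simp only:)
    note zr = closure_reachable_trans[OF xr this dg_supp]
    have "dg (z \<circ> inv_into UNIV \<pi>) \<in> closure (reachable (dg z))"
      by (rule reach_permute[OF permutes_inv[OF \<pi>(1)]])
    moreover have "z \<circ> inv_into UNIV \<pi> = y"
      using permutes_inv_o(1)[OF \<pi>(1)] by (simp add: z_def comp_assoc)
    ultimately have "dg y \<in> closure (reachable (dg z))" by (simp only:)
    from closure_reachable_trans[OF zr this dg_supp] show ?thesis .
  qed
qed

text \<open>The route is from \<open>A\<close> to the ground state, then to a diagonal form of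
  \<open>B\<close>, then to \<open>B\<close>. The last leg undoes the diagonalising unitary and so
  relies on \<open>G_adj\<close>.\<close>

theorem densities_in_closure_reachable:
  assumes A: "A \<in> densities N" and B: "B \<in> densities N"
  shows "B \<in> closure (reachable A)"
proof -
  have As: "A \<in> supp_on N" and Bs: "B \<in> supp_on N" using A B by (simp_all add: densities_def)
  obtain U y where U: "U \<in> G" and y: "prob y" "U * B * adj U = dg y"
    using density_diagonalize[OF B] by blast
  have "adj U * dg y * adj (adj U) \<in> closure (reachable (dg y))"
    by (rule G_reach[OF G_adj[OF U] dg_supp])
  moreover have "adj U * dg y * adj (adj U) = B"
    using unitary_on_cancel(1)[OF G_unitary[OF U], of "B * adj U * U"]
      unitary_on_cancel(4)[OF G_unitary[OF U] Bs] Bs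
    by (simp add: y(2)[symmetric] mult.assoc)
  ultimately have "B \<in> closure (reachable (dg y))" by (simp only:)
  with closure_reachable_trans[OF reach_pure[OF A] reach_from_pure[OF y(1)] As]
  show ?thesis using As by (rule closure_reachable_trans)
qed

end



section \<open>Transfer to the concrete control system\<close>

definition of_mat :: "nat \<Rightarrow> complex mat \<Rightarrow> fmat" where
  "of_mat n A = cutoff n (\<lambda>i j. A $$ (i,j))"

lemma ent_of_mat [simp]: "ent (of_mat n A) i j = (if i < n \<and> j < n then A $$ (i,j) else 0)"
  by (simp add: of_mat_def)

lemma of_mat_supp [simp, intro]: "of_mat n A \<in> supp_on n"
  by (simp add: of_mat_def)

lemma to_mat_of_mat: "A \<in> carrier_mat n n \<Longrightarrow> to_mat n (of_mat n A) = A"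
  by (rule eq_matI) (auto simp: to_mat_def)

lemma of_mat_to_mat: "X \<in> supp_on n \<Longrightarrow> of_mat n (to_mat n X) = X"
  by (rule supp_eqI[of _ n]) (simp_all add: to_mat_def)

lemma of_mat_mult:
  assumes A: "A \<in> carrier_mat n n" and B: "B \<in> carrier_mat n n"
  shows "of_mat n (A * B) = of_mat n A * of_mat n B"
proof (rule supp_eqI[of _ n])
  fix i j assume ij: "i < n" "j < n"
  have "(A * B) $$ (i,j) = (\<Sum>k<n. A $$ (i,k) * B $$ (k,j))"
    using A B ij by (simp add: scalar_prod_def atLeast0LessThan)
  also have "\<dots> = ent (of_mat n A * of_mat n B) i j"
    using ij by (simp add: ent_mult[OF of_mat_supp])
  finally show "ent (of_mat n (A * B)) i j = ent (of_mat n A * of_mat n B) i j" using ij by simp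
qed simp_all

lemma of_mat_add:
  assumes A: "A \<in> carrier_mat n n" and B: "B \<in> carrier_mat n n"
  shows "of_mat n (A + B) = of_mat n A + of_mat n B"
  by (rule supp_eqI[of _ n]) (use A B in simp_all)

lemma of_mat_minus:
  assumes A: "A \<in> carrier_mat n n" and B: "B \<in> carrier_mat n n"
  shows "of_mat n (A - B) = of_mat n A - of_mat n B"
  by (rule supp_eqI[of _ n]) (use A B in simp_all)

lemma of_mat_uminus:
  assumes A: "A \<in> carrier_mat n n"
  shows "of_mat n (- A) = - of_mat n A"
  by (rule supp_eqI[of _ n]) (use A in simp_all)

lemma of_mat_smult:
  assumes A: "A \<in> carrier_mat n n"
  shows "of_mat n (z \<cdot>\<^sub>m A) = csc z (of_mat n A)"
  by (rule supp_eqI[of _ n]) (use A in simp_all)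

lemma mat_adjoint_carrier [simp]: "A \<in> carrier_mat n n \<Longrightarrow> mat_adjoint A \<in> carrier_mat n n"
  unfolding mat_adjoint_def
  using mat_of_rows_carrier(1)[of "dim_row A" "map conjugate (cols A)"] by (simp only: carrier_matD length_map cols_length)

lemma mat_adjoint_index:
  "A \<in> carrier_mat n n \<Longrightarrow> i < n \<Longrightarrow> j < n \<Longrightarrow> mat_adjoint A $$ (i,j) = cnj (A $$ (j,i))"
  by (simp add: mat_adjoint_def mat_of_rows_index)

lemma of_mat_adjoint: "A \<in> carrier_mat n n \<Longrightarrow> of_mat n (mat_adjoint A) = adj (of_mat n A)"
  by (rule supp_eqI[of _ n]) (simp_all add: mat_adjoint_index)

lemma of_mat_inject:
  assumes "of_mat n A = of_mat n B" "A \<in> carrier_mat n n" "B \<in> carrier_mat n n"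
  shows "A = B"
  using arg_cong[OF assms(1), of "to_mat n"] by (simp only: to_mat_of_mat[OF assms(2)] to_mat_of_mat[OF assms(3)])

lemma mtrace_eq: "A \<in> carrier_mat n n \<Longrightarrow> mtrace A = tr (of_mat n A)"
  by (simp add: mtrace_def tr_supp[OF of_mat_supp])

text \<open>The l2 norm of the entries is at most their l1 norm, so approximation in the algebra
  norm carries over to the Frobenius norm.\<close>

lemma frob_norm_le:
  assumes "A \<in> carrier_mat n n"
  shows "frob_norm A \<le> norm (of_mat n A)"
proof -
  have "frob_norm A = L2_set (\<lambda>(i,j). cmod (A $$ (i,j))) ({..<n} \<times> {..<n})"
    using assms by (simp add: frob_norm_def L2_set_def sum.cartesian_product case_prod_unfold)
  also have "\<dots> \<le> (\<Sum>(i,j)\<in>{..<n} \<times> {..<n}. cmod (A $$ (i,j)))"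
    by (rule L2_set_le_sum) auto
  also have "\<dots> = norm (of_mat n A)"
    by (simp add: norm_supp[OF of_mat_supp] sum.cartesian_product case_prod_unfold)
  finally show ?thesis .
qed

lemma quadratic_form_eq:
  assumes A: "A \<in> carrier_mat n n" and v: "v \<in> carrier_vec n" and X: "X \<in> supp_on n"
    and Xv: "\<And>i. i < n \<Longrightarrow> ent X i 0 = v $ i"
  shows "(A *\<^sub>v v) \<bullet>c v = ent (adj X * of_mat n A * X) 0 0"
proof -
  have "(A *\<^sub>v v) \<bullet>c v = (\<Sum>i<n. (\<Sum>j<n. A $$ (i,j) * v $ j) * cnj (v $ i))"
    using A v by (simp add: scalar_prod_def atLeast0LessThan)
  also have "\<dots> = (\<Sum>i<n. \<Sum>j<n. cnj (v $ i) * A $$ (i,j) * v $ j)"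
    unfolding sum_distrib_right by (simp only: mult_ac)
  also have "\<dots> = (\<Sum>j<n. \<Sum>i<n. cnj (v $ i) * A $$ (i,j) * v $ j)" by (rule sum.swap)
  also have "\<dots> = ent (adj X * of_mat n A * X) 0 0"
    using X by (simp add: ent_mult'[OF X] ent_mult'[OF of_mat_supp] sum_distrib_right Xv)
  finally show ?thesis .
qed

text \<open>The order on complex numbers in \<open>density_ops\<close> also demands a vanishing
  imaginary part, whereas \<open>psd_on\<close> bounds only the real part. Self-adjointness closes
  the gap.\<close>

lemma density_ops_iff:
  "A \<in> density_ops n \<longleftrightarrow> A \<in> carrier_mat n n \<and> of_mat n A \<in> densities n"
proof (cases "A \<in> carrier_mat n n")
  case A: True
  have herm: "mat_adjoint A = A \<longleftrightarrow> adj (of_mat n A) = of_mat n A"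
  proof
    assume "mat_adjoint A = A"
    thus "adj (of_mat n A) = of_mat n A" using of_mat_adjoint[OF A] by simp
  next
    assume "adj (of_mat n A) = of_mat n A"
    hence "of_mat n (mat_adjoint A) = of_mat n A" by (simp only: of_mat_adjoint[OF A])
    thus "mat_adjoint A = A" using mat_adjoint_carrier[OF A] A by (rule of_mat_inject)
  qed
  have "(\<forall>v\<in>carrier_vec n. 0 \<le> (A *\<^sub>v v) \<bullet>c v) \<longleftrightarrow> psd_on n (of_mat n A)"
    if h: "adj (of_mat n A) = of_mat n A"
  proof
    assume pos: "\<forall>v\<in>carrier_vec n. 0 \<le> (A *\<^sub>v v) \<bullet>c v"
    show "psd_on n (of_mat n A)"
      unfolding psd_on_def
    proof
      fix X assume X: "X \<in> supp_on n"
      have "(A *\<^sub>v vec n (\<lambda>i. ent X i 0)) \<bullet>c vec n (\<lambda>i. ent X i 0) = ent (adj X * of_mat n A * X) 0 0"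
        by (rule quadratic_form_eq[OF A _ X]) simp_all
      moreover have "0 \<le> (A *\<^sub>v vec n (\<lambda>i. ent X i 0)) \<bullet>c vec n (\<lambda>i. ent X i 0)"
        using pos by (rule bspec) simp
      ultimately show "0 \<le> Re (ent (adj X * of_mat n A * X) 0 0)" by (simp add: less_eq_complex_def)
    qed
  next
    assume psd: "psd_on n (of_mat n A)"
    show "\<forall>v\<in>carrier_vec n. 0 \<le> (A *\<^sub>v v) \<bullet>c v"
    proof
      fix v :: "complex vec" assume v: "v \<in> carrier_vec n"
      define X where "X = cutoff n (\<lambda>i j. if j = 0 then v $ i else 0)"
      have X: "X \<in> supp_on n" by (simp add: X_def)
      have eq: "(A *\<^sub>v v) \<bullet>c v = ent (adj X * of_mat n A * X) 0 0"
        by (rule quadratic_form_eq[OF A v X]) (simp add: X_def)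
      have "cnj (ent (adj X * of_mat n A * X) 0 0) = ent (adj (adj X * of_mat n A * X)) 0 0"
        by (rule ent_adj[symmetric])
      also have "adj (adj X * of_mat n A * X) = adj X * of_mat n A * X" by (simp add: h mult.assoc)
      finally have "cnj (ent (adj X * of_mat n A * X) 0 0) = ent (adj X * of_mat n A * X) 0 0" .
      hence "Im (ent (adj X * of_mat n A * X) 0 0) = 0" by (simp add: complex_eq_iff)
      moreover have "0 \<le> Re (ent (adj X * of_mat n A * X) 0 0)" using psd X by (simp add: psd_on_def)
      ultimately show "0 \<le> (A *\<^sub>v v) \<bullet>c v" unfolding eq by (simp add: less_eq_complex_def)
    qed
  qed
  thus ?thesis
    using A herm by (auto simp: density_ops_def densities_def hermitian_mat_def mtrace_eq)
next
  case False
  thus ?thesis by (simp add: density_ops_def hermitian_mat_def)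
qed

lemma foldr_ham:
  assumes "A0 \<in> carrier_mat n n" "\<And>j. j \<in> set js \<Longrightarrow> H j \<in> carrier_mat n n"
  shows "foldr (\<lambda>j A. A + complex_of_real (u j) \<cdot>\<^sub>m H j) js A0 \<in> carrier_mat n n \<and>
    of_mat n (foldr (\<lambda>j A. A + complex_of_real (u j) \<cdot>\<^sub>m H j) js A0) =
      of_mat n A0 + (\<Sum>j\<leftarrow>js. u j *\<^sub>R of_mat n (H j))"
  using assms(2)
proof (induction js)
  case Nil
  thus ?case using assms(1) by simp
next
  case (Cons j js)
  let ?F = "foldr (\<lambda>j A. A + complex_of_real (u j) \<cdot>\<^sub>m H j) js A0"
  have F: "?F \<in> carrier_mat n n" "of_mat n ?F = of_mat n A0 + (\<Sum>j\<leftarrow>js. u j *\<^sub>R of_mat n (H j))"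
    using Cons by simp_all
  have Hj: "H j \<in> carrier_mat n n" "complex_of_real (u j) \<cdot>\<^sub>m H j \<in> carrier_mat n n"
    using Cons.prems by simp_all
  have "of_mat n (?F + complex_of_real (u j) \<cdot>\<^sub>m H j) = of_mat n ?F + u j *\<^sub>R of_mat n (H j)"
    using of_mat_add[OF F(1) Hj(2)] of_mat_smult[OF Hj(1)] by simp
  thus ?case using F Hj by (simp add: add_ac)
qed

section \<open>The given matrix system as an instance of the abstract one\<close>

locale control_system =
  fixes N m :: nat and H :: "nat \<Rightarrow> complex mat" and Vm :: "complex mat" and \<gamma>s :: real
  assumes H_herm: "j \<le> m \<Longrightarrow> hermitian_mat N (H j)"
    and Vm_carrier: "Vm \<in> carrier_mat N N"
    and gs_pos: "0 < \<gamma>s"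
begin

lemma H_carrier: "j \<le> m \<Longrightarrow> H j \<in> carrier_mat N N"
  using H_herm by (simp add: hermitian_mat_def)

lemma H_adj: "j \<le> m \<Longrightarrow> adj (of_mat N (H j)) = of_mat N (H j)"
  using H_herm[of j] of_mat_adjoint[of "H j" N] by (simp add: hermitian_mat_def)

lemma ham_carrier: "ham m H u \<in> carrier_mat N N"
  and of_mat_ham: "of_mat N (ham m H u) = of_mat N (H 0) + (\<Sum>j\<in>{1..<Suc m}. u j *\<^sub>R of_mat N (H j))"
proof -
  have *: "foldr (\<lambda>j A. A + complex_of_real (u j) \<cdot>\<^sub>m H j) [1..<Suc m] (H 0) \<in> carrier_mat N N \<and>
    of_mat N (foldr (\<lambda>j A. A + complex_of_real (u j) \<cdot>\<^sub>m H j) [1..<Suc m] (H 0)) =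
      of_mat N (H 0) + (\<Sum>j\<leftarrow>[1..<Suc m]. u j *\<^sub>R of_mat N (H j))"
    by (rule foldr_ham) (auto intro: H_carrier)
  show "ham m H u \<in> carrier_mat N N" using * unfolding ham_def by (rule conjunct1)
  have "(\<Sum>j\<leftarrow>[1..<Suc m]. u j *\<^sub>R of_mat N (H j)) = (\<Sum>j\<in>{1..<Suc m}. u j *\<^sub>R of_mat N (H j))"
    by (subst sum_list_distinct_conv_sum_set) (simp_all del: upt_Suc)
  thus "of_mat N (ham m H u) = of_mat N (H 0) + (\<Sum>j\<in>{1..<Suc m}. u j *\<^sub>R of_mat N (H j))"
    using * unfolding ham_def by simp
qed

lemma adj_sum: "adj (\<Sum>j\<in>J. f j) = (\<Sum>j\<in>J. adj (f j))"
  by (rule fmat_eqI) simp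

sublocale lindblad N "\<lambda>u. of_mat N (ham m H u)" "of_mat N Vm" \<gamma>s
proof
  show "adj (of_mat N (ham m H u)) = of_mat N (ham m H u)" for u
    unfolding of_mat_ham by (simp add: adj_sum H_adj)
qed (simp_all add: gs_pos)

text \<open>The minus signs of \<open>gen_rhs\<close> and \<open>Gamma_op\<close> cancel on the
  dissipator; its anticommutator part is absorbed into \<open>K\<close>.\<close>

lemma of_mat_gen_rhs:
  assumes R: "R \<in> carrier_mat N N"
  shows "of_mat N (gen_rhs m H Vm u \<gamma> R) = L u \<gamma> (of_mat N R)"
proof -
  let ?H = "ham m H u" and ?W = "mat_adjoint Vm"
  let ?a = "of_mat N R" and ?h = "of_mat N ?H" and ?v = "of_mat N Vm"
  note mc = mult_carrier_mat[of _ N N _ N]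
  note H = ham_carrier[of u] and V = Vm_carrier
  have W: "?W \<in> carrier_mat N N" using V by (rule mat_adjoint_carrier)
  have HR: "?H * R \<in> carrier_mat N N" "R * ?H \<in> carrier_mat N N" by (intro mc R H)+
  have WV: "?W * Vm \<in> carrier_mat N N" by (intro mc W V)
  have WVR: "?W * Vm * R \<in> carrier_mat N N" "R * (?W * Vm) \<in> carrier_mat N N" by (intro mc WV R)+
  have VRW: "Vm * R \<in> carrier_mat N N" "Vm * R * ?W \<in> carrier_mat N N" by (intro mc V R W)+
  let ?C = "?H * R - R * ?H" and ?S = "?W * Vm * R + R * (?W * Vm)"
  have C: "?C \<in> carrier_mat N N" "of_mat N ?C = ?h * ?a - ?a * ?h"
    by (rule minus_carrier_mat[OF HR(2)])
      (simp only: of_mat_minus[OF HR] of_mat_mult[OF H R] of_mat_mult[OF R H])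
  have S: "?S \<in> carrier_mat N N" "of_mat N ?S = adj ?v * ?v * ?a + ?a * (adj ?v * ?v)"
    by (rule add_carrier_mat[OF WVR(2)])
      (simp only: of_mat_add[OF WVR] of_mat_mult[OF WV R] of_mat_mult[OF R WV] of_mat_mult[OF W V] of_mat_adjoint[OF V])
  let ?D = "Vm * R * ?W - (1/2) \<cdot>\<^sub>m ?S"
  have D: "?D \<in> carrier_mat N N"
    "of_mat N ?D = ?v * ?a * adj ?v - csc (1/2) (adj ?v * ?v * ?a + ?a * (adj ?v * ?v))"
    by (rule minus_carrier_mat[OF smult_carrier_mat[OF S(1)]])
      (simp only: of_mat_minus[OF VRW(2) smult_carrier_mat[OF S(1)]] of_mat_smult[OF S(1)] S(2)
        of_mat_mult[OF VRW(1) W] of_mat_mult[OF V R] of_mat_adjoint[OF V])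
  have gD: "complex_of_real \<gamma> \<cdot>\<^sub>m ?D \<in> carrier_mat N N" "- (complex_of_real \<gamma> \<cdot>\<^sub>m ?D) \<in> carrier_mat N N"
    using D(1) by simp_all
  have iC: "\<i> \<cdot>\<^sub>m ?C \<in> carrier_mat N N" using C(1) by simp
  have "of_mat N (gen_rhs m H Vm u \<gamma> R) = - (csc \<i> (?h * ?a - ?a * ?h) +
      - (csc (of_real \<gamma>) (?v * ?a * adj ?v - csc (1/2) (adj ?v * ?v * ?a + ?a * (adj ?v * ?v)))))"
    unfolding gen_rhs_def Gamma_op_def commut_def
    by (simp only: of_mat_uminus[OF add_carrier_mat[OF gD(2)]] of_mat_add[OF iC gD(2)]
        of_mat_smult[OF C(1)] of_mat_uminus[OF gD(1)] of_mat_smult[OF D(1)] C(2) D(2))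
  also have "\<dots> = L u \<gamma> ?a"
    unfolding L_def K_def
    by (rule fmat_eqI) (simp add: left_diff_distrib right_diff_distrib csc_diff csc_add
        scaleR_add_right mult.assoc algebra_simps)
  finally show ?thesis .
qed

lemma piece_step_imp_flow:
  assumes "piece_step N m H Vm u \<gamma> \<tau> R0 R1"
  shows "flow u \<gamma> \<tau> (of_mat N R0) (of_mat N R1) \<and> R1 \<in> carrier_mat N N"
proof -
  obtain r where \<tau>: "0 \<le> \<tau>" and r: "r 0 = R0" "r \<tau> = R1" and r': "\<forall>t\<in>{0..\<tau>}. r t \<in> carrier_mat N N \<and>
     (\<forall>i<N. \<forall>j<N. ((\<lambda>s. r s $$ (i,j)) has_vector_derivative
         (gen_rhs m H Vm u \<gamma> (r t)) $$ (i,j)) (at t within {0..\<tau>}))"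
    using assms unfolding piece_step_def by blast
  have "flow u \<gamma> \<tau> (of_mat N R0) (of_mat N R1)"
  proof (rule flowI[of \<tau> "\<lambda>t. of_mat N (r t)"])
    fix t assume t: "t \<in> {0..\<tau>}"
    hence rt: "r t \<in> carrier_mat N N" using r' by blast
    show "((\<lambda>t. of_mat N (r t)) has_vector_derivative L u \<gamma> (of_mat N (r t))) (at t within {0..\<tau>})"
    proof (rule has_vector_derivative_fmat[OF of_mat_supp L_supp[OF of_mat_supp] t])
      fix i j assume ij: "i < N" "j < N"
      have "((\<lambda>s. r s $$ (i,j)) has_vector_derivative (gen_rhs m H Vm u \<gamma> (r t)) $$ (i,j)) (at t within {0..\<tau>})"
        using r' t ij by blast
      moreover have "(gen_rhs m H Vm u \<gamma> (r t)) $$ (i,j) = ent (L u \<gamma> (of_mat N (r t))) i j"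
        using ij by (simp add: of_mat_gen_rhs[OF rt, symmetric])
      ultimately show "((\<lambda>s. ent (of_mat N (r s)) i j) has_vector_derivative
          ent (L u \<gamma> (of_mat N (r t))) i j) (at t within {0..\<tau>})"
        using ij by simp
    qed
  qed (use \<tau> r in simp_all)
  moreover have "R1 \<in> carrier_mat N N" using r' r \<tau> by auto
  ultimately show ?thesis ..
qed

lemma flow_imp_piece_step:
  assumes "flow u \<gamma> \<tau> X Y"
  shows "piece_step N m H Vm u \<gamma> \<tau> (to_mat N X) (to_mat N Y)"
proof -
  obtain x where \<tau>: "0 \<le> \<tau>" and x: "x 0 = X" "x \<tau> = Y" and x': "\<forall>t\<in>{0..\<tau>}. x t \<in> supp_on N \<and>
    (x has_vector_derivative L u \<gamma> (x t)) (at t within {0..\<tau>})"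
    using assms unfolding flow_def by (elim conjE exE) (rule that)
  have "((\<lambda>s. to_mat N (x s) $$ (i,j)) has_vector_derivative
      gen_rhs m H Vm u \<gamma> (to_mat N (x t)) $$ (i,j)) (at t within {0..\<tau>})"
    if t: "t \<in> {0..\<tau>}" and ij: "i < N" "j < N" for t i j
  proof -
    have xt: "x t \<in> supp_on N" "(x has_vector_derivative L u \<gamma> (x t)) (at t within {0..\<tau>})"
      using bspec[OF x' t] by simp_all
    have "((\<lambda>s. ent (x s) i j) has_vector_derivative ent (L u \<gamma> (x t)) i j) (at t within {0..\<tau>})"
      by (rule bounded_linear.has_vector_derivative[OF bounded_linear_ent xt(2)])
    moreover have "gen_rhs m H Vm u \<gamma> (to_mat N (x t)) $$ (i,j) = ent (L u \<gamma> (x t)) i j"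
      using arg_cong[OF of_mat_gen_rhs[OF to_mat_carrier, of u \<gamma> "x t"], of "\<lambda>A. ent A i j"] ij
      by (simp add: of_mat_to_mat[OF xt(1)])
    moreover have "to_mat N (x s) $$ (i,j) = ent (x s) i j" for s using ij by (simp add: to_mat_def)
    ultimately show ?thesis by (simp only:)
  qed
  thus ?thesis
    unfolding piece_step_def using \<tau> x by (intro conjI exI[of _ "\<lambda>t. to_mat N (x t)"] ballI allI impI) simp_all
qed

lemma reach_imp_reachable:
  assumes "R \<in> reach N m H Vm \<gamma>s R0" "R0 \<in> carrier_mat N N"
  shows "R \<in> carrier_mat N N \<and> of_mat N R \<in> reachable (of_mat N R0)"
  using assms(1)
proof (induction rule: reach.induct)
  case init
  thus ?case using assms(2) reachable.init by simp
next
  case (step R \<gamma> u \<tau> R')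
  have "flow u \<gamma> \<tau> (of_mat N R) (of_mat N R')" "R' \<in> carrier_mat N N"
    using piece_step_imp_flow[OF step.hyps(3)] by simp_all
  thus ?case using reachable.step[OF conjunct2[OF step.IH] step.hyps(2)] by simp
qed

lemma reachable_imp_reach:
  assumes "X \<in> reachable (of_mat N R0)" "R0 \<in> carrier_mat N N"
  shows "to_mat N X \<in> reach N m H Vm \<gamma>s R0"
  using assms(1)
proof (induction rule: reachable.induct)
  case init
  thus ?case using reach.init by (simp add: to_mat_of_mat[OF assms(2)])
next
  case (step X \<gamma> u \<tau> Y)
  thus ?case using reach.step[OF step.IH step.hyps(2) flow_imp_piece_step[OF step.hyps(3)]] by simp
qed

text \<open>A control Hamiltonian never acts without the drift. Its direction is obtained as the
  difference of the tangent vectors for drift plus control and for drift alone.\<close>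

lemma control_T:
  assumes j: "j \<le> m"
  shows "csc \<i> (of_mat N (H j)) \<in> T"
proof -
  have ham_T: "csc \<i> (of_mat N (ham m H u)) \<in> T" for u
    using T_uminus[OF hamiltonian_T[of u]] by simp
  have drift: "of_mat N (ham m H (\<lambda>_. 0)) = of_mat N (H 0)" by (simp add: of_mat_ham)
  show ?thesis
  proof (cases "j = 0")
    case True
    thus ?thesis using ham_T[of "\<lambda>_. 0"] by (simp add: drift)
  next
    case False
    let ?u = "\<lambda>k. if k = j then 1 else 0 :: real"
    have "(\<Sum>k\<in>{1..<Suc m}. ?u k *\<^sub>R of_mat N (H k)) = (\<Sum>k\<in>{1..<Suc m}. if k = j then of_mat N (H j) else 0)"
      by (intro sum.cong refl) simp
    also have "\<dots> = of_mat N (H j)" using False j by (subst sum.delta) auto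
    finally have "of_mat N (ham m H ?u) = of_mat N (H 0) + of_mat N (H j)" by (simp add: of_mat_ham)
    hence "csc \<i> (of_mat N (H j)) = csc \<i> (of_mat N (ham m H ?u)) - csc \<i> (of_mat N (ham m H (\<lambda>_. 0)))"
      by (simp add: drift csc_add)
    thus ?thesis using T_diff[OF ham_T[of ?u] ham_T[of "\<lambda>_. 0"]] by (simp only:)
  qed
qed

lemma lie_gen_T:
  assumes "A \<in> lie_gen N ((\<lambda>j. \<i> \<cdot>\<^sub>m H j) ` {0..m})"
  shows "A \<in> carrier_mat N N \<and> of_mat N A \<in> T"
  using assms
proof (induction rule: lie_gen.induct)
  case (gen A)
  then obtain j where j: "j \<le> m" "A = \<i> \<cdot>\<^sub>m H j" by auto
  thus ?case using control_T[OF j(1)] H_carrier[OF j(1)] of_mat_smult[of "H j" N \<i>] by simp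
next
  case zero
  have "of_mat N (0\<^sub>m N N) = 0" by (rule supp_eqI[of _ N]) simp_all
  thus ?case using T_zero by simp
next
  case (add A B)
  thus ?case using T_add by (simp add: of_mat_add[of A N B])
next
  case (smult A r)
  thus ?case using T_scaleR[of "of_mat N A" r] by (simp add: of_mat_smult[of A N])
next
  case (bracket A B)
  hence A: "A \<in> carrier_mat N N" and B: "B \<in> carrier_mat N N" and "of_mat N A \<in> T" "of_mat N B \<in> T"
    by simp_all
  moreover have AB: "A * B \<in> carrier_mat N N" "B * A \<in> carrier_mat N N"
    by (rule mult_carrier_mat[OF A B], rule mult_carrier_mat[OF B A])
  moreover have "of_mat N (commut A B) = of_mat N A * of_mat N B - of_mat N B * of_mat N A"
    unfolding commut_def by (simp only: of_mat_minus[OF AB] of_mat_mult[OF A B] of_mat_mult[OF B A])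
  ultimately show ?case
    using T_bracket minus_carrier_mat[OF AB(2), of "A * B"] by (simp add: commut_def)
qed

end

theorem theorem1:
  fixes n m :: nat and H :: "nat \<Rightarrow> complex mat" and \<gamma>s :: real and \<rho>0 :: "complex mat"
  assumes "n \<ge> 1"
    and "\<forall>j\<le>m. hermitian_mat (2^n) (H j)"
    and "lie_gen (2^n) ((\<lambda>j. \<i> \<cdot>\<^sub>m H j) ` {0..m}) = su_alg (2^n)"
    and "diagonal_mat (H 0)"
    and "\<gamma>s > 0"
    and "\<rho>0 \<in> density_ops (2^n)"
  shows "reach (2^n) m H (V_ad n) \<gamma>s \<rho>0 \<subseteq> density_ops (2^n) \<and>
         (\<forall>\<rho>t \<in> density_ops (2^n). \<forall>\<epsilon>>0. \<exists>\<rho> \<in> reach (2^n) m H (V_ad n) \<gamma>s \<rho>0.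
              frob_norm (\<rho> - \<rho>t) < \<epsilon>)"
proof -
  define N :: nat where "N = 2 ^ n"
  interpret control_system N m H "V_ad n" \<gamma>s
    by standard (use assms in \<open>simp_all add: N_def V_ad_def\<close>)
  \<comment> \<open>Zero amplitudes leave the drift, which is diagonal by assumption.\<close>
  interpret amplitude_damping N "\<lambda>u. of_mat N (ham m H u)" "of_mat N (V_ad n)" \<gamma>s "\<lambda>_. 0"
  proof
    show "even N" using assms(1) by (simp add: N_def)
    show "2 \<le> N" using power_increasing[of 1 n "2::nat"] assms(1) by (simp add: N_def)
    show "of_mat N (V_ad n) = cutoff N (\<lambda>i j. if even i \<and> j = i + 1 then 1 else 0)"
      by (rule supp_eqI[of _ N]) (simp_all add: V_ad_def N_def)
    show "ent (of_mat N (ham m H (\<lambda>_. 0))) i j = 0" if "i \<noteq> j" for i j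
      using assms(4) H_carrier[of 0] that by (simp add: of_mat_ham diagonal_mat_def)
    \<comment> \<open>Read as a matrix, \<open>X\<close> belongs to su(N), hence to the generated
      Lie algebra, all of whose elements are tangent by \<open>lie_gen_T\<close>.\<close>
    show "X \<in> T" if X: "X \<in> supp_on N" "adj X = - X" "tr X = 0" for X
    proof -
      have inv: "of_mat N (to_mat N X) = X" by (rule of_mat_to_mat[OF X(1)])
      have "mat_adjoint (to_mat N X) = - to_mat N X"
      proof (rule of_mat_inject[of N])
        show "of_mat N (mat_adjoint (to_mat N X)) = of_mat N (- to_mat N X)"
          by (simp add: of_mat_adjoint[of _ N] of_mat_uminus[of _ N] inv X(2))
      qed simp_all
      moreover have "mtrace (to_mat N X) = 0" using mtrace_eq[of "to_mat N X" N] X(3) by (simp add: inv)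
      ultimately have "to_mat N X \<in> su_alg N" by (simp add: su_alg_def)
      hence "to_mat N X \<in> lie_gen N ((\<lambda>j. \<i> \<cdot>\<^sub>m H j) ` {0..m})" using assms(3) by (simp add: N_def)
      from lie_gen_T[OF this] show ?thesis by (simp add: inv)
    qed
  qed
  have dens: "R \<in> density_ops N \<longleftrightarrow> R \<in> carrier_mat N N \<and> of_mat N R \<in> densities N" for R
    by (rule density_ops_iff)
  have \<rho>0: "\<rho>0 \<in> carrier_mat N N" "of_mat N \<rho>0 \<in> densities N"
    using assms(6) dens[of \<rho>0] by (simp_all add: N_def)
  have "reach N m H (V_ad n) \<gamma>s \<rho>0 \<subseteq> density_ops N"
  proof
    fix R assume "R \<in> reach N m H (V_ad n) \<gamma>s \<rho>0"
    from reach_imp_reachable[OF this \<rho>0(1)] show "R \<in> density_ops N"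
      using reachable_densities[OF _ \<rho>0(2)] by (simp add: dens)
  qed
  moreover have "\<exists>R\<in>reach N m H (V_ad n) \<gamma>s \<rho>0. frob_norm (R - Rt) < \<epsilon>"
    if Rt: "Rt \<in> density_ops N" and \<epsilon>: "0 < \<epsilon>" for Rt \<epsilon>
  proof -
    have Rt': "Rt \<in> carrier_mat N N" "of_mat N Rt \<in> densities N" using Rt by (simp_all add: dens)
    obtain X where X: "X \<in> reachable (of_mat N \<rho>0)" "dist X (of_mat N Rt) < \<epsilon>"
      using densities_in_closure_reachable[OF \<rho>0(2) Rt'(2)] \<epsilon> unfolding closure_approachable by blast
    have Xs: "X \<in> supp_on N" using reachable_supp[OF X(1)] by simp
    have "frob_norm (to_mat N X - Rt) \<le> norm (of_mat N (to_mat N X - Rt))"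
      by (rule frob_norm_le[OF minus_carrier_mat[OF Rt'(1)]])
    also have "\<dots> = norm (X - of_mat N Rt)"
      by (simp add: of_mat_minus[OF to_mat_carrier Rt'(1)] of_mat_to_mat[OF Xs])
    also have "\<dots> < \<epsilon>" using X(2) by (simp add: dist_norm)
    finally show ?thesis using reachable_imp_reach[OF X(1) \<rho>0(1)] by (rule bexI)
  qed
  ultimately show ?thesis by (simp add: N_def)
qed


end
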